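(* Let $1\le p<\infty$ and $\omega\in\mathcal D=\widehat{\mathcal D}\cap\check{\mathcal D}$. Suppose $(\varphi_t)_{t\ge0}$ is a semigroup of analytic self-maps of $\mathbb D$ and $(C_t)_{t\ge0}$, $C_tf=f\circ\varphi_t$, is the corresponding composition semigroup on $A^p_\omega$. Then $(C_t)_{t\ge0}$ is an eventually norm-continuous operator semigroup on $A^p_\omega$ if and only if there exist $\gamma_0=\gamma_0(\omega)>0$ and $t_0>0$ such that for any $\gamma>\gamma_0$ and $t,s>t_0$ $$\lim_{s\to t}\ \sup_{a\in\mathbb D}\frac{(1-|a|)^{\gamma}}{\widehat\omega(a)}\int_{\mathbb D}\left(\frac{\delta^p(\varphi_t(z),\varphi_s(z))}{|1-\bar a\varphi_t(z)|^{\gamma+1}}+\frac{\delta^p(\varphi_t(z),\varphi_s(z))}{|1-\bar a\varphi_s(z)|^{\gamma+1}}\right)\omega(z)\,dA(z)=0.$$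
   Context: $\mathbb D=\{z\in\mathbb C:|z|<1\}$, $dA=\frac{dx\,dy}{\pi}$. A radial weight is a non-negative $\omega\in L^1(\mathbb D)$ with $\omega(z)=\omega(|z|)$. Put $\widehat\omega(z)=\int_{|z|}^1\omega(s)\,ds$; throughout, $\widehat\omega(z)>0$ for all $z\in\mathbb D$. A radial weight $\omega$ belongs to $\widehat{\mathcal D}$ if there is $C\ge1$ with $\widehat\omega(r)\le C\,\widehat\omega(\frac{1+r}{2})$ for all $0\le r<1$; it belongs to $\check{\mathcal D}$ if there are $K>1$ and $C>1$ with $\widehat\omega(r)\ge C\,\widehat\omega(1-\frac{1-r}{K})$ for all $0\le r<1$. $A^p_\omega$ consists of the analytic functions $f$ on $\mathbb D$ with $\|f\|_{A^p_\omega}^p=\int_{\mathbb D}|f|^p\omega\,dA<\infty$. A semigroup of analytic self-maps of $\mathbb D$ is a family $(\varphi_t)_{t\ge0}$ of analytic maps $\mathbb D\to\mathbb D$ with $\varphi_0=\mathrm{id}$, $\varphi_t\circ\varphi_s=\varphi_{t+s}$, and $\varphi_t(z)\to z$ as $t\to0^+$ for each $z\in\mathbb D$. The composition semigroup is eventually norm-continuous on $A^p_\omega$ if there is $t_0>0$ such that $\lim_{s\to t}\|C_s-C_t\|=0$ (operator norm) for all $t>t_0$. The pseudohyperbolic distance is $\delta(a,z)=\left|\frac{a-z}{1-\overline a z}\right|$, $a,z\in\mathbb D$. The notation $\gamma_0(\omega)$ means that $\gamma_0$ depends only on $\omega$. *)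

theory Defs
  imports "HOL-Complex_Analysis.Complex_Analysis"
begin

abbreviation unit_disc :: "complex set" where
  "unit_disc \<equiv> ball 0 1"

definition disc_area :: "complex measure" where
  "disc_area = scale_measure (ennreal (1 / pi)) (lebesgue_on unit_disc)"

text \<open>
  Weights and analytic functions on the disc are total functions on the complex plane; only
  their values on the disc matter. Integrals of non-negative functions are taken in the
  extended non-negative reals, so that divergent integrals have the value \<open>\<infinity>\<close> and
  not the default value 0 of the Bochner integral.
\<close>

definition radial_weight :: "(complex \<Rightarrow> real) \<Rightarrow> bool" where
  "radial_weight \<omega> \<longleftrightarrow>
     (\<forall>z\<in>unit_disc. \<omega> z \<ge> 0 \<and> \<omega> z = \<omega> (of_real (cmod z))) \<and> integrable disc_area \<omega>"

definition weight_hat :: "(complex \<Rightarrow> real) \<Rightarrow> complex \<Rightarrow> ennreal" where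
  "weight_hat \<omega> z = (\<integral>\<^sup>+ s\<in>{cmod z..<1}. ennreal (\<omega> (of_real s)) \<partial>lebesgue)"

definition D_hat :: "(complex \<Rightarrow> real) set" where
  "D_hat = {\<omega>. radial_weight \<omega> \<and> (\<forall>z\<in>unit_disc. weight_hat \<omega> z > 0) \<and>
     (\<exists>C::real. C \<ge> 1 \<and> (\<forall>r::real. 0 \<le> r \<and> r < 1 \<longrightarrow>
        weight_hat \<omega> (of_real r) \<le> ennreal C * weight_hat \<omega> (of_real ((1 + r) / 2))))}"

definition D_check :: "(complex \<Rightarrow> real) set" where
  "D_check = {\<omega>. radial_weight \<omega> \<and> (\<forall>z\<in>unit_disc. weight_hat \<omega> z > 0) \<and>
     (\<exists>K C::real. K > 1 \<and> C > 1 \<and> (\<forall>r::real. 0 \<le> r \<and> r < 1 \<longrightarrow>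
        weight_hat \<omega> (of_real r) \<ge> ennreal C * weight_hat \<omega> (of_real (1 - (1 - r) / K))))}"

definition bergman_integral ::
  "real \<Rightarrow> (complex \<Rightarrow> real) \<Rightarrow> (complex \<Rightarrow> complex) \<Rightarrow> ennreal" where
  "bergman_integral p \<omega> f = (\<integral>\<^sup>+ z. ennreal (cmod (f z) powr p * \<omega> z) \<partial>disc_area)"

definition bergman_space ::
  "real \<Rightarrow> (complex \<Rightarrow> real) \<Rightarrow> (complex \<Rightarrow> complex) set" where
  "bergman_space p \<omega> = {f. f holomorphic_on unit_disc \<and> bergman_integral p \<omega> f < \<infinity>}"

definition bergman_norm ::
  "real \<Rightarrow> (complex \<Rightarrow> real) \<Rightarrow> (complex \<Rightarrow> complex) \<Rightarrow> ennreal" where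
  "bergman_norm p \<omega> f =
     (if bergman_integral p \<omega> f = \<infinity> then \<infinity>
      else ennreal (enn2real (bergman_integral p \<omega> f) powr (1 / p)))"

definition bergman_opnorm ::
  "real \<Rightarrow> (complex \<Rightarrow> real) \<Rightarrow> ((complex \<Rightarrow> complex) \<Rightarrow> complex \<Rightarrow> complex) \<Rightarrow> ennreal" where
  "bergman_opnorm p \<omega> T =
     (SUP f\<in>{f \<in> bergman_space p \<omega>. bergman_norm p \<omega> f \<le> 1}. bergman_norm p \<omega> (T f))"

definition analytic_semigroup :: "(real \<Rightarrow> complex \<Rightarrow> complex) \<Rightarrow> bool" where
  "analytic_semigroup \<phi> \<longleftrightarrow>
     (\<forall>t\<ge>0. \<phi> t holomorphic_on unit_disc \<and> \<phi> t ` unit_disc \<subseteq> unit_disc) \<and>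
     (\<forall>z\<in>unit_disc. \<phi> 0 z = z) \<and>
     (\<forall>t\<ge>0. \<forall>s\<ge>0. \<forall>z\<in>unit_disc. \<phi> t (\<phi> s z) = \<phi> (t + s) z) \<and>
     (\<forall>z\<in>unit_disc. ((\<lambda>t. \<phi> t z) \<longlongrightarrow> z) (at_right 0))"

definition comp_op ::
  "(real \<Rightarrow> complex \<Rightarrow> complex) \<Rightarrow> real \<Rightarrow> (complex \<Rightarrow> complex) \<Rightarrow> complex \<Rightarrow> complex" where
  "comp_op \<phi> t f = f \<circ> \<phi> t"

definition eventually_norm_continuous ::
  "real \<Rightarrow> (complex \<Rightarrow> real) \<Rightarrow> (real \<Rightarrow> complex \<Rightarrow> complex) \<Rightarrow> bool" where
  "eventually_norm_continuous p \<omega> \<phi> \<longleftrightarrow>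
     (\<exists>t0>0. \<forall>t>t0.
        ((\<lambda>s. bergman_opnorm p \<omega> (\<lambda>f z. comp_op \<phi> s f z - comp_op \<phi> t f z)) \<longlongrightarrow> 0) (at t))"

definition pseudohyp :: "complex \<Rightarrow> complex \<Rightarrow> real" where
  "pseudohyp a z = cmod ((a - z) / (1 - cnj a * z))"

definition semigroup_test_sup ::
  "real \<Rightarrow> (complex \<Rightarrow> real) \<Rightarrow> (real \<Rightarrow> complex \<Rightarrow> complex) \<Rightarrow> real \<Rightarrow> real \<Rightarrow> real \<Rightarrow> ennreal" where
  "semigroup_test_sup p \<omega> \<phi> \<gamma> t s =
     (SUP a\<in>unit_disc.
        ennreal ((1 - cmod a) powr \<gamma>) / weight_hat \<omega> a *
        (\<integral>\<^sup>+ z. ennreal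
           ((pseudohyp (\<phi> t z) (\<phi> s z) powr p / cmod (1 - cnj a * \<phi> t z) powr (\<gamma> + 1) +
             pseudohyp (\<phi> t z) (\<phi> s z) powr p / cmod (1 - cnj a * \<phi> s z) powr (\<gamma> + 1)) * \<omega> z)
         \<partial>disc_area))"

end

theory Submission
  imports Defs
begin

text \<open>
  Only two self-maps \<open>u = \<phi>\<^sub>t\<close>, \<open>v = \<phi>\<^sub>s\<close> matter: the operator norm of the difference of the two composition
  operators, raised to the power \<open>p\<close>, is comparable with the supremum of the test integrals; the semigroup
  law plays no role. Two facts on the weight enter. On the one hand, \<open>D_hat\<close> bounds the weighted integral of
  the kernel \<open>1 / |1 - cnj a * z|\<close> to a large power. On the other hand, since integral means of \<open>|f|\<^sup>p\<close>
  increase with the radius, \<open>D_check\<close> shows that \<open>|f|\<^sup>p\<close> integrated against the regular weight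
  \<open>weight_hat \<omega> z / (1 - |z|)\<close> is bounded by its integral against \<open>\<omega>\<close>.

  For the upper bound of the norm, \<open>|f(u) - f(v)|\<^sup>p\<close> is at most \<open>\<delta>(u,v)\<^sup>p\<close> times local averages of \<open>|f|\<^sup>p\<close>
  around \<open>u\<close> and \<open>v\<close>; by Fubini this becomes an integral of \<open>|f|\<^sup>p\<close> against the test integrals. For the
  lower bound, testing on a kernel at \<open>a\<close> and on its product with the disc automorphism at \<open>a\<close> controls the
  integral of \<open>\<delta>(u,v)\<^sup>p\<close> over the points with \<open>u\<close> near \<open>a\<close>, and averaging over \<open>a\<close> recovers the test integrals.
\<close>

text \<open>A weight of the class may vanish on whole annuli, so point values of f cannot be
  averaged against \<open>\<omega>\<close> itself. The averages are taken in area measure over discs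
  whose radius is comparable to the distance to the boundary, and only after Fubini is the regular
  weight traded for \<open>\<omega>\<close>. This trade needs analyticity: |f|^p is pushed outwards
  to radii that \<open>\<omega>\<close> charges. The same trade, applied to the kernel 1 / (1 - cnj
  a * z) with exponent \<gamma> + 1, serves the converse direction and takes the place of a covering
  of the disc.

  The threshold for \<gamma> comes from the doubling constant \<open>Cd\<close>: the kernel integral
  is dominated by a geometric series of ratio Cd / 2^\<gamma>. All comparison constants are fixed
  before the pair of maps, which turns the two-sided estimate into an equivalence of limits.

  Weights are only Lebesgue measurable, and functions on the disc are arbitrary outside it. They are
  replaced by a Borel function of the radius and by zero extensions, so that Fubini takes place
  between Borel measures.\<close>

section \<open>Polar coordinates in the plane\<close>

lemma nn_integral_lborel_translate:
  fixes a :: "'a::euclidean_space"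
  assumes [measurable]: "F \<in> borel_measurable borel"
  shows "(\<integral>\<^sup>+x. F (a + x) \<partial>lborel) = (\<integral>\<^sup>+x. F x \<partial>lborel)"
proof -
  have "(\<integral>\<^sup>+x. F x \<partial>lborel) = (\<integral>\<^sup>+x. F x \<partial>distr lborel borel ((+) a))"
    by (simp add: lborel_distr_plus)
  also have "\<dots> = (\<integral>\<^sup>+x. F (a + x) \<partial>lborel)"
    by (subst nn_integral_distr) auto
  finally show ?thesis by simp
qed

lemma nn_integral_lborel_uminus:
  fixes F :: "'a::euclidean_space \<Rightarrow> ennreal"
  assumes [measurable]: "F \<in> borel_measurable borel"
  shows "(\<integral>\<^sup>+x. F (- x) \<partial>lborel) = (\<integral>\<^sup>+x. F x \<partial>lborel)"
proof -
  have *: "(lborel :: 'a measure) = distr lborel borel uminus"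
    using lborel_affine[of "-1" "0::'a"] by (simp add: density_1 one_ennreal_def[symmetric])
  have "(\<integral>\<^sup>+x. F x \<partial>lborel) = (\<integral>\<^sup>+x. F x \<partial>distr lborel borel uminus)"
    using * by simp
  also have "\<dots> = (\<integral>\<^sup>+x. F (- x) \<partial>lborel)"
    by (subst nn_integral_distr) auto
  finally show ?thesis by simp
qed

text \<open>The uniqueness argument for Haar measure: average over translates of the unit disc, which is
  itself invariant under rotation.\<close>

lemma nn_integral_lborel_rotate:
  fixes c :: complex
  assumes F[measurable]: "F \<in> borel_measurable borel" and c: "cmod c = 1"
  shows "(\<integral>\<^sup>+x. F (c * x) \<partial>lborel) = (\<integral>\<^sup>+x. F x \<partial>lborel)"
proof -
  let ?B = "ball (0::complex) 1"
  have [measurable]: "?B \<in> sets borel" by simp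
  define b :: ennreal where "b = (\<integral>\<^sup>+x. indicator ?B x \<partial>(lborel::complex measure))"
  have b_eq: "b = emeasure lborel ?B" unfolding b_def by simp
  have "b = ennreal pi" unfolding b_eq by (subst emeasure_ball) (auto simp: unit_ball_vol_2)
  then have b0: "b \<noteq> 0" and btop: "b \<noteq> top" by auto
  have c0: "c \<noteq> 0" using c by auto
  have "(\<integral>\<^sup>+x. F (c * x) \<partial>lborel) * b
      = (\<integral>\<^sup>+y. indicator ?B y * (\<integral>\<^sup>+x. F (c * x) \<partial>lborel) \<partial>lborel)"
    unfolding b_def
    by (subst nn_integral_multc) (auto intro!: borel_measurable_indicator simp: mult.commute)
  also have "\<dots> = (\<integral>\<^sup>+y. indicator ?B y * (\<integral>\<^sup>+x. F (c * x + y) \<partial>lborel) \<partial>lborel)"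
  proof (rule nn_integral_cong)
    fix y :: complex
    have "(\<integral>\<^sup>+x. F (c * x + y) \<partial>lborel) = (\<integral>\<^sup>+x. F (c * (y / c + x)) \<partial>lborel)"
      using c0 by (simp add: distrib_left add.commute)
    also have "\<dots> = (\<integral>\<^sup>+x. F (c * x) \<partial>lborel)"
      by (rule nn_integral_lborel_translate[of "\<lambda>x. F (c * x)"]) measurable
    finally show "indicator ?B y * (\<integral>\<^sup>+x. F (c * x) \<partial>lborel) = indicator ?B y * (\<integral>\<^sup>+x. F (c * x + y) \<partial>lborel)"
      by simp
  qed
  also have "\<dots> = (\<integral>\<^sup>+y. (\<integral>\<^sup>+x. indicator ?B y * F (c * x + y) \<partial>lborel) \<partial>lborel)"
    by (intro nn_integral_cong nn_integral_cmult[symmetric]) measurable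
  also have "\<dots> = (\<integral>\<^sup>+x. (\<integral>\<^sup>+y. indicator ?B y * F (c * x + y) \<partial>lborel) \<partial>lborel)"
    by (rule lborel_pair.Fubini'[symmetric]) measurable
  also have "\<dots> = (\<integral>\<^sup>+x. (\<integral>\<^sup>+y. indicator ?B (y - c * x) * F y \<partial>lborel) \<partial>lborel)"
  proof (rule nn_integral_cong)
    fix x :: complex
    show "(\<integral>\<^sup>+y. indicator ?B y * F (c * x + y) \<partial>lborel) = (\<integral>\<^sup>+y. indicator ?B (y - c * x) * F y \<partial>lborel)"
      using nn_integral_lborel_translate[of "\<lambda>y. indicator ?B (y - c * x) * F y" "c * x"] by simp
  qed
  also have "\<dots> = (\<integral>\<^sup>+y. (\<integral>\<^sup>+x. indicator ?B (y - c * x) * F y \<partial>lborel) \<partial>lborel)"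
    by (rule lborel_pair.Fubini') measurable
  also have "\<dots> = (\<integral>\<^sup>+y. b * F y \<partial>lborel)"
  proof (rule nn_integral_cong)
    fix y :: complex
    have ind: "indicator ?B (y - c * x) = (indicator ?B (y / c + - x) :: ennreal)" for x
    proof -
      have "y - c * x = c * (y / c + - x)" using c0 by (simp add: field_simps)
      then have "cmod (y - c * x) = cmod (y / c + - x)" using c by (simp add: norm_mult)
      then show ?thesis by (simp add: indicator_def)
    qed
    have "(\<integral>\<^sup>+x. indicator ?B (y - c * x) * F y \<partial>lborel) = (\<integral>\<^sup>+x. indicator ?B (y / c + - x) \<partial>lborel) * F y"
      unfolding ind by (rule nn_integral_multc) measurable
    also have "(\<integral>\<^sup>+x. indicator ?B (y / c + - x) \<partial>lborel) = (b :: ennreal)"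
      unfolding b_def
      by (subst nn_integral_lborel_uminus[of "\<lambda>x. indicator ?B (y / c + x)"])
         (auto simp: nn_integral_lborel_translate[of "indicator ?B :: complex \<Rightarrow> ennreal", OF borel_measurable_indicator])
    finally show "(\<integral>\<^sup>+x. indicator ?B (y - c * x) * F y \<partial>lborel) = b * F y" .
  qed
  also have "\<dots> = (\<integral>\<^sup>+x. F x \<partial>lborel) * b"
    by (subst nn_integral_cmult) (auto simp: mult.commute)
  finally show ?thesis
    using b0 btop by (metis ennreal_mult_cancel_left mult.commute)
qed

text \<open>The disc of radius r has area pi r^2, so both measures agree on half-lines. These are an
  intersection-stable generator, and the real line is a countable union of half-lines of finite
  mass. The density 2 pi s is the derivative of that area.\<close>

lemma distr_lborel_cmod:
  "distr lborel borel cmod = density lborel (\<lambda>s. ennreal (2 * pi * s) * indicator {0..} s)"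
proof (rule measure_eqI_generator_eq[where E="range atMost" and \<Omega>=UNIV and A="\<lambda>i. {..real i}"])
  show "Int_stable (range atMost :: real set set)"
    by (auto simp: Int_stable_def)
  show "sets (distr lborel borel cmod) = sigma_sets UNIV (range atMost)"
    unfolding sets_distr borel_eq_atMost by simp
  show "sets (density lborel (\<lambda>s. ennreal (2 * pi * s) * indicator {0..} s)) = sigma_sets UNIV (range atMost)"
    unfolding sets_density sets_lborel borel_eq_atMost by simp
  fix X :: "real set" assume "X \<in> range atMost"
  then obtain r where X: "X = {..r}" by auto
  have pre: "cmod -` {..r} = cball 0 r" by auto
  have 1: "emeasure (distr lborel borel cmod) X = emeasure lborel (cball (0::complex) r)"
    unfolding X by (subst emeasure_distr) (auto simp: pre)
  have 2: "emeasure (density lborel (\<lambda>s. ennreal (2 * pi * s) * indicator {0..} s)) X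
      = (\<integral>\<^sup>+s. ennreal (2 * pi * s) * indicator {0..r} s \<partial>lborel)"
    unfolding X by (subst emeasure_density) (auto intro!: nn_integral_cong simp: indicator_def)
  show "emeasure (distr lborel borel cmod) X
      = emeasure (density lborel (\<lambda>s. ennreal (2 * pi * s) * indicator {0..} s)) X"
  proof (cases "r \<ge> 0")
    case True
    have "(\<integral>\<^sup>+s. ennreal (2 * pi * s) * indicator {0..r} s \<partial>lborel) = ennreal (pi * r\<^sup>2 - pi * 0\<^sup>2)"
      using True by (intro nn_integral_FTC_Icc) (auto intro!: derivative_eq_intros)
    moreover have "emeasure lborel (cball (0::complex) r) = ennreal (pi * r\<^sup>2)"
      using True by (subst emeasure_cball) (auto simp: unit_ball_vol_2)
    ultimately show ?thesis using 1 2 by simp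
  next
    case False
    then show ?thesis using 1 2 by simp
  qed
next
  show "range (\<lambda>i. {..real i}) \<subseteq> range atMost" by auto
  show "(\<Union>i. {..real i}) = UNIV" by (auto intro: real_arch_simple)
  fix i
  have pre: "cmod -` {..real i} = cball 0 (real i)" by auto
  show "emeasure (distr lborel borel cmod) {..real i} \<noteq> \<infinity>"
    by (subst emeasure_distr) (use emeasure_lborel_cball_finite[of "0::complex" "real i"] in \<open>auto simp: pre\<close>)
qed auto

lemma nn_integral_lborel_cmod:
  assumes [measurable]: "h \<in> borel_measurable borel"
  shows "(\<integral>\<^sup>+z. h (cmod z) \<partial>lborel) = (\<integral>\<^sup>+s. ennreal (2 * pi * s) * h s * indicator {0..} s \<partial>lborel)"
proof -
  have "(\<integral>\<^sup>+z. h (cmod z) \<partial>lborel) = (\<integral>\<^sup>+s. h s \<partial>distr lborel borel cmod)"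
    by (subst nn_integral_distr) auto
  also have "\<dots> = (\<integral>\<^sup>+s. ennreal (2 * pi * s) * indicator {0..} s * h s \<partial>lborel)"
    unfolding distr_lborel_cmod by (subst nn_integral_density) auto
  finally show ?thesis by (simp add: mult_ac)
qed

text \<open>Arc length on the unit circle, normalised to mass 1 and carried to the plane, so that
  rotations and Fubini act on the complex variable rather than on the angle.\<close>

definition circle_measure :: "complex measure" where
  "circle_measure = distr (density lborel (indicator {0..<1})) borel (\<lambda>t. cis (2 * pi * t))"

lemma sets_circle_measure [measurable_cong, simp]: "sets circle_measure = sets borel"
  by (simp add: circle_measure_def)

lemma space_circle_measure [simp]: "space circle_measure = UNIV"
  by (simp add: circle_measure_def)

lemma measurable_cis2pi [measurable]: "(\<lambda>t. cis (2 * pi * t)) \<in> borel_measurable borel"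
  by (intro borel_measurable_continuous_onI continuous_intros)

lemma nn_integral_circle_measure:
  assumes [measurable]: "F \<in> borel_measurable borel"
  shows "(\<integral>\<^sup>+z. F z \<partial>circle_measure) = (\<integral>\<^sup>+t. F (cis (2 * pi * t)) * indicator {0..<1} t \<partial>lborel)"
  unfolding circle_measure_def
  by (subst nn_integral_distr) (measurable, simp add: nn_integral_density mult.commute[of _ "indicator _ _"])

lemma emeasure_circle_measure_UNIV [simp]: "emeasure circle_measure UNIV = 1"
  using nn_integral_circle_measure[of "\<lambda>_. 1"] by simp

interpretation circle: finite_measure circle_measure
  by standard simp

interpretation circle_lborel: pair_sigma_finite circle_measure "lborel :: complex measure" ..

lemma AE_circle_measure_cmod: "AE z in circle_measure. cmod z = 1"
  unfolding circle_measure_def by (subst AE_distr_iff) auto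

text \<open>A rotation shifts the parameter by \<tau>. The shifted period interval is cut at 1, and
  the part beyond 1 is moved back by periodicity.\<close>

lemma nn_integral_circle_rotate:
  assumes [measurable]: "F \<in> borel_measurable borel" and c: "cmod c = 1"
  shows "(\<integral>\<^sup>+z. F (c * z) \<partial>circle_measure) = (\<integral>\<^sup>+z. F z \<partial>circle_measure)"
proof -
  obtain \<tau> where \<tau>: "0 \<le> \<tau>" "\<tau> < 1" "c = cis (2 * pi * \<tau>)"
  proof -
    obtain x where x: "c = cis x" "0 \<le> x" "x < 2 * pi"
      using complex_unimodular_polar[of c] c by (metis cis.code complex_eq_iff cis.simps)
    show ?thesis
      by (rule that[of "x / (2 * pi)"]) (use x in \<open>auto simp: field_simps\<close>)
  qed
  let ?G = "\<lambda>t. F (cis (2 * pi * t))"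
  have per: "?G (t + 1) = ?G t" for t
    by (simp add: distrib_left cis_mult[symmetric])
  have "(\<integral>\<^sup>+z. F (c * z) \<partial>circle_measure) = (\<integral>\<^sup>+t. ?G (\<tau> + t) * indicator {\<tau>..<1+\<tau>} (\<tau> + t) \<partial>lborel)"
    by (subst nn_integral_circle_measure) (auto simp: \<tau> cis_mult algebra_simps indicator_def intro!: nn_integral_cong)
  also have "\<dots> = (\<integral>\<^sup>+t. ?G t * indicator {\<tau>..<1+\<tau>} t \<partial>lborel)"
    by (rule nn_integral_lborel_translate[of "\<lambda>t. ?G t * indicator {\<tau>..<1+\<tau>} t"]) measurable
  also have "\<dots> = (\<integral>\<^sup>+t. ?G t * indicator {\<tau>..<1} t + ?G t * indicator {1..<1+\<tau>} t \<partial>lborel)"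
    using \<tau> by (intro nn_integral_cong) (auto simp: indicator_def)
  also have "\<dots> = (\<integral>\<^sup>+t. ?G t * indicator {\<tau>..<1} t \<partial>lborel) + (\<integral>\<^sup>+t. ?G t * indicator {1..<1+\<tau>} t \<partial>lborel)"
    by (rule nn_integral_add) measurable
  also have "(\<integral>\<^sup>+t. ?G t * indicator {1..<1+\<tau>} t \<partial>lborel) = (\<integral>\<^sup>+t. ?G (1 + t) * indicator {1..<1+\<tau>} (1 + t) \<partial>lborel)"
    by (rule nn_integral_lborel_translate[symmetric, of "\<lambda>t. ?G t * indicator {1..<1+\<tau>} t"]) measurable
  also have "\<dots> = (\<integral>\<^sup>+t. ?G t * indicator {0..<\<tau>} t \<partial>lborel)"
    using per by (intro nn_integral_cong) (auto simp: indicator_def add.commute)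
  also have "(\<integral>\<^sup>+t. ?G t * indicator {\<tau>..<1} t \<partial>lborel) + (\<integral>\<^sup>+t. ?G t * indicator {0..<\<tau>} t \<partial>lborel)
     = (\<integral>\<^sup>+t. ?G t * indicator {\<tau>..<1} t + ?G t * indicator {0..<\<tau>} t \<partial>lborel)"
    by (rule nn_integral_add[symmetric]) measurable
  also have "\<dots> = (\<integral>\<^sup>+t. ?G t * indicator {0..<1} t \<partial>lborel)"
    using \<tau> by (intro nn_integral_cong) (auto simp: indicator_def)
  finally show ?thesis
    by (simp add: nn_integral_circle_measure)
qed

text \<open>Averaging the rotation-invariant area integral over all rotations and exchanging the
  integrals leaves a circle mean that depends on |z| only; the distribution of the modulus then
  gives the radial density.\<close>

lemma nn_integral_polar:
  assumes F[measurable]: "F \<in> borel_measurable borel"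
  shows "(\<integral>\<^sup>+z. F z \<partial>lborel) =
    (\<integral>\<^sup>+s. ennreal (2 * pi * s) * (\<integral>\<^sup>+z. F (of_real s * z) \<partial>circle_measure) * indicator {0..} s \<partial>lborel)"
proof -
  have "(\<integral>\<^sup>+z. F z \<partial>lborel) = (\<integral>\<^sup>+\<zeta>. (\<integral>\<^sup>+z. F z \<partial>lborel) \<partial>circle_measure)"
    by simp
  also have "\<dots> = (\<integral>\<^sup>+\<zeta>. (\<integral>\<^sup>+z. F (\<zeta> * z) \<partial>lborel) \<partial>circle_measure)"
    using AE_circle_measure_cmod
    by (intro nn_integral_cong_AE) (auto elim!: eventually_mono simp: nn_integral_lborel_rotate)
  also have "\<dots> = (\<integral>\<^sup>+z. (\<integral>\<^sup>+\<zeta>. F (\<zeta> * z) \<partial>circle_measure) \<partial>lborel)"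
    by (rule circle_lborel.Fubini'[symmetric]) measurable
  also have "\<dots> = (\<integral>\<^sup>+z. (\<integral>\<^sup>+\<zeta>. F (of_real (cmod z) * \<zeta>) \<partial>circle_measure) \<partial>lborel)"
  proof (rule nn_integral_cong)
    fix z :: complex
    have z: "z = of_real (cmod z) * (if z = 0 then 1 else sgn z)"
      by (auto simp: sgn_eq)
    let ?c = "if z = 0 then 1 else sgn z"
    have "(\<integral>\<^sup>+\<zeta>. F (\<zeta> * z) \<partial>circle_measure) = (\<integral>\<^sup>+\<zeta>. F (of_real (cmod z) * (?c * \<zeta>)) \<partial>circle_measure)"
      by (subst z) (simp add: mult_ac)
    also have "\<dots> = (\<integral>\<^sup>+\<zeta>. F (of_real (cmod z) * \<zeta>) \<partial>circle_measure)"
      by (rule nn_integral_circle_rotate[of "\<lambda>\<zeta>. F (of_real (cmod z) * \<zeta>)"]) (auto simp: norm_sgn)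
    finally show "(\<integral>\<^sup>+\<zeta>. F (\<zeta> * z) \<partial>circle_measure) = (\<integral>\<^sup>+\<zeta>. F (of_real (cmod z) * \<zeta>) \<partial>circle_measure)" .
  qed
  also have "\<dots> = (\<integral>\<^sup>+s. ennreal (2 * pi * s) * (\<integral>\<^sup>+z. F (of_real s * z) \<partial>circle_measure) * indicator {0..} s \<partial>lborel)"
    by (rule nn_integral_lborel_cmod) measurable
  finally show ?thesis .
qed

section \<open>Poisson kernel and integral means\<close>

text \<open>For |z| = 1 the denominator is |z - w|^2, so this is the usual Poisson kernel. The form
  with \<open>1 - cnj w * z\<close> makes it directly comparable with the test kernels.\<close>

definition poisson :: "complex \<Rightarrow> complex \<Rightarrow> real" where
  "poisson w z = (1 - (cmod w)\<^sup>2) / (cmod (1 - cnj w * z))\<^sup>2"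

lemma poisson_nonneg: "cmod w < 1 \<Longrightarrow> 0 \<le> poisson w z"
  by (simp add: poisson_def power_le_one_iff)

lemma poisson_measurable [measurable]: "poisson w \<in> borel_measurable borel"
  unfolding poisson_def by measurable

lemma one_minus_cnj_mult_nz:
  assumes "cmod w < 1" "cmod z \<le> 1"
  shows "1 - cnj w * z \<noteq> 0"
proof
  assume "1 - cnj w * z = 0"
  then have "cmod (cnj w * z) = 1" by (metis eq_iff_diff_eq_0 norm_one)
  moreover have "cmod (cnj w * z) < 1"
    using assms mult_right_mono[of "cmod z" 1 "cmod w"] by (simp add: norm_mult mult.commute)
  ultimately show False by simp
qed

lemma cnj_mult_neq_1:
  "cmod w < 1 \<Longrightarrow> cmod z \<le> 1 \<Longrightarrow> cnj w * z \<noteq> 1"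
  using one_minus_cnj_mult_nz by fastforce

text \<open>Cauchy's formula is applied not to f but to f(z) (1 - |w|^2) / (1 - cnj w * z), which
  has the same value at w and is holomorphic near the closed disc; on the circle the extra factor
  completes the Cauchy kernel to the Poisson kernel.\<close>

lemma has_integral_poisson:
  assumes f: "f holomorphic_on ball 0 R" and R: "1 < R" and w: "cmod w < 1"
  shows "((\<lambda>t. f (cis (2 * pi * t)) * of_real (poisson w (cis (2 * pi * t)))) has_integral f w) {0..1}"
proof -
  let ?g = "\<lambda>z. f z * (1 - cnj w * w) / (1 - cnj w * z)"
  have sub: "cball 0 1 \<subseteq> ball (0::complex) R" using R by auto
  have g: "?g holomorphic_on cball 0 1"
    by (intro holomorphic_intros holomorphic_on_subset[OF f] sub)
       (use w in \<open>auto simp: cnj_mult_neq_1\<close>)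
  have "((\<lambda>u. ?g u / (u - w)) has_contour_integral (2 * of_real pi * \<i> * ?g w)) (circlepath 0 1)"
    using w by (intro Cauchy_integral_circlepath holomorphic_on_imp_continuous_on[OF g] holomorphic_on_subset[OF g]) auto
  then have "((\<lambda>t. ?g (cis (2 * pi * t)) / (cis (2 * pi * t) - w) * (2 * pi * \<i> * cis (2 * pi * t)))
      has_integral (2 * of_real pi * \<i> * ?g w)) {0..1}"
    unfolding has_contour_integral vector_derivative_circlepath
    by (rule has_integral_eq_rhs[OF has_integral_eq, rotated]) (auto simp: circlepath cis_conv_exp mult_ac)
  then have "((\<lambda>t. ?g (cis (2 * pi * t)) / (cis (2 * pi * t) - w) * (2 * pi * \<i> * cis (2 * pi * t)) / (2 * of_real pi * \<i>))
      has_integral ((2 * of_real pi * \<i> * ?g w) / (2 * of_real pi * \<i>))) {0..1}"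
    by (rule has_integral_divide)
  moreover have "(2 * of_real pi * \<i> * ?g w) / (2 * of_real pi * \<i>) = f w"
    using w one_minus_cnj_mult_nz[of w w] by (simp add: divide_simps)
  moreover have "?g (cis (2 * pi * t)) / (cis (2 * pi * t) - w) * (2 * pi * \<i> * cis (2 * pi * t)) / (2 * of_real pi * \<i>)
     = f (cis (2 * pi * t)) * of_real (poisson w (cis (2 * pi * t)))" for t
  proof -
    define z where "z = cis (2 * pi * t)"
    have z: "z * cnj z = 1" "z \<noteq> 0" by (auto simp: z_def cis_mult cis_cnj)
    have d1: "1 - cnj w * z \<noteq> 0" by (rule one_minus_cnj_mult_nz) (use w in \<open>auto simp: z_def\<close>)
    have d2: "z - w \<noteq> 0" using w by (auto simp: z_def)
    have d3: "1 - w * cnj z \<noteq> 0" using d1 by (metis complex_cnj_cnj complex_cnj_diff complex_cnj_mult complex_cnj_one complex_cnj_zero_iff)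
    \<comment> \<open>Since z * cnj z = 1, the factor z of the line element cancels, and the
      conjugate of 1 - cnj w * z appears in the denominator.\<close>
    have e: "z - w = z * (1 - w * cnj z)" using z by (simp add: algebra_simps)
    have "of_real (poisson w z) = (1 - cnj w * w) / ((1 - cnj w * z) * (1 - w * cnj z))"
    proof -
      have "complex_of_real ((cmod (1 - cnj w * z))\<^sup>2) = (1 - cnj w * z) * (1 - w * cnj z)"
        by (subst complex_norm_square) simp
      moreover have "complex_of_real ((cmod w)\<^sup>2) = cnj w * w"
        by (subst complex_norm_square) (simp add: mult.commute)
      ultimately show ?thesis unfolding poisson_def of_real_divide of_real_diff of_real_1 by simp
    qed
    moreover have "?g z / (z - w) * (2 * pi * \<i> * z) / (2 * of_real pi * \<i>) = f z * ((1 - cnj w * w) / ((1 - cnj w * z) * (1 - w * cnj z)))"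
      unfolding e using d1 d3 z by (simp add: divide_simps)
    ultimately show ?thesis unfolding z_def by simp
  qed
  ultimately show ?thesis by simp
qed

lemma continuous_on_poisson_cis:
  assumes "cmod w < 1"
  shows "continuous_on X (\<lambda>t. poisson w (cis (2 * pi * t)))"
  unfolding poisson_def using assms by (intro continuous_intros) (auto simp: cnj_mult_neq_1)

lemma has_integral_poisson_1:
  assumes w: "cmod w < 1"
  shows "((\<lambda>t. poisson w (cis (2 * pi * t))) has_integral 1) {0..1}"
proof -
  have "((\<lambda>t. Re (complex_of_real (poisson w (cis (2 * pi * t))))) has_integral Re 1) {0..1}"
    using has_integral_poisson[of "\<lambda>_. 1" 2 w] w by (intro has_integral_Re) simp
  then show ?thesis by simp
qed

lemma nn_integral_circle_measure_eq:
  assumes [measurable]: "g \<in> borel_measurable borel" and "\<And>z. 0 \<le> g z"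
    and I: "((\<lambda>t. g (cis (2 * pi * t))) has_integral I) {0..1}"
  shows "(\<integral>\<^sup>+z. ennreal (g z) \<partial>circle_measure) = ennreal I"
proof -
  have "(\<integral>\<^sup>+z. ennreal (g z) \<partial>circle_measure) = (\<integral>\<^sup>+t. ennreal (g (cis (2 * pi * t))) * indicator {0..<1} t \<partial>lborel)"
    by (rule nn_integral_circle_measure) measurable
  also have "\<dots> = (\<integral>\<^sup>+t. indicator {0..1} t * ennreal (g (cis (2 * pi * t))) \<partial>lborel)"
    using AE_lborel_singleton[of "1::real"]
    by (intro nn_integral_cong_AE) (auto elim!: eventually_mono simp: indicator_def)
  also have "\<dots> = ennreal I"
    using nn_integral_has_integral_lebesgue[OF _ I] assms(2)
    by (simp add: ennreal_mult'' flip: ennreal_indicator)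
  finally show ?thesis .
qed

lemma nn_integral_poisson:
  assumes "cmod w < 1"
  shows "(\<integral>\<^sup>+z. ennreal (poisson w z) \<partial>circle_measure) = 1"
  using nn_integral_circle_measure_eq[OF poisson_measurable _ has_integral_poisson_1] assms
  by (simp add: poisson_nonneg)

text \<open>Convexity of x^p in the form in which Jensen's inequality uses it below. The point 0 is
  treated by hand because the convexity argument runs on the open half-line.\<close>

lemma powr_ge_tangent:
  fixes a x p :: real
  assumes "0 < a" "0 \<le> x" "1 \<le> p"
  shows "a powr p + p * a powr (p - 1) * (x - a) \<le> x powr p"
proof (cases "x = 0")
  case True
  have "a powr (p - 1) * a = a powr p" using assms powr_mult_base[of a "p - 1"] by (simp add: mult.commute)
  then have "p * a powr (p - 1) * (x - a) = - (p * a powr p)" using True by (simp add: mult.assoc)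
  moreover have "a powr p \<le> p * a powr p" using assms by simp
  moreover have "x powr p = 0" using True by simp
  ultimately show ?thesis by linarith
next
  case False
  have "((\<lambda>x. x powr p) has_real_derivative p * a powr (p - 1)) (at a within {0<..})"
    by (rule has_field_derivative_at_within, rule has_real_derivative_powr) (use assms in auto)
  from convex_on_imp_above_tangent[OF powr_convex[OF assms(3)] _ _ _ this, of x]
  show ?thesis using assms False by (simp add: interior_open)
qed

text \<open>Jensen's inequality for the Poisson kernel, a density of mass 1: with a = |f(w)|, the
  tangent of x^p at a is integrated against the kernel, and the linear term is non-negative because
  a is at most the Poisson mean of |f|.\<close>

lemma poisson_submean:
  assumes f: "f holomorphic_on ball 0 R" and [measurable]: "f \<in> borel_measurable borel"
    and R: "1 < R" and w: "cmod w < 1" and p: "1 \<le> (p::real)"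
  shows "ennreal (cmod (f w) powr p) \<le> (\<integral>\<^sup>+z. ennreal (cmod (f z) powr p * poisson w z) \<partial>circle_measure)"
proof (cases "f w = 0")
  case True
  then show ?thesis by simp
next
  case False
  let ?c = "\<lambda>t. cis (2 * pi * t)"
  let ?P = "\<lambda>t. poisson w (?c t)"
  define a where "a = cmod (f w)"
  have a: "a > 0" using False by (simp add: a_def)
  have cf: "continuous_on {0..1} (\<lambda>t. f (?c t))"
    by (rule continuous_on_compose2[OF holomorphic_on_imp_continuous_on[OF f]])
       (use R in \<open>auto intro!: continuous_intros\<close>)
  note cP = continuous_on_poisson_cis[OF w]
  have P0: "0 \<le> ?P t" for t using w by (simp add: poisson_nonneg)
  have i1: "(\<lambda>t. cmod (f (?c t)) * ?P t) integrable_on {0..1}"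
    by (intro integrable_continuous_interval continuous_intros cf cP)
  have i2: "(\<lambda>t. cmod (f (?c t)) powr p * ?P t) integrable_on {0..1}"
    using p by (intro integrable_continuous_interval continuous_intros cf cP continuous_on_powr') auto
  have hP: "(?P has_integral 1) {0..1}" by (rule has_integral_poisson_1[OF w])
  have "a = cmod (integral {0..1} (\<lambda>t. f (?c t) * of_real (?P t)))"
    using integral_unique[OF has_integral_poisson[OF f R w]] by (simp add: a_def)
  also have "\<dots> \<le> integral {0..1} (\<lambda>t. cmod (f (?c t)) * ?P t)"
    by (rule integral_norm_bound_integral[OF has_integral_integrable[OF has_integral_poisson[OF f R w]] i1])
       (simp add: norm_mult P0)
  finally have le1: "a \<le> integral {0..1} (\<lambda>t. cmod (f (?c t)) * ?P t)" .
  let ?k = "p * a powr (p - 1)"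
  have h: "((\<lambda>t. a powr p * ?P t + ?k * (cmod (f (?c t)) * ?P t - a * ?P t)) has_integral
      (a powr p * 1 + ?k * (integral {0..1} (\<lambda>t. cmod (f (?c t)) * ?P t) - a * 1))) {0..1}"
    by (intro has_integral_add has_integral_mult_right has_integral_diff hP integrable_integral i1)
  have "a powr p \<le> a powr p * 1 + ?k * (integral {0..1} (\<lambda>t. cmod (f (?c t)) * ?P t) - a * 1)"
    using le1 p a by simp
  also have "\<dots> \<le> integral {0..1} (\<lambda>t. cmod (f (?c t)) powr p * ?P t)"
  proof (rule has_integral_le[OF h integrable_integral[OF i2]])
    fix t
    have "(a powr p + ?k * (cmod (f (?c t)) - a)) * ?P t \<le> cmod (f (?c t)) powr p * ?P t"
      using powr_ge_tangent[OF a _ p, of "cmod (f (?c t))"] P0 by (intro mult_right_mono) auto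
    then show "a powr p * ?P t + ?k * (cmod (f (?c t)) * ?P t - a * ?P t) \<le> cmod (f (?c t)) powr p * ?P t"
      by (simp add: algebra_simps)
  qed
  finally have "ennreal (a powr p) \<le> ennreal (integral {0..1} (\<lambda>t. cmod (f (?c t)) powr p * ?P t))"
    by (rule ennreal_leI)
  also have "\<dots> = (\<integral>\<^sup>+z. ennreal (cmod (f z) powr p * poisson w z) \<partial>circle_measure)"
    using w by (intro nn_integral_circle_measure_eq[symmetric] integrable_integral[OF i2])
      (auto simp: poisson_nonneg)
  finally show ?thesis by (simp add: a_def)
qed

section \<open>Monotone integral means and the submean property over discs\<close>

interpretation circle_pair: pair_sigma_finite circle_measure circle_measure ..

text \<open>The submean property is used at the point q = r / s for the rotated dilations z
  \<mapsto> f(s \<alpha> z), which are holomorphic beyond the closed disc. After averaging over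
  \<alpha>, rotation invariance removes z from the inner mean, and the remaining Poisson kernel
  integrates to 1.\<close>

lemma integral_mean_mono:
  assumes f: "f holomorphic_on ball 0 1" and fm[measurable]: "f \<in> borel_measurable borel"
    and r: "0 \<le> r" "r \<le> s" "s < 1" and p: "1 \<le> (p::real)"
  shows "(\<integral>\<^sup>+z. ennreal (cmod (f (of_real r * z)) powr p) \<partial>circle_measure)
       \<le> (\<integral>\<^sup>+z. ennreal (cmod (f (of_real s * z)) powr p) \<partial>circle_measure)"
proof (cases "r = s")
  case True
  then show ?thesis by simp
next
  case False
  with r have s: "0 < s" "r < s" by auto
  define q where "q = r / s"
  have q: "0 \<le> q" "q < 1" "r = s * q" using s r by (auto simp: q_def)
  let ?g = "\<lambda>z. f (of_real s * z)"
  have [measurable]: "(\<lambda>z. f (complex_of_real s * z)) \<in> borel_measurable borel" by measurable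
  have g: "(\<lambda>z. ?g (\<alpha> * z)) holomorphic_on ball 0 (1 / s)" if "cmod \<alpha> = 1" for \<alpha>
  proof -
    have "(f \<circ> (\<lambda>z. of_real s * (\<alpha> * z))) holomorphic_on ball 0 (1 / s)"
    proof (rule holomorphic_on_compose_gen[OF _ f])
      show "(\<lambda>z. of_real s * (\<alpha> * z)) holomorphic_on ball 0 (1 / s)" by (intro holomorphic_intros)
      show "(\<lambda>z. of_real s * (\<alpha> * z)) ` ball 0 (1 / s) \<subseteq> ball 0 1"
        using s that by (auto simp: norm_mult pos_less_divide_eq mult.commute)
    qed
    then show ?thesis by (simp add: o_def)
  qed
  have 1: "ennreal (cmod (f (of_real r * \<alpha>)) powr p)
      \<le> (\<integral>\<^sup>+z. ennreal (cmod (?g (\<alpha> * z)) powr p * poisson q z) \<partial>circle_measure)" if "cmod \<alpha> = 1" for \<alpha>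
    using poisson_submean[OF g[OF that], of q p] r s q p by (simp add: mult_ac)
  have "(\<integral>\<^sup>+z. ennreal (cmod (f (of_real r * z)) powr p) \<partial>circle_measure)
     \<le> (\<integral>\<^sup>+\<alpha>. (\<integral>\<^sup>+z. ennreal (cmod (?g (\<alpha> * z)) powr p * poisson q z) \<partial>circle_measure) \<partial>circle_measure)"
    by (rule nn_integral_mono_AE, use AE_circle_measure_cmod in \<open>elim eventually_mono\<close>) (rule 1)
  also have "\<dots> = (\<integral>\<^sup>+z. (\<integral>\<^sup>+\<alpha>. ennreal (cmod (?g (\<alpha> * z)) powr p * poisson q z) \<partial>circle_measure) \<partial>circle_measure)"
    by (rule circle_pair.Fubini') measurable
  also have "\<dots> = (\<integral>\<^sup>+z. ennreal (poisson q z) * (\<integral>\<^sup>+\<alpha>. ennreal (cmod (?g \<alpha>) powr p) \<partial>circle_measure) \<partial>circle_measure)"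
  proof (rule nn_integral_cong_AE, use AE_circle_measure_cmod in \<open>elim eventually_mono\<close>)
    fix z assume z: "cmod z = 1"
    have "(\<integral>\<^sup>+\<alpha>. ennreal (cmod (?g (\<alpha> * z)) powr p * poisson q z) \<partial>circle_measure)
        = ennreal (poisson q z) * (\<integral>\<^sup>+\<alpha>. ennreal (cmod (?g (z * \<alpha>)) powr p) \<partial>circle_measure)"
      using q by (subst nn_integral_cmult[symmetric]) (auto simp: ennreal_mult' poisson_nonneg mult_ac)
    also have "(\<integral>\<^sup>+\<alpha>. ennreal (cmod (?g (z * \<alpha>)) powr p) \<partial>circle_measure)
        = (\<integral>\<^sup>+\<alpha>. ennreal (cmod (?g \<alpha>) powr p) \<partial>circle_measure)"
      by (rule nn_integral_circle_rotate[OF _ z]) measurable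
    finally show "(\<integral>\<^sup>+\<alpha>. ennreal (cmod (?g (\<alpha> * z)) powr p * poisson q z) \<partial>circle_measure)
        = ennreal (poisson q z) * (\<integral>\<^sup>+\<alpha>. ennreal (cmod (?g \<alpha>) powr p) \<partial>circle_measure)" .
  qed
  also have "\<dots> = (\<integral>\<^sup>+\<alpha>. ennreal (cmod (?g \<alpha>) powr p) \<partial>circle_measure)"
    using q by (subst nn_integral_multc) (auto simp: nn_integral_poisson)
  finally show ?thesis .
qed

text \<open>On each circle about w this is the Poisson inequality at the centre, where the kernel is
  identically 1; polar coordinates integrate it over the radii.\<close>

lemma area_submean:
  assumes f: "f holomorphic_on ball w R" and fm[measurable]: "f \<in> borel_measurable borel" and p: "1 \<le> (p::real)"
    and R: "0 < R"
  shows "ennreal (pi * R\<^sup>2) * ennreal (cmod (f w) powr p)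
     \<le> (\<integral>\<^sup>+z. ennreal (cmod (f z) powr p) * indicator (ball w R) z \<partial>lborel)"
proof -
  have [measurable]: "ball a R \<in> sets borel" for a :: complex by simp
  have "ennreal (pi * R\<^sup>2) * ennreal (cmod (f w) powr p) = (\<integral>\<^sup>+z. indicator (ball (0::complex) R) z \<partial>lborel) * ennreal (cmod (f w) powr p)"
    using R by (simp add: emeasure_ball unit_ball_vol_2)
  also have "\<dots> = (\<integral>\<^sup>+z. indicator (ball (0::complex) R) z * ennreal (cmod (f w) powr p) \<partial>lborel)"
    by (subst nn_integral_multc) (auto intro!: borel_measurable_indicator)
  also have "\<dots> = (\<integral>\<^sup>+z. ennreal (cmod (f w) powr p) * indicator {..<R} (cmod z) \<partial>lborel)"
    by (auto simp: indicator_def intro!: nn_integral_cong)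
  also have "\<dots> = (\<integral>\<^sup>+s. ennreal (2 * pi * s) * (ennreal (cmod (f w) powr p) * indicator {..<R} s) * indicator {0..} s \<partial>lborel)"
    by (rule nn_integral_lborel_cmod) measurable
  also have "\<dots> \<le> (\<integral>\<^sup>+s. ennreal (2 * pi * s) * (\<integral>\<^sup>+z. ennreal (cmod (f (w + of_real s * z)) powr p) * indicator (ball 0 R) (of_real s * z) \<partial>circle_measure) * indicator {0..} s \<partial>lborel)"
  proof (rule nn_integral_mono)
    fix s :: real
    show "ennreal (2 * pi * s) * (ennreal (cmod (f w) powr p) * indicator {..<R} s) * indicator {0..} s
       \<le> ennreal (2 * pi * s) * (\<integral>\<^sup>+z. ennreal (cmod (f (w + of_real s * z)) powr p) * indicator (ball 0 R) (of_real s * z) \<partial>circle_measure) * indicator {0..} s"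
    proof (cases "0 < s \<and> s < R")
      case True
      have "(f \<circ> (\<lambda>z. w + of_real s * z)) holomorphic_on ball 0 (R / s)"
      proof (rule holomorphic_on_compose_gen[OF _ f])
        show "(\<lambda>z. w + of_real s * z) holomorphic_on ball 0 (R / s)" by (intro holomorphic_intros)
        show "(\<lambda>z. w + of_real s * z) ` ball 0 (R / s) \<subseteq> ball w R"
          using True by (auto simp: dist_norm norm_mult pos_less_divide_eq mult.commute)
      qed
      then have "(\<lambda>z. f (w + of_real s * z)) holomorphic_on ball 0 (R / s)" by (simp add: o_def)
      from poisson_submean[OF this, of 0 p] True p
      have "ennreal (cmod (f w) powr p) \<le> (\<integral>\<^sup>+z. ennreal (cmod (f (w + of_real s * z)) powr p) \<partial>circle_measure)"
        by (simp add: poisson_def)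
      also have "\<dots> = (\<integral>\<^sup>+z. ennreal (cmod (f (w + of_real s * z)) powr p) * indicator (ball 0 R) (of_real s * z) \<partial>circle_measure)"
        by (rule nn_integral_cong_AE, use AE_circle_measure_cmod in \<open>elim eventually_mono\<close>)
           (use True in \<open>simp add: norm_mult indicator_def\<close>)
      finally show ?thesis using True by (auto intro!: mult_left_mono)
    next
      case False
      then show ?thesis by (cases "s = 0") (auto simp: indicator_def)
    qed
  qed
  also have "\<dots> = (\<integral>\<^sup>+z. ennreal (cmod (f (w + z)) powr p) * indicator (ball 0 R) z \<partial>lborel)"
    by (rule nn_integral_polar[symmetric]) measurable
  also have "\<dots> = (\<integral>\<^sup>+z. ennreal (cmod (f (w + z)) powr p) * indicator (ball w R) (w + z) \<partial>lborel)"
    by (auto intro!: nn_integral_cong simp: indicator_def dist_norm)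
  also have "\<dots> = (\<integral>\<^sup>+z. ennreal (cmod (f z) powr p) * indicator (ball w R) z \<partial>lborel)"
    by (rule nn_integral_lborel_translate[of "\<lambda>z. ennreal (cmod (f z) powr p) * indicator (ball w R) z"]) measurable
  finally show ?thesis .
qed

section \<open>Radial weights\<close>

lemma borel_measurable_radial_weight:
  assumes "radial_weight \<omega>"
  shows "\<omega> \<in> borel_measurable (lebesgue_on unit_disc)"
proof -
  have "\<omega> \<in> borel_measurable disc_area"
    using assms unfolding radial_weight_def by (intro borel_measurable_integrable) simp
  moreover have "sets disc_area = sets (lebesgue_on unit_disc)"
    by (simp add: disc_area_def)
  ultimately show ?thesis
    using measurable_cong_sets[of disc_area "lebesgue_on unit_disc" borel borel] by blast
qed

text \<open>A radius is a null set of the plane, so a Borel version of \<omega> in the plane says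
  nothing about \<omega> along that radius. Circle averages repair this: by polar coordinates a
  planar null set meets almost every circle in a set of arc length zero, and on such a circle the
  average of the Borel version is the constant value of \<omega>.\<close>

lemma radial_weight_profile:
  assumes \<omega>: "radial_weight \<omega>"
  obtains W :: "real \<Rightarrow> ennreal" where
    "W \<in> borel_measurable borel"
    "AE z in lborel. z \<in> unit_disc \<longrightarrow> ennreal (\<omega> z) = W (cmod z)"
    "AE s in lborel. s \<in> {0..<1} \<longrightarrow> ennreal (\<omega> (of_real s)) = W s"
proof -
  have [measurable]: "unit_disc \<in> sets borel" by simp
  let ?g = "\<lambda>z. ennreal (\<omega> z) * indicator unit_disc z"
  have rad: "\<omega> z = \<omega> (of_real (cmod z))" if "z \<in> unit_disc" for z
    using \<omega> that unfolding radial_weight_def by blast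
  have "\<omega> \<in> borel_measurable (lebesgue_on unit_disc)" by (rule borel_measurable_radial_weight[OF \<omega>])
  then have "(\<lambda>z. ennreal (\<omega> z)) \<in> borel_measurable (lebesgue_on unit_disc)" by measurable
  then have "?g \<in> borel_measurable lebesgue"
    by (subst (asm) borel_measurable_restrict_space_iff_ennreal) auto
  then obtain g where g[measurable]: "g \<in> borel_measurable borel" and gg: "AE z in lborel. ?g z = g z"
    using completion_ex_borel_measurable[of ?g lborel] by auto
  from AE_E[OF gg] obtain B where B: "{z \<in> space lborel. \<not> ?g z = g z} \<subseteq> B" "emeasure lborel B = 0" "B \<in> sets lborel"
    by auto
  then have [measurable]: "B \<in> sets borel" by simp
  define W where "W s = (\<integral>\<^sup>+\<zeta>. g (of_real s * \<zeta>) \<partial>circle_measure)" for s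
  have W[measurable]: "W \<in> borel_measurable borel" unfolding W_def by measurable
  let ?b = "\<lambda>s. \<integral>\<^sup>+\<zeta>. indicator B (complex_of_real s * \<zeta>) \<partial>circle_measure"
  have "(\<integral>\<^sup>+s. ennreal (2 * pi * s) * ?b s * indicator {0..} s \<partial>lborel) = 0"
    using nn_integral_polar[of "indicator B"] B by simp
  then have "AE s in lborel. ennreal (2 * pi * s) * ?b s * indicator {0..} s = 0"
    by (subst (asm) nn_integral_0_iff_AE) measurable
  then have ae: "AE s in lborel. 0 < s \<longrightarrow> ?b s = 0"
    by eventually_elim (auto simp: indicator_def split: if_splits)
  have W_eq: "ennreal (\<omega> (of_real s)) = W s" if s: "0 < s" "s < 1" and b: "?b s = 0" for s
  proof -
    have "AE \<zeta> in circle_measure. indicator B (complex_of_real s * \<zeta>) = (0::ennreal)"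
      using b by (subst (asm) nn_integral_0_iff_AE) measurable
    then have "AE \<zeta> in circle_measure. g (of_real s * \<zeta>) = ennreal (\<omega> (of_real s))"
      using AE_circle_measure_cmod
    proof eventually_elim
      case (elim \<zeta>)
      have "of_real s * \<zeta> \<in> unit_disc" using s elim by (simp add: norm_mult)
      moreover have "of_real s * \<zeta> \<notin> B" using elim by (auto simp: indicator_def split: if_splits)
      then have "?g (of_real s * \<zeta>) = g (of_real s * \<zeta>)" using B by auto
      moreover have "\<omega> (of_real s * \<zeta>) = \<omega> (of_real s)"
        using rad[of "of_real s * \<zeta>"] calculation(1) s elim by (metis abs_of_pos mult.right_neutral norm_mult norm_of_real)
      ultimately show ?case by simp
    qed
    then have "W s = (\<integral>\<^sup>+\<zeta>. ennreal (\<omega> (of_real s)) \<partial>circle_measure)"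
      unfolding W_def by (rule nn_integral_cong_AE)
    then show ?thesis by simp
  qed
  show thesis
  proof (rule that[OF W])
    show "AE s in lborel. s \<in> {0..<1} \<longrightarrow> ennreal (\<omega> (of_real s)) = W s"
      using ae AE_lborel_singleton[of "0::real"] by eventually_elim (auto intro: W_eq)
    \<comment> \<open>The distribution of the modulus has a density, so a null set of radii has a
      null preimage in the plane.\<close>
    have "AE s in distr lborel borel cmod. 0 < s \<longrightarrow> ?b s = 0"
      unfolding distr_lborel_cmod using ae by (subst AE_density) auto
    then have "AE z in lborel. 0 < cmod z \<longrightarrow> ?b (cmod z) = 0"
      by (subst (asm) AE_distr_iff) auto
    then show "AE z in lborel. z \<in> unit_disc \<longrightarrow> ennreal (\<omega> z) = W (cmod z)"
      using AE_lborel_singleton[of "0::complex"]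
    proof eventually_elim
      case (elim z)
      show ?case
      proof
        assume z: "z \<in> unit_disc"
        then have "ennreal (\<omega> (of_real (cmod z))) = W (cmod z)" using elim by (intro W_eq) auto
        then show "ennreal (\<omega> z) = W (cmod z)" using rad[OF z] by metis
      qed
    qed
  qed
qed

text \<open>The measure \<omega> dA, rebuilt as a Borel measure on the whole plane that charges only
  the disc.\<close>

definition profile_measure :: "(real \<Rightarrow> ennreal) \<Rightarrow> complex measure" where
  "profile_measure W = density lborel (\<lambda>z. indicator unit_disc z * W (cmod z) / ennreal pi)"

lemma sets_profile_measure [measurable_cong, simp]: "sets (profile_measure W) = sets borel"
  by (simp add: profile_measure_def)

lemma space_profile_measure [simp]: "space (profile_measure W) = UNIV"
  by (simp add: profile_measure_def)

lemma unit_disc_borel [measurable]: "unit_disc \<in> sets borel" by simp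

lemma nn_integral_profile_measure:
  assumes [measurable]: "W \<in> borel_measurable borel" "F \<in> borel_measurable borel"
  shows "(\<integral>\<^sup>+z. F z \<partial>profile_measure W) = (\<integral>\<^sup>+z. indicator unit_disc z * W (cmod z) / ennreal pi * F z \<partial>lborel)"
  unfolding profile_measure_def by (subst nn_integral_density) auto

lemma nn_integral_profile_polar:
  assumes [measurable]: "W \<in> borel_measurable borel" "F \<in> borel_measurable borel"
  shows "(\<integral>\<^sup>+z. F z \<partial>profile_measure W)
    = (\<integral>\<^sup>+s. ennreal (2 * s) * W s * (\<integral>\<^sup>+z. F (of_real s * z) \<partial>circle_measure) * indicator {0..<1} s \<partial>lborel)"
proof -
  have "(\<integral>\<^sup>+z. F z \<partial>profile_measure W) = (\<integral>\<^sup>+s. ennreal (2 * pi * s) *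
     (\<integral>\<^sup>+z. indicator unit_disc (of_real s * z) * W (cmod (of_real s * z)) / ennreal pi * F (of_real s * z) \<partial>circle_measure) * indicator {0..} s \<partial>lborel)"
    unfolding nn_integral_profile_measure[OF assms] by (rule nn_integral_polar) measurable
  also have "\<dots> = (\<integral>\<^sup>+s. ennreal (2 * s) * W s * (\<integral>\<^sup>+z. F (of_real s * z) \<partial>circle_measure) * indicator {0..<1} s \<partial>lborel)"
  proof (rule nn_integral_cong)
    fix s :: real
    show "ennreal (2 * pi * s) *
     (\<integral>\<^sup>+z. indicator unit_disc (of_real s * z) * W (cmod (of_real s * z)) / ennreal pi * F (of_real s * z) \<partial>circle_measure) * indicator {0..} s
     = ennreal (2 * s) * W s * (\<integral>\<^sup>+z. F (of_real s * z) \<partial>circle_measure) * indicator {0..<1} s"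
    proof (cases "0 \<le> s")
      case True
      have "(\<integral>\<^sup>+z. indicator unit_disc (of_real s * z) * W (cmod (of_real s * z)) / ennreal pi * F (of_real s * z) \<partial>circle_measure)
        = (\<integral>\<^sup>+z. (indicator {0..<1} s * W s / ennreal pi) * F (of_real s * z) \<partial>circle_measure)"
        by (rule nn_integral_cong_AE, use AE_circle_measure_cmod in \<open>elim eventually_mono\<close>)
           (use True in \<open>simp add: norm_mult indicator_def\<close>)
      also have "\<dots> = (indicator {0..<1} s * W s / ennreal pi) * (\<integral>\<^sup>+z. F (of_real s * z) \<partial>circle_measure)"
        by (rule nn_integral_cmult) measurable
      also have "ennreal (2 * pi * s) * \<dots> * indicator {0..} s
         = (ennreal (2 * s) * (ennreal pi / ennreal pi)) * W s * (\<integral>\<^sup>+z. F (of_real s * z) \<partial>circle_measure) * indicator {0..<1} s"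
      proof -
        have e: "ennreal (2 * pi * s) = ennreal (2 * s) * ennreal pi"
          using True by (simp add: mult_ac flip: ennreal_mult)
        have c: "ennreal pi * X / ennreal pi = X" for X
          using mult_divide_eq_ennreal[of "ennreal pi" X] by (simp add: mult.commute)
        show ?thesis unfolding e using True
          by (simp add: c indicator_def ennreal_times_divide mult_ac)
      qed
      finally show ?thesis by (simp add: ennreal_divide_self)
    qed simp
  qed
  finally show ?thesis .
qed

lemma nn_integral_disc_area:
  assumes \<omega>: "radial_weight \<omega>" and W[measurable]: "W \<in> borel_measurable borel"
    and ae: "AE z in lborel. z \<in> unit_disc \<longrightarrow> ennreal (\<omega> z) = W (cmod z)"
    and g[measurable]: "g \<in> borel_measurable borel" and g0: "\<And>z. 0 \<le> g z"
  shows "(\<integral>\<^sup>+z. ennreal (g z * \<omega> z) \<partial>disc_area) = (\<integral>\<^sup>+z. ennreal (g z) \<partial>profile_measure W)"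
proof -
  note borel_measurable_radial_weight[OF \<omega>, measurable]
  have [measurable]: "g \<in> borel_measurable (lebesgue_on unit_disc)"
    by (intro measurable_restrict_space1 measurable_completion) simp
  have "(\<integral>\<^sup>+z. ennreal (g z * \<omega> z) \<partial>disc_area) = ennreal (1 / pi) * (\<integral>\<^sup>+z. ennreal (g z * \<omega> z) \<partial>lebesgue_on unit_disc)"
    unfolding disc_area_def by (rule nn_integral_scale_measure) measurable
  also have "(\<integral>\<^sup>+z. ennreal (g z * \<omega> z) \<partial>lebesgue_on unit_disc) = (\<integral>\<^sup>+z. ennreal (g z * \<omega> z) * indicator unit_disc z \<partial>lborel)"
    by (subst nn_integral_restrict_space) (auto simp: nn_integral_completion)
  also have "\<dots> = (\<integral>\<^sup>+z. ennreal (g z) * (W (cmod z) * indicator unit_disc z) \<partial>lborel)"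
    by (rule nn_integral_cong_AE, use ae in \<open>elim eventually_mono\<close>)
       (auto simp: indicator_def ennreal_mult' g0 split: if_splits)
  also have "ennreal (1 / pi) * \<dots> = (\<integral>\<^sup>+z. ennreal (1 / pi) * (ennreal (g z) * (W (cmod z) * indicator unit_disc z)) \<partial>lborel)"
    by (rule nn_integral_cmult[symmetric]) measurable
  also have "\<dots> = (\<integral>\<^sup>+z. ennreal (g z) \<partial>profile_measure W)"
    by (subst nn_integral_profile_measure)
       (auto intro!: nn_integral_cong simp: divide_ennreal_def inverse_ennreal mult_ac inverse_eq_divide)
  finally show ?thesis .
qed

definition tail :: "(real \<Rightarrow> ennreal) \<Rightarrow> real \<Rightarrow> ennreal" where
  "tail W r = (\<integral>\<^sup>+s. W s * indicator {r..<1} s \<partial>lborel)"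

lemma weight_hat_eq_tail:
  assumes ae: "AE s in lborel. s \<in> {0..<1} \<longrightarrow> ennreal (\<omega> (of_real s)) = W s"
  shows "weight_hat \<omega> z = tail W (cmod z)"
  unfolding weight_hat_def tail_def nn_integral_completion
proof (rule nn_integral_cong_AE, use ae in \<open>elim eventually_mono\<close>)
  fix s :: real
  assume "s \<in> {0..<1} \<longrightarrow> ennreal (\<omega> (of_real s)) = W s"
  moreover have "0 \<le> cmod z" by simp
  ultimately show "ennreal (\<omega> (of_real s)) * indicator {cmod z..<1} s = W s * indicator {cmod z..<1} s"
    by (auto simp: indicator_def simp del: norm_ge_zero)
qed

section \<open>Doubling weights\<close>

text \<open>The two membership conditions, read off for a Borel profile and with their constants
  fixed: \<open>Cd\<close> belongs to \<open>D_hat\<close>, \<open>K\<close> and \<open>Cc\<close>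
  to \<open>D_check\<close>. The constants of the estimates below are built from these three, the
  exponents p and \<gamma>, and absolute numbers.\<close>

locale doubling_profile =
  fixes W :: "real \<Rightarrow> ennreal" and Cd K Cc :: real
  assumes W_measurable [measurable]: "W \<in> borel_measurable borel"
    and tail_finite: "tail W 0 < top"
    and tail_pos: "0 \<le> r \<Longrightarrow> r < 1 \<Longrightarrow> 0 < tail W r"
    and Cd: "1 \<le> Cd"
    and doubling: "0 \<le> r \<Longrightarrow> r < 1 \<Longrightarrow> tail W r \<le> ennreal Cd * tail W ((1 + r) / 2)"
    and K: "1 < K" and Cc: "1 < Cc"
    and reverse_doubling: "0 \<le> r \<Longrightarrow> r < 1 \<Longrightarrow> ennreal Cc * tail W (1 - (1 - r) / K) \<le> tail W r"
begin

abbreviation \<mu> :: "complex measure" where "\<mu> \<equiv> profile_measure W"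

definition H :: "real \<Rightarrow> real" where "H r = enn2real (tail W r)"

lemma tail_antimono: "r \<le> s \<Longrightarrow> tail W s \<le> tail W r"
  unfolding tail_def by (intro nn_integral_mono) (auto simp: indicator_def)

lemma tail_eq_H: "0 \<le> r \<Longrightarrow> tail W r = ennreal (H r)"
  unfolding H_def using tail_finite tail_antimono[of 0 r]
  by (metis ennreal_enn2real le_less_trans)

lemma H_pos: "0 \<le> r \<Longrightarrow> r < 1 \<Longrightarrow> 0 < H r"
  using tail_pos[of r] tail_eq_H[of r] by (metis ennreal_less_zero_iff)

lemma H_nonneg [simp]: "0 \<le> H r"
  by (simp add: H_def)

lemma H_antimono: "0 \<le> r \<Longrightarrow> r \<le> s \<Longrightarrow> H s \<le> H r"
  using tail_antimono[of r s] by (simp add: tail_eq_H)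

lemma H_doubling: "0 \<le> r \<Longrightarrow> r < 1 \<Longrightarrow> H r \<le> Cd * H ((1 + r) / 2)"
  using doubling[of r] Cd by (simp add: tail_eq_H flip: ennreal_mult)

lemma H_measurable [measurable]: "H \<in> borel_measurable borel"
proof -
  have "(\<lambda>r. tail W r) \<in> borel_measurable borel"
  proof -
    have *: "tail W r = (\<integral>\<^sup>+s. W s * indicator {x \<in> space (borel \<Otimes>\<^sub>M borel). fst x \<le> snd x \<and> snd x < 1} (r, s) \<partial>lborel)" for r
      unfolding tail_def by (intro nn_integral_cong) (auto simp: indicator_def space_pair_measure)
    show ?thesis unfolding * by measurable
  qed
  then show ?thesis unfolding H_def by measurable
qed

text \<open>Passing from r to (1 + r) / 2 halves the distance to the boundary, so k doublings lead
  from 1 - 2^k h to 1 - h. The maximum keeps the radius admissible once 2^k h exceeds 1.\<close>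

lemma H_dyadic:
  assumes "0 < h" "h \<le> 1"
  shows "H (max 0 (1 - 2 ^ k * h)) \<le> Cd ^ k * H (1 - h)"
proof (induction k)
  case 0
  then show ?case using assms by simp
next
  case (Suc k)
  let ?r = "max 0 (1 - 2 ^ Suc k * h)"
  have r: "0 \<le> ?r" "?r < 1" using assms by auto
  have "(1 + ?r) / 2 \<ge> max 0 (1 - 2 ^ k * h)" using assms by (auto simp: max_def)
  then have "H ((1 + ?r) / 2) \<le> H (max 0 (1 - 2 ^ k * h))" by (intro H_antimono) auto
  then have "H ?r \<le> Cd * H (max 0 (1 - 2 ^ k * h))"
    using H_doubling[OF r] Cd by (smt (verit) mult_left_mono)
  also have "\<dots> \<le> Cd * (Cd ^ k * H (1 - h))" using Suc Cd by (intro mult_left_mono) auto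
  finally show ?case by simp
qed

text \<open>Reverse doubling leaves at most the fraction 1 / Cc of the tail beyond 1 - (1 - r) / K,
  hence at least the fraction 1 - 1 / Cc before it.\<close>

lemma tail_le_window:
  assumes "0 \<le> r" "r < 1"
  shows "tail W r \<le> ennreal (Cc / (Cc - 1)) * (\<integral>\<^sup>+s. W s * indicator {r..<1 - (1 - r) / K} s \<partial>lborel)"
proof -
  define r' where "r' = 1 - (1 - r) / K"
  have "(1 - r) * 1 \<le> (1 - r) * K" using assms K by (intro mult_left_mono) auto
  then have r': "r \<le> r'" "r' < 1" using assms K by (auto simp: r'_def field_simps)
  define w where "w = (\<integral>\<^sup>+s. W s * indicator {r..<r'} s \<partial>lborel)"
  have split: "tail W r = w + tail W r'"
    unfolding w_def tail_def
    by (subst nn_integral_add[symmetric]) (use r' in \<open>auto intro!: nn_integral_cong simp: indicator_def\<close>)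
  then have "w < top" using tail_eq_H[OF assms(1)] by (metis ennreal_add_eq_top ennreal_neq_top less_top)
  then obtain x where x: "w = ennreal x" "0 \<le> x" by (cases w) auto
  have "Cc * H r' \<le> H r"
    using reverse_doubling[OF assms] assms r' Cc by (simp add: r'_def[symmetric] tail_eq_H flip: ennreal_mult)
  moreover have "H r = x + H r'"
    using split x assms r' by (simp add: tail_eq_H flip: ennreal_plus)
  ultimately have "H r * (Cc - 1) \<le> Cc * x" by (simp add: algebra_simps)
  then have "H r \<le> Cc / (Cc - 1) * x" using Cc by (simp add: field_simps)
  then have "ennreal (H r) \<le> ennreal (Cc / (Cc - 1)) * ennreal x"
    using Cc x by (simp flip: ennreal_mult)
  then show ?thesis using assms x by (simp add: tail_eq_H w_def r'_def)
qed

text \<open>At scale 2^k h the kernel is at most (2^k h)^(-\<gamma>), while the tail at the next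
  scale is at most Cd^(k+1) times H(1 - h). The sum is geometric with ratio Cd / 2^\<gamma>, which
  explains the lower bound on \<gamma>.\<close>

lemma radial_kernel_integral:
  assumes \<gamma>: "Cd < 2 powr \<gamma>" "0 < \<gamma>" and h: "0 < h" "h \<le> 1"
  shows "(\<integral>\<^sup>+s. W s * ennreal (1 / (1 - (1 - h) * s) powr \<gamma>) * indicator {0..<1} s \<partial>lborel)
    \<le> ennreal (Cd / (1 - Cd / 2 powr \<gamma>) * (H (1 - h) / h powr \<gamma>))"
proof -
  define q where "q = Cd / 2 powr \<gamma>"
  have q: "0 \<le> q" "q < 1" using \<gamma> Cd by (auto simp: q_def)
  let ?r = "\<lambda>k. max 0 (1 - 2 ^ Suc k * h)"
  let ?c = "\<lambda>k. 1 / (2 powr \<gamma>) ^ k / h powr \<gamma>"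
  have pt: "W s * ennreal (1 / (1 - (1 - h) * s) powr \<gamma>) * indicator {0..<1} s
      \<le> (\<Sum>k. ennreal (?c k) * (W s * indicator {?r k..<1} s))" for s
  proof (cases "s \<in> {0..<1}")
    case True
    have "\<exists>k. 1 - s \<le> 2 ^ Suc k * h"
    proof -
      obtain k where "1 / h < 2 ^ k" using real_arch_pow[of 2 "1 / h"] by auto
      then have "1 < 2 ^ k * h" using h by (simp add: field_simps)
      then have "1 - s \<le> 2 ^ Suc k * h" using True h by simp
      then show ?thesis by blast
    qed
    \<comment> \<open>The least scale containing s: for positive k minimality bounds the kernel at
      s, while for k = 0 the bound 1 - (1 - h) s \<ge> h is used instead.\<close>
    define k where "k = (LEAST k. 1 - s \<le> 2 ^ Suc k * h)"
    have k1: "1 - s \<le> 2 ^ Suc k * h" unfolding k_def by (rule LeastI_ex) fact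
    have k2: "2 ^ k * h \<le> 1 - (1 - h) * s"
    proof (cases k)
      case 0
      have "(1 - h) * s \<le> 1 - h" using True h by (simp add: mult_left_le)
      then show ?thesis using 0 by simp
    next
      case (Suc j)
      then have "\<not> 1 - s \<le> 2 ^ Suc j * h" using not_less_Least[of j "\<lambda>k. 1 - s \<le> 2 ^ Suc k * h"] unfolding k_def by simp
      moreover have "1 - s \<le> 1 - (1 - h) * s" using True h by (simp add: algebra_simps)
      ultimately show ?thesis using Suc by simp
    qed
    have "?c k = 1 / (2 ^ k * h) powr \<gamma>"
      using h by (simp add: powr_mult powr_powr powr_realpow[symmetric] mult.commute)
    also have "\<dots> \<ge> 1 / (1 - (1 - h) * s) powr \<gamma>"
    proof -
      have "0 < 2 ^ k * h" using h by simp
      then show ?thesis using k2 \<gamma> by (intro divide_left_mono powr_mono2 mult_pos_pos) auto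
    qed
    finally have le: "1 / (1 - (1 - h) * s) powr \<gamma> \<le> ?c k" .
    have "W s * ennreal (1 / (1 - (1 - h) * s) powr \<gamma>) * indicator {0..<1} s \<le> ennreal (?c k) * (W s * indicator {?r k..<1} s)"
      using True k1 le by (auto simp: mult.commute intro!: mult_left_mono ennreal_leI)
    also have "\<dots> \<le> (\<Sum>k. ennreal (?c k) * (W s * indicator {?r k..<1} s))"
      using sum_le_suminf[of "\<lambda>k. ennreal (?c k) * (W s * indicator {?r k..<1} s)" "{k}"] by simp
    finally show ?thesis .
  qed simp
  have "(\<integral>\<^sup>+s. W s * ennreal (1 / (1 - (1 - h) * s) powr \<gamma>) * indicator {0..<1} s \<partial>lborel)
     \<le> (\<integral>\<^sup>+s. (\<Sum>k. ennreal (?c k) * (W s * indicator {?r k..<1} s)) \<partial>lborel)"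
    by (rule nn_integral_mono) (rule pt)
  also have "\<dots> = (\<Sum>k. \<integral>\<^sup>+s. ennreal (?c k) * (W s * indicator {?r k..<1} s) \<partial>lborel)"
    by (rule nn_integral_suminf) measurable
  also have "\<dots> = (\<Sum>k. ennreal (?c k) * tail W (?r k))"
    unfolding tail_def by (intro arg_cong[where f=suminf] ext nn_integral_cmult) measurable
  also have "\<dots> \<le> (\<Sum>k. ennreal (Cd * (H (1 - h) / h powr \<gamma>) * q ^ k))"
  proof (rule suminf_le)
    fix k
    have "?c k * H (?r k) \<le> ?c k * (Cd ^ Suc k * H (1 - h))"
      by (intro mult_left_mono H_dyadic h) auto
    also have "\<dots> = Cd * (H (1 - h) / h powr \<gamma>) * q ^ k"
      by (simp add: q_def power_divide mult_ac)
    finally show "ennreal (?c k) * tail W (?r k) \<le> ennreal (Cd * (H (1 - h) / h powr \<gamma>) * q ^ k)"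
      by (simp add: tail_eq_H ennreal_leI flip: ennreal_mult)
  qed auto
  also have "\<dots> = ennreal (Cd * (H (1 - h) / h powr \<gamma>) * (1 / (1 - q)))"
  proof (rule suminf_ennreal_eq)
    show "(\<lambda>k. Cd * (H (1 - h) / h powr \<gamma>) * q ^ k) sums (Cd * (H (1 - h) / h powr \<gamma>) * (1 / (1 - q)))"
      using q by (intro sums_mult geometric_sums) auto
  qed (use Cd q in auto)
  finally show ?thesis by (simp add: q_def mult_ac)
qed

text \<open>Two of the \<gamma> + 1 powers form a Poisson kernel, of integral 1; the other \<gamma>
  - 1 are estimated by |1 - cnj w * z| \<ge> 1 - |w|, which requires \<gamma> \<ge> 1.\<close>

lemma circle_kernel_integral:
  assumes w: "cmod w < 1" and \<gamma>: "1 \<le> \<gamma>"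
  shows "(\<integral>\<^sup>+z. ennreal (1 / cmod (1 - cnj w * z) powr (\<gamma> + 1)) \<partial>circle_measure) \<le> ennreal (1 / (1 - cmod w) powr \<gamma>)"
proof -
  let ?h = "1 - cmod w"
  have h: "0 < ?h" using w by simp
  have "(\<integral>\<^sup>+z. ennreal (1 / cmod (1 - cnj w * z) powr (\<gamma> + 1)) \<partial>circle_measure)
     \<le> (\<integral>\<^sup>+z. ennreal (1 / ?h powr \<gamma>) * ennreal (poisson w z) \<partial>circle_measure)"
  proof (rule nn_integral_mono_AE, use AE_circle_measure_cmod in \<open>elim eventually_mono\<close>)
    fix z :: complex assume z: "cmod z = 1"
    define x where "x = cmod (1 - cnj w * z)"
    have x: "?h \<le> x" unfolding x_def using norm_triangle_ineq2[of 1 "cnj w * z"] z by (simp add: norm_mult)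
    have "?h * ?h powr (\<gamma> - 1) = ?h powr \<gamma>" using powr_mult_base[of ?h "\<gamma> - 1"] h by simp
    moreover have "?h \<le> 1 - (cmod w)\<^sup>2" using w by (simp add: power2_eq_square mult_left_le)
    moreover have "?h powr (\<gamma> - 1) \<le> x powr (\<gamma> - 1)" using x h \<gamma> by (intro powr_mono2) auto
    moreover have "?h * ?h powr (\<gamma> - 1) \<le> (1 - (cmod w)\<^sup>2) * x powr (\<gamma> - 1)"
      using calculation h by (intro mult_mono) auto
    ultimately have "?h powr \<gamma> \<le> (1 - (cmod w)\<^sup>2) * x powr (\<gamma> - 1)"
      by simp
    moreover have "x powr (\<gamma> + 1) = x powr (\<gamma> - 1) * x\<^sup>2"
      using x h powr_add[of x "\<gamma> - 1" 2] by (simp add: powr_numeral add.commute)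
    ultimately have "1 / x powr (\<gamma> + 1) \<le> 1 / ?h powr \<gamma> * ((1 - (cmod w)\<^sup>2) / x\<^sup>2)"
      using x h by (simp add: field_simps)
    then have "1 / cmod (1 - cnj w * z) powr (\<gamma> + 1) \<le> 1 / ?h powr \<gamma> * poisson w z"
      by (simp add: x_def poisson_def)
    then show "ennreal (1 / cmod (1 - cnj w * z) powr (\<gamma> + 1)) \<le> ennreal (1 / ?h powr \<gamma>) * ennreal (poisson w z)"
      using w by (simp add: poisson_nonneg ennreal_leI flip: ennreal_mult)
  qed
  also have "\<dots> = ennreal (1 / ?h powr \<gamma>)"
    using w by (subst nn_integral_cmult) (auto simp: nn_integral_poisson)
  finally show ?thesis .
qed

lemma kernel_integral:
  assumes \<gamma>: "Cd < 2 powr \<gamma>" "1 \<le> \<gamma>" and a: "cmod a < 1"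
  shows "(\<integral>\<^sup>+z. ennreal (1 / cmod (1 - cnj a * z) powr (\<gamma> + 1)) \<partial>\<mu>)
    \<le> ennreal (2 * Cd / (1 - Cd / 2 powr \<gamma>) * (H (cmod a) / (1 - cmod a) powr \<gamma>))"
proof -
  have "(\<integral>\<^sup>+z. ennreal (1 / cmod (1 - cnj a * z) powr (\<gamma> + 1)) \<partial>\<mu>)
    = (\<integral>\<^sup>+s. ennreal (2 * s) * W s * (\<integral>\<^sup>+z. ennreal (1 / cmod (1 - cnj a * (of_real s * z)) powr (\<gamma> + 1)) \<partial>circle_measure) * indicator {0..<1} s \<partial>lborel)"
    by (rule nn_integral_profile_polar) measurable
  \<comment> \<open>The circle estimate is used at the point s a. The base 1 - |a| s is written so
    as to match the radial estimate with h = 1 - |a|.\<close>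
  also have "\<dots> \<le> (\<integral>\<^sup>+s. ennreal 2 * (W s * ennreal (1 / (1 - (1 - (1 - cmod a)) * s) powr \<gamma>) * indicator {0..<1} s) \<partial>lborel)"
  proof (rule nn_integral_mono)
    fix s :: real
    show "ennreal (2 * s) * W s * (\<integral>\<^sup>+z. ennreal (1 / cmod (1 - cnj a * (of_real s * z)) powr (\<gamma> + 1)) \<partial>circle_measure) * indicator {0..<1} s
       \<le> ennreal 2 * (W s * ennreal (1 / (1 - (1 - (1 - cmod a)) * s) powr \<gamma>) * indicator {0..<1} s)"
    proof (cases "s \<in> {0..<1}")
      case True
      have "cmod (a * of_real s) < 1" using True a mult_strict_mono[of "cmod a" 1 s 1] by (simp add: norm_mult)
      from circle_kernel_integral[OF this \<gamma>(2)] True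
      have "(\<integral>\<^sup>+z. ennreal (1 / cmod (1 - cnj a * (of_real s * z)) powr (\<gamma> + 1)) \<partial>circle_measure) \<le> ennreal (1 / (1 - cmod a * s) powr \<gamma>)"
        by (simp add: norm_mult mult.assoc)
      then have "ennreal (2 * s) * W s * (\<integral>\<^sup>+z. ennreal (1 / cmod (1 - cnj a * (of_real s * z)) powr (\<gamma> + 1)) \<partial>circle_measure)
         \<le> ennreal 2 * W s * ennreal (1 / (1 - cmod a * s) powr \<gamma>)"
        using True by (intro mult_mono ennreal_leI) auto
      then show ?thesis using True by (simp add: mult.assoc)
    qed simp
  qed
  also have "\<dots> = ennreal 2 * (\<integral>\<^sup>+s. W s * ennreal (1 / (1 - (1 - (1 - cmod a)) * s) powr \<gamma>) * indicator {0..<1} s \<partial>lborel)"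
    by (rule nn_integral_cmult) measurable
  also have "\<dots> \<le> ennreal 2 * ennreal (Cd / (1 - Cd / 2 powr \<gamma>) * (H (1 - (1 - cmod a)) / (1 - cmod a) powr \<gamma>))"
    using a \<gamma> by (intro mult_left_mono radial_kernel_integral) auto
  also have "\<dots> = ennreal (2 * Cd / (1 - Cd / 2 powr \<gamma>) * (H (cmod a) / (1 - cmod a) powr \<gamma>))"
    using \<gamma> Cd by (simp flip: ennreal_mult' del: ennreal_numeral)
  finally show ?thesis .
qed

text \<open>In polar coordinates H(r) is replaced by the mass of W in a window to the right of r. On
  that window s / (1 - s) and the circle mean of |f|^p are at least as large as at r, so everything
  can be evaluated at s. Integrating over r first, the factor 1 / (1 - s) is absorbed by the length
  of the set of admissible r.\<close>

lemma norm_comparison: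
  assumes f: "f holomorphic_on unit_disc" and fm[measurable]: "f \<in> borel_measurable borel" and p: "1 \<le> (p::real)"
  shows "(\<integral>\<^sup>+z. ennreal (cmod (f z) powr p * (H (cmod z) / (1 - cmod z))) * indicator unit_disc z \<partial>lborel)
    \<le> ennreal (Cc / (Cc - 1) * K * pi) * (\<integral>\<^sup>+z. ennreal (cmod (f z) powr p) \<partial>\<mu>)"
proof -
  define c where "c = Cc / (Cc - 1)"
  have c: "0 \<le> c" using Cc by (simp add: c_def)
  define M where "M s = (\<integral>\<^sup>+z. ennreal (cmod (f (of_real s * z)) powr p) \<partial>circle_measure)" for s
  have M[measurable]: "M \<in> borel_measurable borel" unfolding M_def by measurable
  \<comment> \<open>The window condition r \<le> s < 1 - (1 - r) / K, solved for r, places r in this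
    interval.\<close>
  define G where "G r s = ennreal (2 * pi * s / (1 - s)) * M s * (ennreal c * W s) * indicator {1 - K * (1 - s)..s} r * indicator {0..<1} s" for r s
  have "(\<integral>\<^sup>+z. ennreal (cmod (f z) powr p * (H (cmod z) / (1 - cmod z))) * indicator unit_disc z \<partial>lborel)
    = (\<integral>\<^sup>+s. ennreal (2 * pi * s) * (\<integral>\<^sup>+z. ennreal (cmod (f (of_real s * z)) powr p * (H (cmod (of_real s * z)) / (1 - cmod (of_real s * z)))) * indicator unit_disc (of_real s * z) \<partial>circle_measure) * indicator {0..} s \<partial>lborel)"
    by (rule nn_integral_polar) measurable
  also have "\<dots> = (\<integral>\<^sup>+r. ennreal (2 * pi * r) * (M r * ennreal (H r / (1 - r))) * indicator {0..<1} r \<partial>lborel)"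
  proof (rule nn_integral_cong)
    fix s :: real
    show "ennreal (2 * pi * s) * (\<integral>\<^sup>+z. ennreal (cmod (f (of_real s * z)) powr p * (H (cmod (of_real s * z)) / (1 - cmod (of_real s * z)))) * indicator unit_disc (of_real s * z) \<partial>circle_measure) * indicator {0..} s
      = ennreal (2 * pi * s) * (M s * ennreal (H s / (1 - s))) * indicator {0..<1} s"
    proof (cases "0 \<le> s")
      case True
      have "(\<integral>\<^sup>+z. ennreal (cmod (f (of_real s * z)) powr p * (H (cmod (of_real s * z)) / (1 - cmod (of_real s * z)))) * indicator unit_disc (of_real s * z) \<partial>circle_measure)
         = (\<integral>\<^sup>+z. ennreal (cmod (f (of_real s * z)) powr p) * (ennreal (H s / (1 - s)) * indicator {0..<1} s) \<partial>circle_measure)"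
        by (rule nn_integral_cong_AE, use AE_circle_measure_cmod in \<open>elim eventually_mono\<close>)
           (use True in \<open>auto simp: norm_mult indicator_def simp flip: ennreal_mult'\<close>)
      also have "\<dots> = M s * (ennreal (H s / (1 - s)) * indicator {0..<1} s)"
        unfolding M_def by (rule nn_integral_multc) measurable
      finally show ?thesis using True by (simp add: mult_ac indicator_def)
    qed simp
  qed
  also have "\<dots> \<le> (\<integral>\<^sup>+r. (\<integral>\<^sup>+s. G r s \<partial>lborel) \<partial>lborel)"
  proof (rule nn_integral_mono)
    fix r :: real
    show "ennreal (2 * pi * r) * (M r * ennreal (H r / (1 - r))) * indicator {0..<1} r \<le> (\<integral>\<^sup>+s. G r s \<partial>lborel)"
    proof (cases "r \<in> {0..<1}")
      case True
      then have r: "0 \<le> r" "r < 1" by auto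
      have "ennreal (2 * pi * r) * (M r * ennreal (H r / (1 - r))) = ennreal (2 * pi * r / (1 - r)) * M r * tail W r"
        using r by (simp add: tail_eq_H mult_ac flip: ennreal_mult' ennreal_mult'')
      also have "\<dots> \<le> ennreal (2 * pi * r / (1 - r)) * M r * (ennreal c * (\<integral>\<^sup>+s. W s * indicator {r..<1 - (1 - r) / K} s \<partial>lborel))"
        unfolding c_def by (intro mult_left_mono tail_le_window r) auto
      also have "\<dots> = (\<integral>\<^sup>+s. ennreal (2 * pi * r / (1 - r)) * M r * (ennreal c * (W s * indicator {r..<1 - (1 - r) / K} s)) \<partial>lborel)"
        by ((subst nn_integral_cmult[symmetric], measurable)+)
      also have "\<dots> \<le> (\<integral>\<^sup>+s. G r s \<partial>lborel)"
      proof (rule nn_integral_mono)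
        fix s :: real
        show "ennreal (2 * pi * r / (1 - r)) * M r * (ennreal c * (W s * indicator {r..<1 - (1 - r) / K} s)) \<le> G r s"
        proof (cases "s \<in> {r..<1 - (1 - r) / K}")
          case True
          then have s: "r \<le> s" "s < 1 - (1 - r) / K" by auto
          have "(1 - r) / K > 0" using r K by simp
          with s have s1: "s < 1" by linarith
          have "1 - r \<le> K * (1 - s)" using s K by (simp add: field_simps)
          then have ind: "indicator {1 - K * (1 - s)..s} r * indicator {0..<1} s = (1::ennreal)"
            using r s s1 by (simp add: indicator_def)
          have "2 * pi * r / (1 - r) \<le> 2 * pi * s / (1 - s)"
            using r s s1 by (intro frac_le mult_mono) auto
          moreover have "M r \<le> M s" unfolding M_def by (rule integral_mean_mono[OF f fm _ _ _ p]) (use r s s1 in auto)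
          ultimately have "ennreal (2 * pi * r / (1 - r)) * M r * (ennreal c * W s) \<le> ennreal (2 * pi * s / (1 - s)) * M s * (ennreal c * W s)"
            by (intro mult_mono ennreal_leI) auto
          then show ?thesis unfolding G_def mult.assoc ind using True by (simp add: mult.assoc)
        qed simp
      qed
      finally show ?thesis using True by simp
    qed simp
  qed
  also have "\<dots> = (\<integral>\<^sup>+s. (\<integral>\<^sup>+r. G r s \<partial>lborel) \<partial>lborel)"
  proof (rule lborel_pair.Fubini')
    have [measurable]: "Measurable.pred (borel \<Otimes>\<^sub>M borel) (\<lambda>x::real \<times> real. snd x \<in> {1 - K * (1 - fst x)..fst x})"
      unfolding atLeastAtMost_iff by measurable
    show "case_prod (\<lambda>s r. G r s) \<in> borel_measurable (lborel \<Otimes>\<^sub>M lborel)"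
      unfolding G_def by measurable
  qed
  also have "\<dots> \<le> (\<integral>\<^sup>+s. ennreal (c * K * pi) * (ennreal (2 * s) * W s * M s * indicator {0..<1} s) \<partial>lborel)"
  proof (rule nn_integral_mono)
    fix s :: real
    show "(\<integral>\<^sup>+r. G r s \<partial>lborel) \<le> ennreal (c * K * pi) * (ennreal (2 * s) * W s * M s * indicator {0..<1} s)"
    proof (cases "s \<in> {0..<1}")
      case True
      have "(\<integral>\<^sup>+r. G r s \<partial>lborel) = (\<integral>\<^sup>+r. (ennreal (2 * pi * s / (1 - s)) * M s * (ennreal c * W s)) * indicator {1 - K * (1 - s)..s} r \<partial>lborel)"
        using True by (simp add: G_def)
      also have "\<dots> = ennreal (2 * pi * s / (1 - s)) * M s * (ennreal c * W s) * emeasure lborel {1 - K * (1 - s)..s}"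
        by (subst nn_integral_cmult) auto
      \<comment> \<open>The interval has length (K - 1) (1 - s).\<close>
      also have "\<dots> \<le> ennreal (2 * pi * s / (1 - s)) * M s * (ennreal c * W s) * ennreal (K * (1 - s))"
        using True K by (intro mult_left_mono) (auto simp: emeasure_lborel_Icc_eq intro!: ennreal_leI)
      also have "\<dots> = (ennreal (2 * pi * s / (1 - s)) * ennreal c * ennreal (K * (1 - s))) * (W s * M s)"
        by (simp add: mult_ac)
      also have "ennreal (2 * pi * s / (1 - s)) * ennreal c * ennreal (K * (1 - s)) = ennreal (c * K * pi) * ennreal (2 * s)"
        using True c K by (simp flip: ennreal_mult')
      finally show ?thesis using True by (simp add: mult_ac)
    qed (simp add: G_def)
  qed
  also have "\<dots> = ennreal (c * K * pi) * (\<integral>\<^sup>+z. ennreal (cmod (f z) powr p) \<partial>\<mu>)"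
    by (subst nn_integral_cmult) (auto simp: nn_integral_profile_polar M_def)
  finally show ?thesis by (simp add: c_def)
qed

end

section \<open>Pseudohyperbolic distance and local averages\<close>

definition moebius :: "complex \<Rightarrow> complex \<Rightarrow> complex" where
  "moebius a z = (a - z) / (1 - cnj a * z)"

lemma pseudohyp_moebius: "pseudohyp a z = cmod (moebius a z)"
  by (simp add: pseudohyp_def moebius_def)

lemma pseudohyp_nonneg [simp]: "0 \<le> pseudohyp a z"
  by (simp add: pseudohyp_def)

lemma cmod_one_minus_cnj_commute: "cmod (1 - cnj a * z) = cmod (1 - cnj z * a)"
  by (metis complex_cnj_cnj complex_cnj_diff complex_cnj_mult complex_cnj_one complex_mod_cnj mult.commute)

lemma pseudohyp_commute: "pseudohyp a z = pseudohyp z a"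
  unfolding pseudohyp_def norm_divide by (simp add: cmod_one_minus_cnj_commute[of a z] norm_minus_commute)

lemma cnj_measurable [measurable]: "cnj \<in> borel_measurable borel"
  by (intro borel_measurable_continuous_onI continuous_intros)

lemma pseudohyp_measurable [measurable]:
  assumes [measurable]: "f \<in> borel_measurable M" "g \<in> borel_measurable M"
  shows "(\<lambda>x. pseudohyp (f x) (g x)) \<in> borel_measurable M"
  unfolding pseudohyp_def by measurable

lemma pseudohyp_less_1:
  assumes "cmod a < 1" "cmod z < 1"
  shows "pseudohyp a z < 1"
proof -
  have "complex_of_real ((cmod (1 - cnj a * z))\<^sup>2 - (cmod (a - z))\<^sup>2) = complex_of_real ((1 - (cmod a)\<^sup>2) * (1 - (cmod z)\<^sup>2))"
    unfolding of_real_diff of_real_mult of_real_1 complex_norm_square by (simp add: algebra_simps)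
  then have "(cmod (1 - cnj a * z))\<^sup>2 - (cmod (a - z))\<^sup>2 = (1 - (cmod a)\<^sup>2) * (1 - (cmod z)\<^sup>2)"
    using of_real_eq_iff by blast
  also have "\<dots> > 0" using assms by (simp add: abs_square_less_1)
  finally have "(cmod (a - z))\<^sup>2 < (cmod (1 - cnj a * z))\<^sup>2" by simp
  then have "cmod (a - z) < cmod (1 - cnj a * z)" by (rule power2_less_imp_less) simp
  then show ?thesis
    by (simp add: pseudohyp_def norm_divide divide_less_eq)
qed

text \<open>Disc automorphisms preserve the pseudohyperbolic distance, so |m(u) - m(v)| is
  \<delta>(u,v) times |1 - cnj (m(u)) m(v)| for m = \<open>moebius a\<close>, and the latter is at
  least 1 - |m(u)| because |m(v)| < 1.\<close>

lemma cmod_moebius_diff: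
  assumes "cmod a < 1" "cmod u < 1" "cmod v < 1"
  shows "pseudohyp u v * (1 - pseudohyp a u) \<le> cmod (moebius a u - moebius a v)"
proof -
  have nz: "1 - cnj a * u \<noteq> 0" "1 - cnj a * v \<noteq> 0" "1 - a * cnj u \<noteq> 0" "1 - cnj u * v \<noteq> 0"
    using assms one_minus_cnj_mult_nz[of a u] one_minus_cnj_mult_nz[of a v] one_minus_cnj_mult_nz[of u v]
      one_minus_cnj_mult_nz[of u a] by (auto simp: mult.commute)
  have d: "moebius a u - moebius a v = (cnj a * a - 1) * (u - v) / ((1 - cnj a * u) * (1 - cnj a * v))"
    unfolding moebius_def using nz(1,2) by (simp add: divide_simps) (simp add: algebra_simps)
  have e: "1 - cnj (moebius a u) * moebius a v = (1 - cnj a * a) * (1 - cnj u * v) / ((1 - a * cnj u) * (1 - cnj a * v))"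
    unfolding moebius_def using nz(2,3) by (simp add: divide_simps) (simp add: algebra_simps)
  have m: "cmod (1 - a * cnj u) = cmod (1 - cnj a * u)"
    using cmod_one_minus_cnj_commute[of a u] by (simp add: mult.commute)
  have "cmod (moebius a u - moebius a v) = pseudohyp u v * cmod (1 - cnj (moebius a u) * moebius a v)"
    unfolding d e pseudohyp_def norm_divide norm_mult m norm_minus_commute[of "cnj a * a" 1]
    using nz by (simp add: field_simps)
  moreover have "1 - pseudohyp a u \<le> cmod (1 - cnj (moebius a u) * moebius a v)"
  proof -
    have "cmod (cnj (moebius a u) * moebius a v) \<le> pseudohyp a u * 1"
      unfolding norm_mult pseudohyp_moebius complex_mod_cnj
      using pseudohyp_less_1[of a v] assms by (intro mult_left_mono) (auto simp: pseudohyp_moebius)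
    then show ?thesis using norm_triangle_ineq2[of 1 "cnj (moebius a u) * moebius a v"] by simp
  qed
  ultimately show ?thesis by (simp add: mult_left_mono)
qed

section \<open>Averages over discs of Whitney type\<close>

lemma powr_add_le:
  fixes x y p :: real
  assumes "0 \<le> x" "0 \<le> y" "0 \<le> p"
  shows "(x + y) powr p \<le> 2 powr p * (x powr p + y powr p)"
proof -
  have "(x + y) powr p \<le> (2 * max x y) powr p" using assms by (intro powr_mono2) auto
  also have "\<dots> = 2 powr p * max x y powr p" using assms by (simp add: powr_mult)
  also have "max x y powr p \<le> x powr p + y powr p" by (simp add: max_def)
  finally show ?thesis by (simp add: mult_left_mono)
qed

text \<open>The indicator of a disc of Whitney type, kept as a jointly measurable function of centre
  and point: Fubini integrates out either of them.\<close>

definition whitney :: "complex \<Rightarrow> complex \<Rightarrow> ennreal" where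
  "whitney u z = (if dist u z < (1 - cmod u) / 4 then 1 else 0)"

lemma whitney_measurable [measurable]:
  assumes [measurable]: "f \<in> borel_measurable M" "g \<in> borel_measurable M"
  shows "(\<lambda>x. whitney (f x) (g x)) \<in> borel_measurable M"
  unfolding whitney_def by measurable

text \<open>Collects the comparisons valid when z lies in the Whitney disc of u. That z belongs to
  the unit disc is a consequence; the bounds are phrased from the side of z because z becomes the
  base point of the test kernels.\<close>

locale whitney_pair =
  fixes u z :: complex
  assumes u: "cmod u < 1" and near: "dist u z < (1 - cmod u) / 4"
begin

lemma near': "cmod (u - z) < (1 - cmod u) / 4" "cmod (z - u) < (1 - cmod u) / 4"
  using near by (auto simp: dist_norm norm_minus_commute)

lemma lower: "3 / 4 * (1 - cmod u) \<le> 1 - cmod z"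
  using near' norm_triangle_ineq2[of z u] by simp

lemma upper: "1 - cmod z \<le> 5 / 4 * (1 - cmod u)"
  using near' norm_triangle_ineq2[of u z] by simp

lemma z: "cmod z < 1"
  using lower u by simp

lemma dist_le: "cmod (u - z) \<le> (1 - cmod z) / 3"
  using near' lower by simp

text \<open>The constant is 2 + 1/3: 1 - |z|^2 is at most 2 (1 - |z|), and moving from z to u costs
  at most (1 - |z|) / 3.\<close>

lemma kernel_upper: "cmod (1 - cnj z * u) \<le> 7 / 3 * (1 - cmod z)"
proof -
  have "1 - cnj z * u = of_real (1 - (cmod z)\<^sup>2) + cnj z * (z - u)"
    unfolding of_real_diff complex_norm_square by (simp add: algebra_simps)
  then have "cmod (1 - cnj z * u) \<le> \<bar>1 - (cmod z)\<^sup>2\<bar> + cmod z * cmod (z - u)"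
    by (metis norm_triangle_ineq norm_of_real norm_mult complex_mod_cnj)
  also have "cmod z * cmod (z - u) \<le> 1 * cmod (u - z)"
    using z by (intro mult_mono) (auto simp: norm_minus_commute)
  also have "\<bar>1 - (cmod z)\<^sup>2\<bar> = (1 - cmod z) * (1 + cmod z)"
    using z by (simp add: power2_eq_square algebra_simps abs_if mult_le_one not_less)
  also have "\<dots> \<le> (1 - cmod z) * 2" using z by (intro mult_left_mono) auto
  finally show ?thesis using dist_le by simp
qed

lemma kernel_lower: "1 - cmod z \<le> cmod (1 - cnj z * u)"
proof -
  have "cmod (cnj z * u) \<le> cmod z * 1" using u by (simp add: norm_mult mult_left_le)
  then show ?thesis using norm_triangle_ineq2[of 1 "cnj z * u"] by simp
qed

lemma pseudohyp_le: "pseudohyp z u \<le> 1 / 3"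
proof -
  have "cmod (z - u) \<le> 1 / 3 * cmod (1 - cnj z * u)"
    using dist_le kernel_lower by (simp add: norm_minus_commute)
  moreover have "0 < cmod (1 - cnj z * u)" using kernel_lower z by linarith
  ultimately show ?thesis by (simp add: pseudohyp_def norm_divide divide_le_eq)
qed

lemma kernel_compare:
  assumes a: "cmod a < 1"
  shows "cmod (1 - cnj a * z) \<le> 5 / 4 * cmod (1 - cnj a * u)"
proof -
  have "cmod (cnj a * u) \<le> 1 * cmod u" unfolding norm_mult using a by (intro mult_right_mono) auto
  then have 1: "1 - cmod u \<le> cmod (1 - cnj a * u)" using norm_triangle_ineq2[of 1 "cnj a * u"] by simp
  have "1 - cnj a * z = (1 - cnj a * u) + cnj a * (u - z)" by (simp add: algebra_simps)
  then have "cmod (1 - cnj a * z) \<le> cmod (1 - cnj a * u) + cmod a * cmod (u - z)"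
    by (metis norm_triangle_ineq norm_mult complex_mod_cnj)
  also have "cmod a * cmod (u - z) \<le> 1 * cmod (u - z)" using a by (intro mult_right_mono) auto
  finally show ?thesis using 1 near' by simp
qed

end

text \<open>On the Whitney disc of u the integrand is bounded below by a constant multiple of its
  value at u, and the area pi (1 - |u|)^2 / 16 cancels the quadratic weight.\<close>

lemma kernel_le_whitney_average:
  assumes a: "cmod a < 1" and u: "cmod u < 1" and \<gamma>: "0 \<le> \<gamma>"
  shows "ennreal (1 / cmod (1 - cnj a * u) powr (\<gamma> + 1))
    \<le> ennreal (16 / pi * (5 / 4) powr (\<gamma> + 3)) * (\<integral>\<^sup>+z. whitney u z * ennreal (1 / cmod (1 - cnj a * z) powr (\<gamma> + 1) / (1 - cmod z)\<^sup>2) \<partial>lborel)"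
proof -
  let ?h = "1 - cmod u" and ?x = "cmod (1 - cnj a * u)"
  have h: "0 < ?h" using u by simp
  have x: "0 < ?x" using one_minus_cnj_mult_nz[of a u] a u by simp
  \<comment> \<open>The minorant of the integrand: each of the \<gamma> + 1 kernel factors and of
    the two distance factors costs 5/4.\<close>
  define c where "c = 1 / (?x powr (\<gamma> + 1) * ?h\<^sup>2) / (5 / 4) powr (\<gamma> + 3)"
  have c: "0 \<le> c" by (simp add: c_def)
  have "ennreal (c * (pi * (?h / 4)\<^sup>2)) = ennreal c * emeasure lborel (ball u (?h / 4))"
    using h c by (simp add: emeasure_ball unit_ball_vol_2 ennreal_mult')
  also have "\<dots> = (\<integral>\<^sup>+z. ennreal c * indicator (ball u (?h / 4)) z \<partial>lborel)"
    by (subst nn_integral_cmult) (auto intro!: borel_measurable_indicator)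
  also have "\<dots> \<le> (\<integral>\<^sup>+z. whitney u z * ennreal (1 / cmod (1 - cnj a * z) powr (\<gamma> + 1) / (1 - cmod z)\<^sup>2) \<partial>lborel)"
  proof (rule nn_integral_mono)
    fix z :: complex
    show "ennreal c * indicator (ball u (?h / 4)) z \<le> whitney u z * ennreal (1 / cmod (1 - cnj a * z) powr (\<gamma> + 1) / (1 - cmod z)\<^sup>2)"
    proof (cases "dist u z < ?h / 4")
      case True
      then interpret whitney_pair u z using u by unfold_locales
      let ?y = "cmod (1 - cnj a * z)"
      have y: "0 < ?y" using one_minus_cnj_mult_nz[of a z] a z by simp
      have "?y powr (\<gamma> + 1) \<le> (5 / 4 * ?x) powr (\<gamma> + 1)" using kernel_compare[OF a] \<gamma> by (intro powr_mono2) auto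
      moreover have "(1 - cmod z)\<^sup>2 \<le> (5 / 4 * ?h)\<^sup>2" using upper z by (intro power_mono) auto
      ultimately have "?y powr (\<gamma> + 1) * (1 - cmod z)\<^sup>2 \<le> (5 / 4 * ?x) powr (\<gamma> + 1) * (5 / 4 * ?h)\<^sup>2"
        by (intro mult_mono) auto
      also have "\<dots> = (5 / 4) powr (\<gamma> + 3) * (?x powr (\<gamma> + 1) * ?h\<^sup>2)"
      proof -
        have "(5 / 4 :: real) powr (\<gamma> + 3) = (5 / 4) powr (\<gamma> + 1) * (5 / 4)\<^sup>2"
          using powr_add[of "5 / 4 :: real" "\<gamma> + 1" 2] by (simp add: add.commute powr_numeral)
        moreover have "(5 / 4 * ?x) powr (\<gamma> + 1) = (5 / 4) powr (\<gamma> + 1) * ?x powr (\<gamma> + 1)"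
          by (rule powr_mult)
        ultimately show ?thesis by (simp only: power_mult_distrib mult_ac)
      qed
      finally have "c \<le> 1 / (?y powr (\<gamma> + 1) * (1 - cmod z)\<^sup>2)"
        unfolding c_def using x h y z by (simp add: frac_le mult.commute)
      then show ?thesis using True by (simp add: whitney_def indicator_def ennreal_leI)
    qed (simp add: indicator_def)
  qed
  finally have "ennreal (16 / pi * (5 / 4) powr (\<gamma> + 3)) * ennreal (c * (pi * (?h / 4)\<^sup>2)) \<le>
    ennreal (16 / pi * (5 / 4) powr (\<gamma> + 3)) * (\<integral>\<^sup>+z. whitney u z * ennreal (1 / cmod (1 - cnj a * z) powr (\<gamma> + 1) / (1 - cmod z)\<^sup>2) \<partial>lborel)"
    by (rule mult_left_mono) simp
  moreover have "16 / pi * (5 / 4) powr (\<gamma> + 3) * (c * (pi * (?h / 4)\<^sup>2)) = 1 / ?x powr (\<gamma> + 1)"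
  proof -
    have "16 / pi * P * (1 / (X * y\<^sup>2) / P * (pi * (y / 4)\<^sup>2)) = 1 / X" if "0 < y" "0 < P" for X P y :: real
      using that by (simp add: power2_eq_square)
    from this[OF h, of "(5 / 4) powr (\<gamma> + 3)"] show ?thesis unfolding c_def by fastforce
  qed
  ultimately show ?thesis by (simp flip: ennreal_mult')
qed

text \<open>The disc of radius (1 - |u|) / 8 about w still lies in the Whitney disc of u. The
  freedom to move w is what makes derivatives of f near u controllable by the average at u.\<close>

lemma powr_le_whitney_average:
  assumes f: "f holomorphic_on unit_disc" and fm[measurable]: "f \<in> borel_measurable borel" and p: "1 \<le> (p::real)"
    and u: "cmod u < 1" and w: "dist u w \<le> (1 - cmod u) / 8"
  shows "ennreal (cmod (f w) powr p) \<le> ennreal 32 * (\<integral>\<^sup>+z. whitney u z * ennreal (cmod (f z) powr p / (1 - cmod z)\<^sup>2) \<partial>lborel)"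
proof -
  let ?h = "1 - cmod u" and ?R = "(1 - cmod u) / 8"
  have h: "0 < ?h" using u by simp
  have sub: "dist u z < ?h / 4" if "z \<in> ball w ?R" for z
    using that w dist_triangle[of u z w] by simp
  have "ball w ?R \<subseteq> unit_disc"
  proof
    fix z assume "z \<in> ball w ?R"
    then interpret whitney_pair u z using u sub by unfold_locales auto
    show "z \<in> unit_disc" using z by simp
  qed
  then have fw: "f holomorphic_on ball w ?R" by (rule holomorphic_on_subset[OF f])
  have "ennreal (pi * ?R\<^sup>2) * ennreal (cmod (f w) powr p)
     \<le> (\<integral>\<^sup>+z. ennreal (cmod (f z) powr p) * indicator (ball w ?R) z \<partial>lborel)"
    using h by (intro area_submean[OF fw fm p]) simp
  also have "\<dots> \<le> (\<integral>\<^sup>+z. ennreal (25 / 16 * ?h\<^sup>2) * (whitney u z * ennreal (cmod (f z) powr p / (1 - cmod z)\<^sup>2)) \<partial>lborel)"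
  proof (rule nn_integral_mono)
    fix z :: complex
    show "ennreal (cmod (f z) powr p) * indicator (ball w ?R) z \<le> ennreal (25 / 16 * ?h\<^sup>2) * (whitney u z * ennreal (cmod (f z) powr p / (1 - cmod z)\<^sup>2))"
    proof (cases "z \<in> ball w ?R")
      case True
      then interpret whitney_pair u z using u sub by unfold_locales auto
      have "(5 / 4 * y)\<^sup>2 = 25 / 16 * y\<^sup>2" for y :: real by (simp add: power2_eq_square)
      moreover have "(1 - cmod z)\<^sup>2 \<le> (5 / 4 * ?h)\<^sup>2" using upper z by (intro power_mono) auto
      ultimately have "(1 - cmod z)\<^sup>2 \<le> 25 / 16 * ?h\<^sup>2" by metis
      then have "cmod (f z) powr p * (1 - cmod z)\<^sup>2 \<le> cmod (f z) powr p * (25 / 16 * ?h\<^sup>2)"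
        by (intro mult_left_mono) auto
      then have "cmod (f z) powr p \<le> 25 / 16 * ?h\<^sup>2 * (cmod (f z) powr p / (1 - cmod z)\<^sup>2)"
        using z by (simp add: field_simps)
      then show ?thesis using True near
        by (simp add: whitney_def ennreal_leI flip: ennreal_mult')
    qed simp
  qed
  also have "\<dots> = ennreal (25 / 16 * ?h\<^sup>2) * (\<integral>\<^sup>+z. whitney u z * ennreal (cmod (f z) powr p / (1 - cmod z)\<^sup>2) \<partial>lborel)"
    (is "_ = _ * ?I") by (rule nn_integral_cmult) measurable
  finally have "ennreal (1 / (pi * ?R\<^sup>2)) * (ennreal (pi * ?R\<^sup>2) * ennreal (cmod (f w) powr p))
      \<le> ennreal (1 / (pi * ?R\<^sup>2)) * (ennreal (25 / 16 * ?h\<^sup>2) * ?I)"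
    by (rule mult_left_mono) simp
  moreover have "ennreal (1 / (pi * ?R\<^sup>2)) * (ennreal (pi * ?R\<^sup>2) * ennreal (cmod (f w) powr p)) = ennreal (cmod (f w) powr p)"
    using h by (simp flip: ennreal_mult')
  moreover have "ennreal (1 / (pi * ?R\<^sup>2)) * (ennreal (25 / 16 * ?h\<^sup>2) * ?I) = ennreal (100 / pi) * ?I"
  proof -
    have "1 / (pi * (y / 8)\<^sup>2) * (25 / 16 * y\<^sup>2) = 100 / pi" if "0 < y" for y :: real
      using that by (simp add: power2_eq_square)
    from this[OF h] show ?thesis unfolding mult.assoc[symmetric] by (subst ennreal_mult'[symmetric]) simp_all
  qed
  \<comment> \<open>100 / pi is about 31.83.\<close>
  moreover have "ennreal (100 / pi) * ?I \<le> ennreal 32 * ?I"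
    using pi_gt3 pi_approx by (intro mult_right_mono ennreal_leI) (auto simp: field_simps)
  ultimately show ?thesis by simp
qed

text \<open>If u and v are close on the scale 1 - |u|, Cauchy's estimate for f' yields a Lipschitz
  bound; otherwise \<delta>(u,v) is at least 1/33 and the triangle inequality suffices. The constant
  72 dominates 48 = 16 * 3 from the first case and 66 = 2 * 33 from the second.\<close>

lemma diff_powr_le_whitney_average:
  assumes f: "f holomorphic_on unit_disc" and fm[measurable]: "f \<in> borel_measurable borel" and p: "1 \<le> (p::real)"
    and u: "cmod u < 1" and v: "cmod v < 1"
  shows "ennreal (cmod (f u - f v) powr p) \<le> ennreal (32 * 72 powr p * pseudohyp u v powr p) *
    ((\<integral>\<^sup>+z. whitney u z * ennreal (cmod (f z) powr p / (1 - cmod z)\<^sup>2) \<partial>lborel)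
     + (\<integral>\<^sup>+z. whitney v z * ennreal (cmod (f z) powr p / (1 - cmod z)\<^sup>2) \<partial>lborel))"
proof (cases "u = v")
  case True
  then show ?thesis by simp
next
  case uv: False
  define A where "A u = (\<integral>\<^sup>+z. whitney u z * ennreal (cmod (f z) powr p / (1 - cmod z)\<^sup>2) \<partial>lborel)" for u
  define d where "d = pseudohyp u v"
  let ?h = "1 - cmod u" and ?x = "cmod (1 - cnj u * v)"
  have h: "0 < ?h" using u by simp
  have x: "0 < ?x" using one_minus_cnj_mult_nz[of u v] u v by simp
  have d: "cmod (u - v) = d * ?x" using x by (simp add: d_def pseudohyp_def norm_divide)
  \<comment> \<open>Strict positivity matters when an average is infinite: a factor 0 would turn the
    right-hand side into 0.\<close>
  have d0: "0 < d" using d uv x by (metis norm_eq_zero eq_iff_diff_eq_0 less_eq_real_def d_def mult_zero_left pseudohyp_nonneg)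
  have xh: "?x \<le> 2 * ?h + cmod (u - v)"
  proof -
    have "1 - cnj u * v = of_real (1 - (cmod u)\<^sup>2) + cnj u * (u - v)"
      unfolding of_real_diff complex_norm_square by (simp add: algebra_simps)
    then have "?x \<le> \<bar>1 - (cmod u)\<^sup>2\<bar> + cmod u * cmod (u - v)"
      by (metis norm_triangle_ineq norm_of_real norm_mult complex_mod_cnj)
    moreover have "cmod u * cmod (u - v) \<le> 1 * cmod (u - v)" using u by (intro mult_right_mono) auto
    moreover have "(cmod u)\<^sup>2 \<le> 1" using u by (simp add: power_le_one)
    moreover have "1 - (cmod u)\<^sup>2 \<le> 2 * ?h" using sum_power2_ge_zero[of "cmod u - 1" 0] by (simp add: power2_eq_square algebra_simps)
    ultimately show ?thesis by simp
  qed
  have "ennreal (cmod (f u - f v) powr p) \<le> ennreal (32 * 72 powr p * d powr p) * (A u + A v)"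
  proof (cases "A u + A v = top")
    case True
    show ?thesis unfolding True using d0 by (simp add: ennreal_mult_top)
  next
    case fin: False
    then obtain \<alpha> \<beta> where \<alpha>: "A u = ennreal \<alpha>" "0 \<le> \<alpha>" and \<beta>: "A v = ennreal \<beta>" "0 \<le> \<beta>"
      by (cases "A u"; cases "A v") auto
    have bd: "cmod (f w) powr p \<le> 32 * \<alpha>" if "dist u w \<le> ?h / 8" for w
      using powr_le_whitney_average[OF f fm p u that] \<alpha> by (simp add: A_def[symmetric] del: ennreal_numeral flip: ennreal_mult)
    have bdv: "cmod (f v) powr p \<le> 32 * \<beta>"
      using powr_le_whitney_average[OF f fm p v, of v] v \<beta> by (simp add: A_def[symmetric] del: ennreal_numeral flip: ennreal_mult)
    have "cmod (f u - f v) powr p \<le> 32 * 72 powr p * d powr p * (\<alpha> + \<beta>)"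
    proof (cases "cmod (u - v) < ?h / 16")
      case True
      define m where "m = (32 * \<alpha>) powr (1 / p)"
      have m: "0 \<le> m" by (simp add: m_def)
      have fm: "cmod (f w) \<le> m" if "dist u w \<le> ?h / 8" for w
        using powr_mono2[OF _ _ bd[OF that], of "1 / p"] p by (simp add: m_def powr_powr)
      \<comment> \<open>A circle of radius h / 16 about such a w stays within h / 8 of u, where m
        bounds |f|.\<close>
      have D: "cmod (deriv f w) \<le> 16 * m / ?h" if w: "w \<in> ball u (?h / 16)" for w
      proof -
        have sub: "cball w (?h / 16) \<subseteq> unit_disc"
        proof
          fix y assume "y \<in> cball w (?h / 16)"
          then have "dist u y < ?h / 4" using w dist_triangle[of u y w] h by (auto simp: dist_commute)
          then interpret whitney_pair u y using u by unfold_locales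
          show "y \<in> unit_disc" using z by simp
        qed
        have "cmod ((deriv ^^ 1) f w) \<le> fact 1 * m / (?h / 16) ^ 1"
        proof (rule Cauchy_inequality)
          show "f holomorphic_on ball w (?h / 16)" by (rule holomorphic_on_subset[OF f]) (use sub in force)
          show "continuous_on (cball w (?h / 16)) f" using holomorphic_on_imp_continuous_on[OF f] continuous_on_subset sub by blast
          show "0 < ?h / 16" using h by simp
          fix y assume "cmod (w - y) = ?h / 16"
          then show "cmod (f y) \<le> m" using w dist_triangle[of u y w] by (intro fm) (simp add: dist_norm)
        qed
        then show ?thesis by (simp add: mult.commute)
      qed
      have subu: "ball u (?h / 16) \<subseteq> unit_disc"
      proof
        fix y assume "y \<in> ball u (?h / 16)"
        then have "dist u y < ?h / 4" using h by simp
        then interpret whitney_pair u y using u by unfold_locales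
        show "y \<in> unit_disc" using z by simp
      qed
      have "cmod (f u - f v) \<le> 16 * m / ?h * cmod (u - v)"
      proof (rule field_differentiable_bound[of "ball u (?h / 16)"])
        fix y assume y: "y \<in> ball u (?h / 16)"
        show "(f has_field_derivative deriv f y) (at y within ball u (?h / 16))"
          using holomorphic_derivI[OF f open_ball, of y] y subu by (auto intro: has_field_derivative_at_within)
        show "cmod (deriv f y) \<le> 16 * m / ?h" by (rule D[OF y])
      qed (use True h in \<open>auto simp: dist_norm\<close>)
      also have "\<dots> \<le> 16 * m / ?h * (d * (3 * ?h))"
        unfolding d using d0 m h xh True by (intro mult_left_mono) auto
      also have "\<dots> \<le> 72 * m * d"
      proof -
        have "16 * m / y * (d * (3 * y)) = 48 * (m * d)" if "0 < y" for y using that by simp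
        from this[OF h] show ?thesis using m d0 by (simp add: mult_ac)
      qed
      finally have "cmod (f u - f v) powr p \<le> (72 * m * d) powr p" using p by (intro powr_mono2) auto
      also have "\<dots> = 72 powr p * (32 * \<alpha>) * d powr p"
        using m d0 p \<alpha> by (simp add: powr_mult powr_powr m_def)
      also have "\<dots> \<le> 32 * 72 powr p * d powr p * (\<alpha> + \<beta>)"
        using \<beta> by (simp add: algebra_simps)
      finally show ?thesis .
    next
      case False
      then have "?x \<le> 33 * cmod (u - v)" using xh by simp
      then have "1 \<le> 33 * d" unfolding d using x by (simp add: field_simps)
      then have "1 powr p \<le> (33 * d) powr p" using p by (intro powr_mono2) auto
      then have one: "1 \<le> 33 powr p * d powr p" using d0 by (simp add: powr_mult)
      have "cmod (f u - f v) powr p \<le> (cmod (f u) + cmod (f v)) powr p"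
        using p norm_triangle_ineq4[of "f u" "f v"] by (intro powr_mono2) auto
      also have "\<dots> \<le> 2 powr p * (cmod (f u) powr p + cmod (f v) powr p)" using p by (intro powr_add_le) auto
      also have "\<dots> \<le> 2 powr p * (32 * \<alpha> + 32 * \<beta>)" using bd[of u] bdv h by (intro mult_left_mono add_mono) auto
      also have "\<dots> \<le> 2 powr p * (32 * \<alpha> + 32 * \<beta>) * (33 powr p * d powr p)"
        using one \<alpha> \<beta> mult_left_mono[of 1 "33 powr p * d powr p" "2 powr p * (32 * \<alpha> + 32 * \<beta>)"] by simp
      also have "\<dots> = 32 * 66 powr p * d powr p * (\<alpha> + \<beta>)"
        using powr_mult[of 2 33 p] by (simp add: algebra_simps)
      also have "\<dots> \<le> 32 * 72 powr p * d powr p * (\<alpha> + \<beta>)"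
        using p \<alpha> \<beta> by (intro mult_right_mono mult_left_mono powr_mono2) auto
      finally show ?thesis .
    qed
    then show ?thesis using \<alpha> \<beta> by (simp add: ennreal_leI flip: ennreal_mult ennreal_plus)
  qed
  then show ?thesis by (simp add: A_def d_def)
qed

section \<open>Differences of composition operators\<close>

context doubling_profile
begin

lemma AE_profile_unit_disc: "AE z in \<mu>. z \<in> unit_disc"
  unfolding profile_measure_def by (subst AE_density) (auto simp: indicator_def)

lemma finite_profile_measure: "finite_measure \<mu>"
proof
  have "emeasure \<mu> (space \<mu>) = (\<integral>\<^sup>+z. 1 \<partial>\<mu>)" by simp
  also have "\<dots> = (\<integral>\<^sup>+s. ennreal (2 * s) * W s * indicator {0..<1} s \<partial>lborel)"
    by (subst nn_integral_profile_polar) auto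
  also have "\<dots> \<le> (\<integral>\<^sup>+s. ennreal 2 * (W s * indicator {0..<1} s) \<partial>lborel)"
    by (intro nn_integral_mono) (auto simp: indicator_def intro!: mult_right_mono ennreal_leI simp del: ennreal_numeral)
  also have "\<dots> = ennreal 2 * tail W 0"
    unfolding tail_def by (rule nn_integral_cmult) measurable
  also have "\<dots> < \<infinity>" using tail_finite by (simp add: ennreal_mult_less_top)
  finally show "emeasure \<mu> (space \<mu>) \<noteq> \<infinity>" by simp
qed

lemma pair_profile_lborel: "pair_sigma_finite \<mu> (lborel :: complex measure)"
proof -
  interpret finite_measure \<mu> by (rule finite_profile_measure)
  show ?thesis ..
qed

lemmas profile_Fubini = pair_sigma_finite.Fubini'[OF pair_profile_lborel]

text \<open>The hypothesis \<open>loc\<close> is a Carleson-type condition: it bounds the d-weighted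
  mass of the points z whose image has \<zeta> in its Whitney disc. Replacing the kernel at the
  image by its average over \<zeta> and exchanging integrals brings this condition in, and a kernel
  integral against the regular weight remains.\<close>

lemma kernel_integral_le_local:
  assumes \<phi>[measurable]: "\<phi> \<in> borel_measurable borel" and \<phi>D: "\<And>z. z \<in> unit_disc \<Longrightarrow> \<phi> z \<in> unit_disc"
    and d[measurable]: "d \<in> borel_measurable borel" and d0: "\<And>z. 0 \<le> d z"
    and L: "0 \<le> L"
    and loc: "\<And>\<zeta>. \<zeta> \<in> unit_disc \<Longrightarrow> (\<integral>\<^sup>+z. ennreal (d z) * whitney (\<phi> z) \<zeta> \<partial>\<mu>) \<le> ennreal (L * ((1 - cmod \<zeta>) * H (cmod \<zeta>)))"
    and \<gamma>: "Cd < 2 powr \<gamma>" "1 \<le> \<gamma>" and a: "a \<in> unit_disc"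
  shows "(\<integral>\<^sup>+z. ennreal (d z / cmod (1 - cnj a * \<phi> z) powr (\<gamma> + 1)) \<partial>\<mu>)
    \<le> ennreal ((16 / pi * (5 / 4) powr (\<gamma> + 3)) * (Cc / (Cc - 1) * K * pi) * (2 * Cd / (1 - Cd / 2 powr \<gamma>)) * L
          * (H (cmod a) / (1 - cmod a) powr \<gamma>))"
proof -
  define c where "c = 16 / pi * (5 / 4) powr (\<gamma> + 3)"
  have c: "0 \<le> c" by (simp add: c_def)
  define c1 where "c1 = Cc / (Cc - 1) * K * pi"
  have c1: "0 \<le> c1" using Cc K by (simp add: c1_def)
  define c2 where "c2 = 2 * Cd / (1 - Cd / 2 powr \<gamma>)"
  have c2: "0 \<le> c2" using Cd \<gamma> by (simp add: c2_def)
  have a1: "cmod a < 1" using a by simp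
  let ?k = "\<lambda>\<zeta>. 1 / cmod (1 - cnj a * \<zeta>) powr (\<gamma> + 1)"
  let ?f = "\<lambda>\<zeta>. 1 / (1 - cnj a * \<zeta>)"
  have "(\<integral>\<^sup>+z. ennreal (d z / cmod (1 - cnj a * \<phi> z) powr (\<gamma> + 1)) \<partial>\<mu>)
    \<le> (\<integral>\<^sup>+z. ennreal c * (\<integral>\<^sup>+\<zeta>. ennreal (d z) * whitney (\<phi> z) \<zeta> * ennreal (?k \<zeta> / (1 - cmod \<zeta>)\<^sup>2) \<partial>lborel) \<partial>\<mu>)"
  proof (rule nn_integral_mono_AE, use AE_profile_unit_disc in \<open>elim eventually_mono\<close>)
    fix z assume "z \<in> unit_disc"
    then have u: "cmod (\<phi> z) < 1" using \<phi>D by fastforce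
    have "ennreal (d z / cmod (1 - cnj a * \<phi> z) powr (\<gamma> + 1)) = ennreal (d z) * ennreal (?k (\<phi> z))"
      using d0 by (simp flip: ennreal_mult)
    also have "\<dots> \<le> ennreal (d z) * (ennreal c * (\<integral>\<^sup>+\<zeta>. whitney (\<phi> z) \<zeta> * ennreal (?k \<zeta> / (1 - cmod \<zeta>)\<^sup>2) \<partial>lborel))"
      unfolding c_def using \<gamma> by (intro mult_left_mono kernel_le_whitney_average[OF a1 u]) auto
    also have "\<dots> = ennreal c * (ennreal (d z) * (\<integral>\<^sup>+\<zeta>. whitney (\<phi> z) \<zeta> * ennreal (?k \<zeta> / (1 - cmod \<zeta>)\<^sup>2) \<partial>lborel))"
      by (simp add: mult_ac)
    also have "ennreal (d z) * (\<integral>\<^sup>+\<zeta>. whitney (\<phi> z) \<zeta> * ennreal (?k \<zeta> / (1 - cmod \<zeta>)\<^sup>2) \<partial>lborel)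
       = (\<integral>\<^sup>+\<zeta>. ennreal (d z) * (whitney (\<phi> z) \<zeta> * ennreal (?k \<zeta> / (1 - cmod \<zeta>)\<^sup>2)) \<partial>lborel)"
      by (rule nn_integral_cmult[symmetric]) measurable
    finally show "ennreal (d z / cmod (1 - cnj a * \<phi> z) powr (\<gamma> + 1)) \<le> ennreal c * (\<integral>\<^sup>+\<zeta>. ennreal (d z) * whitney (\<phi> z) \<zeta> * ennreal (?k \<zeta> / (1 - cmod \<zeta>)\<^sup>2) \<partial>lborel)"
      by (simp add: mult.assoc)
  qed
  also have "\<dots> = ennreal c * (\<integral>\<^sup>+z. (\<integral>\<^sup>+\<zeta>. ennreal (d z) * whitney (\<phi> z) \<zeta> * ennreal (?k \<zeta> / (1 - cmod \<zeta>)\<^sup>2) \<partial>lborel) \<partial>\<mu>)"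
    by (rule nn_integral_cmult) measurable
  also have "(\<integral>\<^sup>+z. (\<integral>\<^sup>+\<zeta>. ennreal (d z) * whitney (\<phi> z) \<zeta> * ennreal (?k \<zeta> / (1 - cmod \<zeta>)\<^sup>2) \<partial>lborel) \<partial>\<mu>)
     = (\<integral>\<^sup>+\<zeta>. (\<integral>\<^sup>+z. ennreal (d z) * whitney (\<phi> z) \<zeta> * ennreal (?k \<zeta> / (1 - cmod \<zeta>)\<^sup>2) \<partial>\<mu>) \<partial>lborel)"
    by (rule profile_Fubini[symmetric]) measurable
  also have "\<dots> \<le> (\<integral>\<^sup>+\<zeta>. ennreal L * (ennreal (cmod (?f \<zeta>) powr (\<gamma> + 1) * (H (cmod \<zeta>) / (1 - cmod \<zeta>))) * indicator unit_disc \<zeta>) \<partial>lborel)"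
  proof (rule nn_integral_mono)
    fix \<zeta> :: complex
    have split: "(\<integral>\<^sup>+z. ennreal (d z) * whitney (\<phi> z) \<zeta> * ennreal (?k \<zeta> / (1 - cmod \<zeta>)\<^sup>2) \<partial>\<mu>)
       = (\<integral>\<^sup>+z. ennreal (d z) * whitney (\<phi> z) \<zeta> \<partial>\<mu>) * ennreal (?k \<zeta> / (1 - cmod \<zeta>)\<^sup>2)"
      by (rule nn_integral_multc) measurable
    show "(\<integral>\<^sup>+z. ennreal (d z) * whitney (\<phi> z) \<zeta> * ennreal (?k \<zeta> / (1 - cmod \<zeta>)\<^sup>2) \<partial>\<mu>)
      \<le> ennreal L * (ennreal (cmod (?f \<zeta>) powr (\<gamma> + 1) * (H (cmod \<zeta>) / (1 - cmod \<zeta>))) * indicator unit_disc \<zeta>)"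
    proof (cases "\<zeta> \<in> unit_disc")
      case True
      then have z: "0 < 1 - cmod \<zeta>" by simp
      have "(\<integral>\<^sup>+z. ennreal (d z) * whitney (\<phi> z) \<zeta> \<partial>\<mu>) * ennreal (?k \<zeta> / (1 - cmod \<zeta>)\<^sup>2)
         \<le> ennreal (L * ((1 - cmod \<zeta>) * H (cmod \<zeta>))) * ennreal (?k \<zeta> / (1 - cmod \<zeta>)\<^sup>2)"
        by (intro mult_right_mono loc True) simp
      also have "\<dots> = ennreal (L * ((1 - cmod \<zeta>) * H (cmod \<zeta>)) * (?k \<zeta> / (1 - cmod \<zeta>)\<^sup>2))"
        using L z by (intro ennreal_mult[symmetric]) auto
      also have "L * ((1 - cmod \<zeta>) * H (cmod \<zeta>)) * (?k \<zeta> / (1 - cmod \<zeta>)\<^sup>2) = L * (cmod (?f \<zeta>) powr (\<gamma> + 1) * (H (cmod \<zeta>) / (1 - cmod \<zeta>)))"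
        using z by (simp add: norm_divide powr_divide power2_eq_square)
      also have "ennreal \<dots> = ennreal L * ennreal (cmod (?f \<zeta>) powr (\<gamma> + 1) * (H (cmod \<zeta>) / (1 - cmod \<zeta>)))"
        using L by (rule ennreal_mult')
      finally show ?thesis unfolding split using True by simp
    next
      \<comment> \<open>Whitney discs of points of the unit disc do not leave it, so the integrand
        vanishes almost everywhere.\<close>
      case False
      have "AE z in \<mu>. ennreal (d z) * whitney (\<phi> z) \<zeta> * ennreal (?k \<zeta> / (1 - cmod \<zeta>)\<^sup>2) = 0"
        using AE_profile_unit_disc
      proof (elim eventually_mono)
        fix z assume "z \<in> unit_disc"
        then have u: "cmod (\<phi> z) < 1" using \<phi>D by fastforce
        have "\<not> dist (\<phi> z) \<zeta> < (1 - cmod (\<phi> z)) / 4"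
        proof
          assume "dist (\<phi> z) \<zeta> < (1 - cmod (\<phi> z)) / 4"
          then interpret whitney_pair "\<phi> z" \<zeta> using u by unfold_locales
          show False using z False by simp
        qed
        then show "ennreal (d z) * whitney (\<phi> z) \<zeta> * ennreal (?k \<zeta> / (1 - cmod \<zeta>)\<^sup>2) = 0"
          by (simp add: whitney_def)
      qed
      then have "(\<integral>\<^sup>+z. ennreal (d z) * whitney (\<phi> z) \<zeta> * ennreal (?k \<zeta> / (1 - cmod \<zeta>)\<^sup>2) \<partial>\<mu>) = 0"
        by (subst nn_integral_0_iff_AE) measurable
      then show ?thesis by simp
    qed
  qed
  also have "\<dots> = ennreal L * (\<integral>\<^sup>+\<zeta>. ennreal (cmod (?f \<zeta>) powr (\<gamma> + 1) * (H (cmod \<zeta>) / (1 - cmod \<zeta>))) * indicator unit_disc \<zeta> \<partial>lborel)"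
    by (rule nn_integral_cmult) measurable
  \<comment> \<open>The kernel is the power \<gamma> + 1 of the modulus of a holomorphic function,
    so the comparison of weights applies with this exponent in place of p.\<close>
  also have "\<dots> \<le> ennreal L * (ennreal c1 * (\<integral>\<^sup>+z. ennreal (cmod (?f z) powr (\<gamma> + 1)) \<partial>\<mu>))"
    unfolding c1_def
  proof (intro mult_left_mono norm_comparison)
    show "?f holomorphic_on unit_disc"
      using a1 by (intro holomorphic_intros) (auto simp: cnj_mult_neq_1)
  qed (use \<gamma> in auto)
  also have "\<dots> \<le> ennreal L * (ennreal c1 * ennreal (c2 * (H (cmod a) / (1 - cmod a) powr \<gamma>)))"
    unfolding c2_def using kernel_integral[OF \<gamma> a1]
    by (intro mult_left_mono) (auto simp: norm_divide powr_divide)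
  finally have "(\<integral>\<^sup>+z. ennreal (d z / cmod (1 - cnj a * \<phi> z) powr (\<gamma> + 1)) \<partial>\<mu>)
     \<le> ennreal c * (ennreal L * (ennreal c1 * ennreal (c2 * (H (cmod a) / (1 - cmod a) powr \<gamma>))))"
    by (simp add: mult_left_mono)
  also have "\<dots> = ennreal (c * c1 * c2 * L * (H (cmod a) / (1 - cmod a) powr \<gamma>))"
    using c L c1 c2 by (simp add: mult_ac flip: ennreal_mult')
  finally show ?thesis unfolding c_def c1_def c2_def .
qed

text \<open>The test functions are a power of the normalised kernel at \<open>\<zeta>\<close> and its product with
  the disc automorphism at \<open>\<zeta>\<close>: by the product rule, the differences of both control the
  difference of the automorphism, that is, the pseudohyperbolic distance.\<close>

lemma local_estimate:
  assumes \<phi>[measurable]: "\<phi> \<in> borel_measurable borel" and \<phi>D: "\<And>z. z \<in> unit_disc \<Longrightarrow> \<phi> z \<in> unit_disc"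
    and \<psi>[measurable]: "\<psi> \<in> borel_measurable borel" and \<psi>D: "\<And>z. z \<in> unit_disc \<Longrightarrow> \<psi> z \<in> unit_disc"
    and p: "1 \<le> p" and E: "0 \<le> E"
    and op: "\<And>f B. f holomorphic_on unit_disc \<Longrightarrow> f \<in> borel_measurable borel \<Longrightarrow> 0 < B \<Longrightarrow>
      (\<integral>\<^sup>+z. ennreal (cmod (f z) powr p) \<partial>\<mu>) \<le> ennreal B \<Longrightarrow>
      (\<integral>\<^sup>+z. ennreal (cmod (f (\<phi> z) - f (\<psi> z)) powr p) \<partial>\<mu>) \<le> ennreal (E * B)"
    and \<gamma>: "Cd < 2 powr \<gamma>" "1 \<le> \<gamma>" and n: "\<gamma> + 1 \<le> real n" and \<zeta>: "\<zeta> \<in> unit_disc"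
  shows "(\<integral>\<^sup>+z. ennreal (pseudohyp (\<phi> z) (\<psi> z) powr p) * whitney (\<phi> z) \<zeta> \<partial>\<mu>)
    \<le> ennreal (2 * (2 / ((3 / 7) ^ n * (2 / 3))) powr p * (2 * Cd / (1 - Cd / 2 powr \<gamma>)) * E * ((1 - cmod \<zeta>) * H (cmod \<zeta>)))"
proof -
  let ?h = "1 - cmod \<zeta>"
  have \<zeta>1: "cmod \<zeta> < 1" and h: "0 < ?h" using \<zeta> by auto
  define A where "A = 2 * Cd / (1 - Cd / 2 powr \<gamma>)"
  have A: "0 < A" using Cd \<gamma> by (simp add: A_def)
  define B where "B = A * (?h * H (cmod \<zeta>))"
  have B: "0 < B" using A h H_pos[of "cmod \<zeta>"] \<zeta>1 by (simp add: B_def)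
  \<comment> \<open>The base has modulus at most 1 on the disc, so n p \<ge> \<gamma> + 1 bounds
    |k|^p by its power \<gamma> + 1. The integer exponent keeps k holomorphic without a choice of
    branch.\<close>
  define k where "k z = (of_real ?h / (1 - cnj \<zeta> * z)) ^ n" for z
  define g where "g z = k z * moebius \<zeta> z" for z
  have [measurable]: "k \<in> borel_measurable borel" unfolding k_def by measurable
  have [measurable]: "g \<in> borel_measurable borel" unfolding g_def moebius_def by measurable
  have hk: "k holomorphic_on unit_disc"
    unfolding k_def using \<zeta>1 by (intro holomorphic_intros) (auto simp: cnj_mult_neq_1)
  have hg: "g holomorphic_on unit_disc"
    unfolding g_def moebius_def using \<zeta>1 by (intro holomorphic_intros hk) (auto simp: cnj_mult_neq_1)
  have kb: "cmod (k z) powr p \<le> ?h powr (\<gamma> + 1) * (1 / cmod (1 - cnj \<zeta> * z) powr (\<gamma> + 1))" if z: "z \<in> unit_disc" for z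
  proof -
    define q where "q = ?h / cmod (1 - cnj \<zeta> * z)"
    have "cmod (cnj \<zeta> * z) \<le> cmod \<zeta> * 1" unfolding norm_mult using z by (intro mult_mono) auto
    then have x: "?h \<le> cmod (1 - cnj \<zeta> * z)" using norm_triangle_ineq2[of 1 "cnj \<zeta> * z"] by simp
    moreover have "0 < cmod (1 - cnj \<zeta> * z)" using x h by linarith
    ultimately have q: "0 < q" "q \<le> 1" using h by (auto simp: q_def)
    have "cmod (k z) = q ^ n" using h by (simp add: k_def q_def norm_power norm_divide del: of_real_diff)
    also have "\<dots> = q powr real n" using q by (simp add: powr_realpow)
    finally have "cmod (k z) powr p = q powr (real n * p)" by (simp add: powr_powr)
    also have "\<dots> \<le> q powr (\<gamma> + 1)"
    proof (rule powr_mono')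
      have "real n * 1 \<le> real n * p" using p by (intro mult_left_mono) auto
      then show "\<gamma> + 1 \<le> real n * p" using n by simp
    qed (use q in auto)
    also have "\<dots> = ?h powr (\<gamma> + 1) * (1 / cmod (1 - cnj \<zeta> * z) powr (\<gamma> + 1))"
      using h x by (simp add: q_def powr_divide)
    finally show ?thesis .
  qed
  have gk: "cmod (g z) powr p \<le> cmod (k z) powr p" if "z \<in> unit_disc" for z
  proof -
    have "cmod (moebius \<zeta> z) \<le> 1"
      using pseudohyp_less_1[of \<zeta> z] that \<zeta>1 by (simp add: pseudohyp_moebius)
    then have "cmod (g z) \<le> cmod (k z)" by (simp add: g_def norm_mult mult_left_le)
    then show ?thesis using p by (intro powr_mono2) auto
  qed
  have nk: "(\<integral>\<^sup>+z. ennreal (cmod (k z) powr p) \<partial>\<mu>) \<le> ennreal B"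
  proof -
    have "(\<integral>\<^sup>+z. ennreal (cmod (k z) powr p) \<partial>\<mu>)
       \<le> (\<integral>\<^sup>+z. ennreal (?h powr (\<gamma> + 1)) * ennreal (1 / cmod (1 - cnj \<zeta> * z) powr (\<gamma> + 1)) \<partial>\<mu>)"
      by (rule nn_integral_mono_AE, use AE_profile_unit_disc in \<open>elim eventually_mono\<close>)
         (use kb in \<open>auto simp: ennreal_leI simp flip: ennreal_mult\<close>)
    also have "\<dots> = ennreal (?h powr (\<gamma> + 1)) * (\<integral>\<^sup>+z. ennreal (1 / cmod (1 - cnj \<zeta> * z) powr (\<gamma> + 1)) \<partial>\<mu>)"
      by (rule nn_integral_cmult) measurable
    also have "\<dots> \<le> ennreal (?h powr (\<gamma> + 1)) * ennreal (A * (H (cmod \<zeta>) / ?h powr \<gamma>))"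
      unfolding A_def by (intro mult_left_mono kernel_integral \<gamma> \<zeta>1) auto
    also have "\<dots> = ennreal (?h powr (\<gamma> + 1) * (A * (H (cmod \<zeta>) / ?h powr \<gamma>)))"
      by (rule ennreal_mult'[symmetric]) simp
    also have "?h powr (\<gamma> + 1) * (A * (H (cmod \<zeta>) / ?h powr \<gamma>)) = B"
    proof -
      have "?h powr (\<gamma> + 1) = ?h powr \<gamma> * ?h" using h by (simp add: powr_add)
      then show ?thesis using h by (simp add: B_def)
    qed
    finally show ?thesis .
  qed
  have ng: "(\<integral>\<^sup>+z. ennreal (cmod (g z) powr p) \<partial>\<mu>) \<le> ennreal B"
    by (rule order.trans[OF nn_integral_mono_AE nk], use AE_profile_unit_disc in \<open>elim eventually_mono\<close>)
       (use gk in \<open>auto intro: ennreal_leI\<close>)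
  \<comment> \<open>Near \<zeta>, (3/7)^n bounds |k| from below, and 2/3 bounds 1 -
    \<delta>(\<zeta>,u) from below.\<close>
  define c where "c = (3 / 7 :: real) ^ n * (2 / 3)"
  have c: "0 < c" by (simp add: c_def)
  let ?D = "\<lambda>f z. cmod (f (\<phi> z) - f (\<psi> z)) powr p"
  have "(\<integral>\<^sup>+z. ennreal (pseudohyp (\<phi> z) (\<psi> z) powr p) * whitney (\<phi> z) \<zeta> \<partial>\<mu>)
    \<le> (\<integral>\<^sup>+z. ennreal ((2 / c) powr p) * (ennreal (?D k z) + ennreal (?D g z)) \<partial>\<mu>)"
  proof (rule nn_integral_mono_AE, use AE_profile_unit_disc in \<open>elim eventually_mono\<close>)
    fix z assume z: "z \<in> unit_disc"
    let ?u = "\<phi> z" and ?v = "\<psi> z"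
    have uv: "cmod ?u < 1" "cmod ?v < 1" using \<phi>D[OF z] \<psi>D[OF z] by auto
    show "ennreal (pseudohyp ?u ?v powr p) * whitney ?u \<zeta> \<le> ennreal ((2 / c) powr p) * (ennreal (?D k z) + ennreal (?D g z))"
    proof (cases "dist ?u \<zeta> < (1 - cmod ?u) / 4")
      case True
      then interpret whitney_pair ?u \<zeta> using uv by unfold_locales
      have x: "0 < cmod (1 - cnj \<zeta> * ?u)" using kernel_lower h by linarith
      have "(3 / 7) ^ n \<le> cmod (k ?u)"
      proof -
        have "3 / 7 \<le> ?h / cmod (1 - cnj \<zeta> * ?u)" using kernel_upper x by (simp add: field_simps)
        then have "(3 / 7) ^ n \<le> (?h / cmod (1 - cnj \<zeta> * ?u)) ^ n" by (intro power_mono) auto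
        then show ?thesis using h by (simp add: k_def norm_power norm_divide del: of_real_diff)
      qed
      moreover have "pseudohyp ?u ?v * (2 / 3) \<le> cmod (moebius \<zeta> ?u - moebius \<zeta> ?v)"
        using pseudohyp_le by (intro order.trans[OF mult_left_mono cmod_moebius_diff[OF \<zeta>1 uv]]) auto
      ultimately have "(3 / 7) ^ n * (pseudohyp ?u ?v * (2 / 3)) \<le> cmod (k ?u) * cmod (moebius \<zeta> ?u - moebius \<zeta> ?v)"
        by (intro mult_mono) auto
      also have "\<dots> = cmod ((g ?u - g ?v) - moebius \<zeta> ?v * (k ?u - k ?v))"
        by (simp add: g_def algebra_simps flip: norm_mult)
      also have "\<dots> \<le> cmod (g ?u - g ?v) + cmod (moebius \<zeta> ?v) * cmod (k ?u - k ?v)"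
        by (metis norm_triangle_ineq4 norm_mult)
      also have "cmod (moebius \<zeta> ?v) * cmod (k ?u - k ?v) \<le> 1 * cmod (k ?u - k ?v)"
        using pseudohyp_less_1[OF \<zeta>1 uv(2)] by (intro mult_right_mono) (auto simp: pseudohyp_moebius)
      finally have "c * pseudohyp ?u ?v \<le> cmod (k ?u - k ?v) + cmod (g ?u - g ?v)"
        by (simp add: c_def mult_ac)
      then have "(c * pseudohyp ?u ?v) powr p \<le> (cmod (k ?u - k ?v) + cmod (g ?u - g ?v)) powr p"
        using c p by (intro powr_mono2) auto
      also have "\<dots> \<le> 2 powr p * (?D k z + ?D g z)" using p by (intro powr_add_le) auto
      finally have "c powr p * pseudohyp ?u ?v powr p \<le> 2 powr p * (?D k z + ?D g z)"
        using c by (simp add: powr_mult)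
      then have "pseudohyp ?u ?v powr p \<le> (2 / c) powr p * (?D k z + ?D g z)"
        using c by (simp add: powr_divide field_simps)
      then show ?thesis using True
        by (simp add: whitney_def ennreal_leI flip: ennreal_mult ennreal_plus)
    qed (simp add: whitney_def)
  qed
  also have "\<dots> = ennreal ((2 / c) powr p) * ((\<integral>\<^sup>+z. ennreal (?D k z) \<partial>\<mu>) + (\<integral>\<^sup>+z. ennreal (?D g z) \<partial>\<mu>))"
    by (subst nn_integral_cmult, measurable, subst nn_integral_add) auto
  also have "\<dots> \<le> ennreal ((2 / c) powr p) * (ennreal (E * B) + ennreal (E * B))"
    using op[OF hk _ B nk] op[OF hg _ B ng] by (intro mult_left_mono add_mono) auto
  also have "ennreal (E * B) + ennreal (E * B) = ennreal (2 * (E * B))"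
    using E B by (simp flip: ennreal_plus)
  also have "ennreal ((2 / c) powr p) * ennreal (2 * (E * B)) = ennreal ((2 / c) powr p * (2 * (E * B)))"
    by (rule ennreal_mult'[symmetric]) simp
  also have "(2 / c) powr p * (2 * (E * B)) = 2 * (2 / c) powr p * A * E * (?h * H (cmod \<zeta>))"
    by (simp add: B_def)
  finally show ?thesis by (simp add: c_def A_def)
qed


text \<open>After Fubini, the inner integral at \<zeta> is compared with the test integral at a =
  \<zeta>. Its bound contributes (1 - |\<zeta>|) H(|\<zeta>|), which against the factor (1 -
  |\<zeta>|)^(-2) of the averages produces the regular weight.\<close>

lemma operator_bound:
  assumes \<phi>[measurable]: "\<phi> \<in> borel_measurable borel" and \<phi>D: "\<And>z. z \<in> unit_disc \<Longrightarrow> \<phi> z \<in> unit_disc"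
    and \<psi>[measurable]: "\<psi> \<in> borel_measurable borel" and \<psi>D: "\<And>z. z \<in> unit_disc \<Longrightarrow> \<psi> z \<in> unit_disc"
    and p: "1 \<le> p" and e: "0 \<le> e" and \<gamma>: "0 < \<gamma>"
    and S: "\<And>a. a \<in> unit_disc \<Longrightarrow>
      (\<integral>\<^sup>+z. ennreal (pseudohyp (\<phi> z) (\<psi> z) powr p / cmod (1 - cnj a * \<phi> z) powr (\<gamma> + 1)
          + pseudohyp (\<phi> z) (\<psi> z) powr p / cmod (1 - cnj a * \<psi> z) powr (\<gamma> + 1)) \<partial>\<mu>)
      \<le> ennreal (e * (H (cmod a) / (1 - cmod a) powr \<gamma>))"
    and f: "f holomorphic_on unit_disc" and fm[measurable]: "f \<in> borel_measurable borel"
  shows "(\<integral>\<^sup>+z. ennreal (cmod (f (\<phi> z) - f (\<psi> z)) powr p) \<partial>\<mu>)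
    \<le> ennreal (32 * 72 powr p * (7 / 3) powr (\<gamma> + 1) * (Cc / (Cc - 1) * K * pi) * e) * (\<integral>\<^sup>+z. ennreal (cmod (f z) powr p) \<partial>\<mu>)"
proof -
  define c where "c = 32 * 72 powr p"
  have c: "0 \<le> c" by (simp add: c_def)
  define c1 where "c1 = (7 / 3) powr (\<gamma> + 1)"
  have c1: "0 \<le> c1" by (simp add: c1_def)
  define c2 where "c2 = Cc / (Cc - 1) * K * pi"
  have c2: "0 \<le> c2" using Cc K by (simp add: c2_def)
  let ?d = "\<lambda>z. pseudohyp (\<phi> z) (\<psi> z) powr p"
  let ?w = "\<lambda>\<zeta>. ennreal (cmod (f \<zeta>) powr p / (1 - cmod \<zeta>)\<^sup>2)"
  let ?T = "\<lambda>z \<zeta>. ennreal (?d z) * (whitney (\<phi> z) \<zeta> + whitney (\<psi> z) \<zeta>)"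
  let ?S = "\<lambda>a z. ?d z / cmod (1 - cnj a * \<phi> z) powr (\<gamma> + 1) + ?d z / cmod (1 - cnj a * \<psi> z) powr (\<gamma> + 1)"
  have "(\<integral>\<^sup>+z. ennreal (cmod (f (\<phi> z) - f (\<psi> z)) powr p) \<partial>\<mu>) \<le> (\<integral>\<^sup>+z. ennreal c * (\<integral>\<^sup>+\<zeta>. ?T z \<zeta> * ?w \<zeta> \<partial>lborel) \<partial>\<mu>)"
  proof (rule nn_integral_mono_AE, use AE_profile_unit_disc in \<open>elim eventually_mono\<close>)
    fix z assume z: "z \<in> unit_disc"
    have uv: "cmod (\<phi> z) < 1" "cmod (\<psi> z) < 1" using \<phi>D[OF z] \<psi>D[OF z] by auto
    have "ennreal (cmod (f (\<phi> z) - f (\<psi> z)) powr p) \<le> ennreal (c * ?d z) *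
       ((\<integral>\<^sup>+\<zeta>. whitney (\<phi> z) \<zeta> * ?w \<zeta> \<partial>lborel) + (\<integral>\<^sup>+\<zeta>. whitney (\<psi> z) \<zeta> * ?w \<zeta> \<partial>lborel))"
      unfolding c_def by (rule diff_powr_le_whitney_average[OF f fm p uv])
    also have "\<dots> = ennreal c * (ennreal (?d z) * (\<integral>\<^sup>+\<zeta>. whitney (\<phi> z) \<zeta> * ?w \<zeta> + whitney (\<psi> z) \<zeta> * ?w \<zeta> \<partial>lborel))"
      using c by (subst nn_integral_add) (auto simp: ennreal_mult' mult.assoc)
    also have "ennreal (?d z) * (\<integral>\<^sup>+\<zeta>. whitney (\<phi> z) \<zeta> * ?w \<zeta> + whitney (\<psi> z) \<zeta> * ?w \<zeta> \<partial>lborel)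
      = (\<integral>\<^sup>+\<zeta>. ennreal (?d z) * (whitney (\<phi> z) \<zeta> * ?w \<zeta> + whitney (\<psi> z) \<zeta> * ?w \<zeta>) \<partial>lborel)"
      by (rule nn_integral_cmult[symmetric]) measurable
    finally show "ennreal (cmod (f (\<phi> z) - f (\<psi> z)) powr p) \<le> ennreal c * (\<integral>\<^sup>+\<zeta>. ?T z \<zeta> * ?w \<zeta> \<partial>lborel)"
      by (simp add: distrib_right mult.assoc)
  qed
  also have "\<dots> = ennreal c * (\<integral>\<^sup>+z. (\<integral>\<^sup>+\<zeta>. ?T z \<zeta> * ?w \<zeta> \<partial>lborel) \<partial>\<mu>)"
    by (rule nn_integral_cmult) measurable
  also have "(\<integral>\<^sup>+z. (\<integral>\<^sup>+\<zeta>. ?T z \<zeta> * ?w \<zeta> \<partial>lborel) \<partial>\<mu>) = (\<integral>\<^sup>+\<zeta>. (\<integral>\<^sup>+z. ?T z \<zeta> * ?w \<zeta> \<partial>\<mu>) \<partial>lborel)"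
    by (rule profile_Fubini[symmetric]) measurable
  also have "\<dots> \<le> (\<integral>\<^sup>+\<zeta>. ennreal (c1 * e) * (ennreal (cmod (f \<zeta>) powr p * (H (cmod \<zeta>) / (1 - cmod \<zeta>))) * indicator unit_disc \<zeta>) \<partial>lborel)"
  proof (rule nn_integral_mono)
    fix \<zeta> :: complex
    have split: "(\<integral>\<^sup>+z. ?T z \<zeta> * ?w \<zeta> \<partial>\<mu>) = (\<integral>\<^sup>+z. ?T z \<zeta> \<partial>\<mu>) * ?w \<zeta>"
      by (rule nn_integral_multc) measurable
    \<comment> \<open>The normalised test kernel at \<zeta> is bounded below wherever \<zeta> lies
      in the Whitney disc of u, so it dominates the indicator.\<close>
    have wl: "whitney u \<zeta> \<le> ennreal (c1 * (1 - cmod \<zeta>) powr (\<gamma> + 1) * (1 / cmod (1 - cnj \<zeta> * u) powr (\<gamma> + 1))) * indicator unit_disc \<zeta>"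
      if u: "cmod u < 1" for u
    proof (cases "dist u \<zeta> < (1 - cmod u) / 4")
      case True
      then interpret whitney_pair u \<zeta> using u by unfold_locales
      have x: "0 < cmod (1 - cnj \<zeta> * u)" using kernel_lower z by linarith
      have "cmod (1 - cnj \<zeta> * u) powr (\<gamma> + 1) \<le> (7 / 3 * (1 - cmod \<zeta>)) powr (\<gamma> + 1)"
        using kernel_upper \<gamma> by (intro powr_mono2) auto
      also have "\<dots> = c1 * (1 - cmod \<zeta>) powr (\<gamma> + 1)"
        unfolding c1_def by (rule powr_mult)
      finally have "1 \<le> c1 * (1 - cmod \<zeta>) powr (\<gamma> + 1) * (1 / cmod (1 - cnj \<zeta> * u) powr (\<gamma> + 1))"
        using x by simp
      then have "ennreal 1 \<le> ennreal (c1 * (1 - cmod \<zeta>) powr (\<gamma> + 1) * (1 / cmod (1 - cnj \<zeta> * u) powr (\<gamma> + 1)))"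
        by (rule ennreal_leI)
      then show ?thesis using True z by (simp add: whitney_def)
    qed (simp add: whitney_def)
    define b where "b = c1 * (1 - cmod \<zeta>) powr (\<gamma> + 1)"
    have b: "0 \<le> b" using c1 by (simp add: b_def)
    have "(\<integral>\<^sup>+z. ?T z \<zeta> \<partial>\<mu>) \<le> (\<integral>\<^sup>+z. ennreal b * indicator unit_disc \<zeta> * ennreal (?S \<zeta> z) \<partial>\<mu>)"
    proof (rule nn_integral_mono_AE, use AE_profile_unit_disc in \<open>elim eventually_mono\<close>)
      fix z assume z: "z \<in> unit_disc"
      have uv: "cmod (\<phi> z) < 1" "cmod (\<psi> z) < 1" using \<phi>D[OF z] \<psi>D[OF z] by auto
      let ?x = "1 / cmod (1 - cnj \<zeta> * \<phi> z) powr (\<gamma> + 1)" and ?y = "1 / cmod (1 - cnj \<zeta> * \<psi> z) powr (\<gamma> + 1)"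
      have "?T z \<zeta> \<le> ennreal (?d z) * (ennreal (b * ?x) * indicator unit_disc \<zeta> + ennreal (b * ?y) * indicator unit_disc \<zeta>)"
        unfolding b_def by (intro mult_left_mono add_mono wl uv) auto
      also have "\<dots> = ennreal (?d z) * (ennreal (b * ?x) + ennreal (b * ?y)) * indicator unit_disc \<zeta>"
        by (simp add: algebra_simps)
      also have "ennreal (?d z) * (ennreal (b * ?x) + ennreal (b * ?y)) = ennreal (?d z * (b * ?x + b * ?y))"
        using b by (simp add: ennreal_mult ennreal_plus[symmetric] del: ennreal_plus)
      also have "?d z * (b * ?x + b * ?y) = b * ?S \<zeta> z" by (simp add: algebra_simps add_divide_distrib)
      also have "ennreal \<dots> = ennreal b * ennreal (?S \<zeta> z)" using b by (rule ennreal_mult')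
      finally show "?T z \<zeta> \<le> ennreal b * indicator unit_disc \<zeta> * ennreal (?S \<zeta> z)" by (simp add: mult_ac)
    qed
    also have "\<dots> = ennreal b * indicator unit_disc \<zeta> * (\<integral>\<^sup>+z. ennreal (?S \<zeta> z) \<partial>\<mu>)"
      by (rule nn_integral_cmult) measurable
    finally have T: "(\<integral>\<^sup>+z. ?T z \<zeta> \<partial>\<mu>) \<le> ennreal b * indicator unit_disc \<zeta> * (\<integral>\<^sup>+z. ennreal (?S \<zeta> z) \<partial>\<mu>)" .
    show "(\<integral>\<^sup>+z. ?T z \<zeta> * ?w \<zeta> \<partial>\<mu>) \<le> ennreal (c1 * e) * (ennreal (cmod (f \<zeta>) powr p * (H (cmod \<zeta>) / (1 - cmod \<zeta>))) * indicator unit_disc \<zeta>)"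
    proof (cases "\<zeta> \<in> unit_disc")
      case True
      then have h: "0 < 1 - cmod \<zeta>" by simp
      have "(\<integral>\<^sup>+z. ?T z \<zeta> \<partial>\<mu>) \<le> ennreal b * (\<integral>\<^sup>+z. ennreal (?S \<zeta> z) \<partial>\<mu>)" using T True by simp
      also have "\<dots> \<le> ennreal b * ennreal (e * (H (cmod \<zeta>) / (1 - cmod \<zeta>) powr \<gamma>))"
        by (intro mult_left_mono S True) auto
      also have "\<dots> = ennreal (b * (e * (H (cmod \<zeta>) / (1 - cmod \<zeta>) powr \<gamma>)))" using b by (rule ennreal_mult'[symmetric])
      also have "b * (e * (H (cmod \<zeta>) / (1 - cmod \<zeta>) powr \<gamma>)) = c1 * e * ((1 - cmod \<zeta>) * H (cmod \<zeta>))"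
        using h by (simp add: b_def powr_add)
      finally have "(\<integral>\<^sup>+z. ?T z \<zeta> \<partial>\<mu>) * ?w \<zeta> \<le> ennreal (c1 * e * ((1 - cmod \<zeta>) * H (cmod \<zeta>))) * ?w \<zeta>"
        by (rule mult_right_mono) simp
      also have "\<dots> = ennreal (c1 * e * ((1 - cmod \<zeta>) * H (cmod \<zeta>)) * (cmod (f \<zeta>) powr p / (1 - cmod \<zeta>)\<^sup>2))"
        using c1 e h by (intro ennreal_mult'[symmetric] mult_nonneg_nonneg) auto
      also have "c1 * e * ((1 - cmod \<zeta>) * H (cmod \<zeta>)) * (cmod (f \<zeta>) powr p / (1 - cmod \<zeta>)\<^sup>2)
         = c1 * e * (cmod (f \<zeta>) powr p * (H (cmod \<zeta>) / (1 - cmod \<zeta>)))"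
        using h by (simp add: power2_eq_square)
      also have "ennreal \<dots> = ennreal (c1 * e) * ennreal (cmod (f \<zeta>) powr p * (H (cmod \<zeta>) / (1 - cmod \<zeta>)))"
        using c1 e by (intro ennreal_mult') simp
      finally show ?thesis unfolding split using True by simp
    next
      case False
      then have "(\<integral>\<^sup>+z. ?T z \<zeta> \<partial>\<mu>) = 0" using T by simp
      then show ?thesis unfolding split by simp
    qed
  qed
  also have "\<dots> = ennreal (c1 * e) * (\<integral>\<^sup>+\<zeta>. ennreal (cmod (f \<zeta>) powr p * (H (cmod \<zeta>) / (1 - cmod \<zeta>))) * indicator unit_disc \<zeta> \<partial>lborel)"
    by (rule nn_integral_cmult) measurable
  also have "\<dots> \<le> ennreal (c1 * e) * (ennreal c2 * (\<integral>\<^sup>+z. ennreal (cmod (f z) powr p) \<partial>\<mu>))"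
    unfolding c2_def by (intro mult_left_mono norm_comparison f fm p) auto
  finally have "(\<integral>\<^sup>+z. ennreal (cmod (f (\<phi> z) - f (\<psi> z)) powr p) \<partial>\<mu>)
     \<le> ennreal c * (ennreal (c1 * e) * (ennreal c2 * (\<integral>\<^sup>+z. ennreal (cmod (f z) powr p) \<partial>\<mu>)))"
    by (simp add: mult_left_mono)
  also have "\<dots> = ennreal (c * c1 * c2 * e) * (\<integral>\<^sup>+z. ennreal (cmod (f z) powr p) \<partial>\<mu>)"
    using c c1 c2 e by (simp add: mult.assoc[symmetric] flip: ennreal_mult') (simp add: mult_ac)
  finally show ?thesis unfolding c_def c1_def c2_def .
qed

end

section \<open>Composition semigroups\<close>

lemma space_disc_area [simp]: "space disc_area = unit_disc"
  by (simp add: disc_area_def space_scale_measure space_restrict_space)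

text \<open>Allows all estimates to be made on p-th powers. An infinite integral makes both sides
  false, so f is not assumed to lie in the space.\<close>

lemma bergman_norm_le_iff:
  assumes e: "0 \<le> e" and p: "1 \<le> p"
  shows "bergman_norm p \<omega> f \<le> ennreal e \<longleftrightarrow> bergman_integral p \<omega> f \<le> ennreal (e powr p)"
proof (cases "bergman_integral p \<omega> f")
  case (real x)
  have "x powr (1 / p) \<le> e \<longleftrightarrow> x \<le> e powr p"
  proof
    assume "x powr (1 / p) \<le> e"
    then have "(x powr (1 / p)) powr p \<le> e powr p" using p by (intro powr_mono2) auto
    then show "x \<le> e powr p" using real p by (simp add: powr_powr)
  next
    assume "x \<le> e powr p"
    then have "x powr (1 / p) \<le> (e powr p) powr (1 / p)" using real p by (intro powr_mono2) auto
    then show "x powr (1 / p) \<le> e" using e p by (simp add: powr_powr)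
  qed
  then show ?thesis using real e by (simp add: bergman_norm_def)
next
  case top
  then show ?thesis by (simp add: bergman_norm_def top_unique)
qed

lemma bergman_opnorm_diff_commute:
  "bergman_opnorm p \<omega> (\<lambda>f z. g f z - h f z) = bergman_opnorm p \<omega> (\<lambda>f z. h f z - g f z)"
  unfolding bergman_opnorm_def bergman_norm_def bergman_integral_def norm_minus_commute[of "g _ _"] ..

text \<open>Holomorphy on the disc says nothing about values elsewhere; the zero extension is a
  Borel function on the plane.\<close>

definition cut_off :: "(complex \<Rightarrow> complex) \<Rightarrow> complex \<Rightarrow> complex" where
  "cut_off f z = (if z \<in> unit_disc then f z else 0)"

lemma cut_off_eq [simp]: "z \<in> unit_disc \<Longrightarrow> cut_off f z = f z"
  by (simp add: cut_off_def)

lemma cut_off_measurable: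
  assumes "f holomorphic_on unit_disc"
  shows "cut_off f \<in> borel_measurable borel"
  unfolding cut_off_def
  by (intro borel_measurable_continuous_on_if holomorphic_on_imp_continuous_on assms) auto

lemma cut_off_holomorphic:
  "f holomorphic_on unit_disc \<Longrightarrow> cut_off f holomorphic_on unit_disc"
  by (rule holomorphic_transform) auto

definition self_map :: "(complex \<Rightarrow> complex) \<Rightarrow> bool" where
  "self_map \<alpha> \<longleftrightarrow> \<alpha> holomorphic_on unit_disc \<and> \<alpha> ` unit_disc \<subseteq> unit_disc"

text \<open>The quantity \<open>semigroup_test_sup\<close> for two arbitrary maps, so that the roles
  of the maps can be exchanged.\<close>

definition test_sup ::
  "real \<Rightarrow> (complex \<Rightarrow> real) \<Rightarrow> real \<Rightarrow> (complex \<Rightarrow> complex) \<Rightarrow> (complex \<Rightarrow> complex) \<Rightarrow> ennreal" where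
  "test_sup p \<omega> \<gamma> \<alpha> \<beta> =
     (SUP a\<in>unit_disc.
        ennreal ((1 - cmod a) powr \<gamma>) / weight_hat \<omega> a *
        (\<integral>\<^sup>+ z. ennreal
           ((pseudohyp (\<alpha> z) (\<beta> z) powr p / cmod (1 - cnj a * \<alpha> z) powr (\<gamma> + 1) +
             pseudohyp (\<alpha> z) (\<beta> z) powr p / cmod (1 - cnj a * \<beta> z) powr (\<gamma> + 1)) * \<omega> z)
         \<partial>disc_area))"

locale doubling_weight = doubling_profile +
  fixes \<omega> :: "complex \<Rightarrow> real"
  assumes radial: "radial_weight \<omega>"
    and profile: "AE z in lborel. z \<in> unit_disc \<longrightarrow> ennreal (\<omega> z) = W (cmod z)"
    and hat: "\<And>z. weight_hat \<omega> z = tail W (cmod z)"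
begin

lemma disc_area_integral:
  assumes "g' \<in> borel_measurable borel" "\<And>z. 0 \<le> g' z" and eq: "\<And>z. z \<in> unit_disc \<Longrightarrow> g z = g' z"
  shows "(\<integral>\<^sup>+z. ennreal (g z * \<omega> z) \<partial>disc_area) = (\<integral>\<^sup>+z. ennreal (g' z) \<partial>\<mu>)"
proof -
  have "(\<integral>\<^sup>+z. ennreal (g z * \<omega> z) \<partial>disc_area) = (\<integral>\<^sup>+z. ennreal (g' z * \<omega> z) \<partial>disc_area)"
    by (intro nn_integral_cong) (simp add: eq)
  also have "\<dots> = (\<integral>\<^sup>+z. ennreal (g' z) \<partial>\<mu>)"
    by (rule nn_integral_disc_area[OF radial W_measurable profile]) (use assms in auto)
  finally show ?thesis .
qed

lemma bergman_integral_eq: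
  assumes "f' \<in> borel_measurable borel" and eq: "\<And>z. z \<in> unit_disc \<Longrightarrow> f z = f' z"
  shows "bergman_integral p \<omega> f = (\<integral>\<^sup>+z. ennreal (cmod (f' z) powr p) \<partial>\<mu>)"
  unfolding bergman_integral_def using assms by (intro disc_area_integral) auto

context
  fixes p :: real and \<alpha> \<beta> :: "complex \<Rightarrow> complex"
  assumes p: "1 \<le> p" and \<alpha>: "self_map \<alpha>" and \<beta>: "self_map \<beta>"
begin

lemma self_map_mem:
  "z \<in> unit_disc \<Longrightarrow> \<alpha> z \<in> unit_disc" "z \<in> unit_disc \<Longrightarrow> \<beta> z \<in> unit_disc"
  using \<alpha> \<beta> unfolding self_map_def by blast+

lemma self_map_cut_off:
  "cut_off \<alpha> \<in> borel_measurable borel" "cut_off \<beta> \<in> borel_measurable borel"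
  "z \<in> unit_disc \<Longrightarrow> cut_off \<alpha> z \<in> unit_disc" "z \<in> unit_disc \<Longrightarrow> cut_off \<beta> z \<in> unit_disc"
  using \<alpha> \<beta> self_map_mem by (auto simp: self_map_def intro!: cut_off_measurable)

lemma bergman_integral_diff:
  assumes f: "f \<in> borel_measurable borel" and eq: "\<And>z. z \<in> unit_disc \<Longrightarrow> g z = f z"
  shows "bergman_integral p \<omega> (\<lambda>z. g (\<alpha> z) - g (\<beta> z)) = (\<integral>\<^sup>+z. ennreal (cmod (f (cut_off \<alpha> z) - f (cut_off \<beta> z)) powr p) \<partial>\<mu>)"
proof (rule bergman_integral_eq)
  note self_map_cut_off(1,2)[measurable] and f[measurable]
  show "(\<lambda>z. f (cut_off \<alpha> z) - f (cut_off \<beta> z)) \<in> borel_measurable borel" by measurable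
qed (use self_map_mem eq in auto)

lemma test_integral_eq:
  "(\<integral>\<^sup>+ z. ennreal
      ((pseudohyp (\<alpha> z) (\<beta> z) powr p / cmod (1 - cnj a * \<alpha> z) powr (\<gamma> + 1) +
        pseudohyp (\<alpha> z) (\<beta> z) powr p / cmod (1 - cnj a * \<beta> z) powr (\<gamma> + 1)) * \<omega> z) \<partial>disc_area)
   = (\<integral>\<^sup>+ z. ennreal
      (pseudohyp (cut_off \<alpha> z) (cut_off \<beta> z) powr p / cmod (1 - cnj a * cut_off \<alpha> z) powr (\<gamma> + 1) +
        pseudohyp (cut_off \<alpha> z) (cut_off \<beta> z) powr p / cmod (1 - cnj a * cut_off \<beta> z) powr (\<gamma> + 1)) \<partial>\<mu>)"
proof (rule disc_area_integral)
  note self_map_cut_off(1,2)[measurable]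
  show "(\<lambda>z. pseudohyp (cut_off \<alpha> z) (cut_off \<beta> z) powr p / cmod (1 - cnj a * cut_off \<alpha> z) powr (\<gamma> + 1) +
        pseudohyp (cut_off \<alpha> z) (cut_off \<beta> z) powr p / cmod (1 - cnj a * cut_off \<beta> z) powr (\<gamma> + 1)) \<in> borel_measurable borel"
    by measurable
qed auto

text \<open>Homogeneity: the operator norm tests only the unit ball, so f is scaled by B^(-1/p). A
  positive upper bound B instead of the norm itself includes f = 0.\<close>

lemma opnorm_scaling:
  assumes e: "0 \<le> e" and op: "bergman_opnorm p \<omega> (\<lambda>f z. f (\<alpha> z) - f (\<beta> z)) \<le> ennreal e"
    and f: "f holomorphic_on unit_disc" and fm[measurable]: "f \<in> borel_measurable borel" and B: "0 < B"
    and fB: "(\<integral>\<^sup>+z. ennreal (cmod (f z) powr p) \<partial>\<mu>) \<le> ennreal B"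
  shows "(\<integral>\<^sup>+z. ennreal (cmod (f (cut_off \<alpha> z) - f (cut_off \<beta> z)) powr p) \<partial>\<mu>) \<le> ennreal (e powr p * B)"
proof -
  note self_map_cut_off(1,2)[measurable]
  define c where "c = (1 / B) powr (1 / p)"
  have c: "0 < c" "c powr p = 1 / B" using B p by (auto simp: c_def powr_powr)
  let ?g = "\<lambda>z. of_real c * f z"
  have scale: "cmod (of_real c * x) powr p = 1 / B * cmod x powr p" for x :: complex
    using c by (simp add: norm_mult powr_mult)
  have "bergman_integral p \<omega> ?g = (\<integral>\<^sup>+z. ennreal (cmod (?g z) powr p) \<partial>\<mu>)"
    by (rule bergman_integral_eq) auto
  also have "\<dots> = ennreal (1 / B) * (\<integral>\<^sup>+z. ennreal (cmod (f z) powr p) \<partial>\<mu>)"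
    unfolding scale using B by (subst nn_integral_cmult[symmetric]) (auto simp flip: ennreal_mult')
  also have "\<dots> \<le> ennreal (1 / B) * ennreal B" by (intro mult_left_mono fB) auto
  also have "\<dots> = ennreal (1 powr p)" using B by (simp flip: ennreal_mult')
  finally have g1: "bergman_integral p \<omega> ?g \<le> ennreal (1 powr p)" .
  then have "bergman_norm p \<omega> ?g \<le> 1" using bergman_norm_le_iff[of 1 p \<omega> ?g] p by simp
  moreover have "?g \<in> bergman_space p \<omega>"
    using f g1 by (auto simp: bergman_space_def intro!: holomorphic_intros le_less_trans[OF g1])
  ultimately have "bergman_norm p \<omega> (\<lambda>z. ?g (\<alpha> z) - ?g (\<beta> z)) \<le> bergman_opnorm p \<omega> (\<lambda>f z. f (\<alpha> z) - f (\<beta> z))"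
    unfolding bergman_opnorm_def by (intro SUP_upper2[of ?g]) auto
  then have "bergman_norm p \<omega> (\<lambda>z. ?g (\<alpha> z) - ?g (\<beta> z)) \<le> ennreal e" using op by (rule order.trans)
  then have "bergman_integral p \<omega> (\<lambda>z. ?g (\<alpha> z) - ?g (\<beta> z)) \<le> ennreal (e powr p)"
    using bergman_norm_le_iff[OF e p] by blast
  moreover have "bergman_integral p \<omega> (\<lambda>z. ?g (\<alpha> z) - ?g (\<beta> z))
      = (\<integral>\<^sup>+z. ennreal (cmod (?g (cut_off \<alpha> z) - ?g (cut_off \<beta> z)) powr p) \<partial>\<mu>)"
    by (rule bergman_integral_diff) auto
  moreover have "\<dots> = ennreal (1 / B) * (\<integral>\<^sup>+z. ennreal (cmod (f (cut_off \<alpha> z) - f (cut_off \<beta> z)) powr p) \<partial>\<mu>)"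
    unfolding right_diff_distrib[symmetric] scale
    using B by (subst nn_integral_cmult[symmetric]) (auto simp flip: ennreal_mult')
  ultimately have "ennreal (1 / B) * (\<integral>\<^sup>+z. ennreal (cmod (f (cut_off \<alpha> z) - f (cut_off \<beta> z)) powr p) \<partial>\<mu>) \<le> ennreal (e powr p)"
    (is "_ * ?I \<le> _") by simp
  then have "ennreal B * (ennreal (1 / B) * ?I) \<le> ennreal B * ennreal (e powr p)"
    by (rule mult_left_mono) simp
  moreover have "ennreal B * (ennreal (1 / B) * ?I) = ?I"
    using B by (simp add: mult.assoc[symmetric] flip: ennreal_mult')
  moreover have "ennreal B * ennreal (e powr p) = ennreal (e powr p * B)"
    using B by (simp add: mult.commute flip: ennreal_mult')
  ultimately show ?thesis by simp
qed

end

text \<open>The constant is chosen before \<alpha>, \<beta> and e; this uniformity lets it act along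
  the whole semigroup in the limit.\<close>

lemma test_sup_le_opnorm:
  assumes p: "1 \<le> p" and \<gamma>: "Cd < 2 powr \<gamma>" "1 \<le> \<gamma>"
  shows "\<exists>C\<ge>0. \<forall>\<alpha> \<beta> e. self_map \<alpha> \<longrightarrow> self_map \<beta> \<longrightarrow> 0 \<le> e \<longrightarrow>
    bergman_opnorm p \<omega> (\<lambda>f z. f (\<alpha> z) - f (\<beta> z)) \<le> ennreal e \<longrightarrow> test_sup p \<omega> \<gamma> \<alpha> \<beta> \<le> ennreal (C * e powr p)"
proof -
  define n where "n = nat \<lceil>\<gamma> + 1\<rceil>"
  have n: "\<gamma> + 1 \<le> real n" unfolding n_def by (rule real_nat_ceiling_ge)
  define c where "c = 2 * (2 / ((3 / 7) ^ n * (2 / 3))) powr p * (2 * Cd / (1 - Cd / 2 powr \<gamma>))"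
  have c: "0 \<le> c" using Cd \<gamma> by (simp add: c_def)
  define c' where "c' = (16 / pi * (5 / 4) powr (\<gamma> + 3)) * (Cc / (Cc - 1) * K * pi) * (2 * Cd / (1 - Cd / 2 powr \<gamma>))"
  have c': "0 \<le> c'" using Cd \<gamma> Cc K by (simp add: c'_def)
  show ?thesis
  proof (intro exI[of _ "2 * c' * c"] conjI allI impI)
    show "0 \<le> 2 * c' * c" using c c' by simp
    fix \<alpha> \<beta> :: "complex \<Rightarrow> complex" and e :: real
    assume \<alpha>: "self_map \<alpha>" and \<beta>: "self_map \<beta>" and e: "0 \<le> e"
      and op: "bergman_opnorm p \<omega> (\<lambda>f z. f (\<alpha> z) - f (\<beta> z)) \<le> ennreal e"
    have op': "bergman_opnorm p \<omega> (\<lambda>f z. f (\<beta> z) - f (\<alpha> z)) \<le> ennreal e"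
      using op bergman_opnorm_diff_commute[of p \<omega> "\<lambda>f z. f (\<alpha> z)"] by simp
    note self_map_cut_off(1,2)[OF p \<alpha> \<beta>, measurable]
    \<comment> \<open>Stated for arbitrary maps: the second summand of the test integral is the
      first one with the maps exchanged, as \<delta> is symmetric.\<close>
    have one: "(\<integral>\<^sup>+z. ennreal (pseudohyp (cut_off \<alpha> z) (cut_off \<beta> z) powr p / cmod (1 - cnj a * cut_off \<alpha> z) powr (\<gamma> + 1)) \<partial>\<mu>)
         \<le> ennreal (c' * (c * e powr p) * (H (cmod a) / (1 - cmod a) powr \<gamma>))"
      if \<alpha>: "self_map \<alpha>" and \<beta>: "self_map \<beta>" and a: "a \<in> unit_disc"
        and op: "bergman_opnorm p \<omega> (\<lambda>f z. f (\<alpha> z) - f (\<beta> z)) \<le> ennreal e" for a \<alpha> \<beta>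
    proof -
      note self_map_cut_off(1,2)[OF p \<alpha> \<beta>, measurable]
      have loc: "(\<integral>\<^sup>+z. ennreal (pseudohyp (cut_off \<alpha> z) (cut_off \<beta> z) powr p) * whitney (cut_off \<alpha> z) \<zeta> \<partial>\<mu>)
         \<le> ennreal (c * e powr p * ((1 - cmod \<zeta>) * H (cmod \<zeta>)))" if "\<zeta> \<in> unit_disc" for \<zeta>
        unfolding c_def
        by (rule local_estimate[OF self_map_cut_off(1)[OF p \<alpha> \<beta>] self_map_cut_off(3)[OF p \<alpha> \<beta>] self_map_cut_off(2)[OF p \<alpha> \<beta>] self_map_cut_off(4)[OF p \<alpha> \<beta>]
             p _ opnorm_scaling[OF p \<alpha> \<beta> e op] \<gamma> n that]) auto
      show ?thesis unfolding c'_def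
        by (rule kernel_integral_le_local[OF self_map_cut_off(1,3)[OF p \<alpha> \<beta>] _ _ _ loc \<gamma> a]) (use c in auto)
    qed
    show "test_sup p \<omega> \<gamma> \<alpha> \<beta> \<le> ennreal (2 * c' * c * e powr p)"
      unfolding test_sup_def
    proof (rule SUP_least)
      fix a assume a: "a \<in> unit_disc"
      then have h: "0 < 1 - cmod a" and Ha: "0 < H (cmod a)" by (auto intro!: H_pos)
      let ?X = "c' * (c * e powr p) * (H (cmod a) / (1 - cmod a) powr \<gamma>)"
      have "(\<integral>\<^sup>+ z. ennreal
          (pseudohyp (cut_off \<alpha> z) (cut_off \<beta> z) powr p / cmod (1 - cnj a * cut_off \<alpha> z) powr (\<gamma> + 1) +
            pseudohyp (cut_off \<alpha> z) (cut_off \<beta> z) powr p / cmod (1 - cnj a * cut_off \<beta> z) powr (\<gamma> + 1)) \<partial>\<mu>)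
        = (\<integral>\<^sup>+ z. ennreal (pseudohyp (cut_off \<alpha> z) (cut_off \<beta> z) powr p / cmod (1 - cnj a * cut_off \<alpha> z) powr (\<gamma> + 1)) \<partial>\<mu>)
         + (\<integral>\<^sup>+ z. ennreal (pseudohyp (cut_off \<beta> z) (cut_off \<alpha> z) powr p / cmod (1 - cnj a * cut_off \<beta> z) powr (\<gamma> + 1)) \<partial>\<mu>)"
        by (subst nn_integral_add[symmetric]) (auto simp: pseudohyp_commute[of "cut_off \<beta> _"] simp flip: ennreal_plus)
      also have "\<dots> \<le> ennreal ?X + ennreal ?X"
        by (intro add_mono one \<alpha> \<beta> a op op')
      also have "\<dots> = ennreal (2 * ?X)"
        using c c' h by (subst ennreal_plus[symmetric]) auto
      finally have I: "(\<integral>\<^sup>+ z. ennreal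
          (pseudohyp (cut_off \<alpha> z) (cut_off \<beta> z) powr p / cmod (1 - cnj a * cut_off \<alpha> z) powr (\<gamma> + 1) +
            pseudohyp (cut_off \<alpha> z) (cut_off \<beta> z) powr p / cmod (1 - cnj a * cut_off \<beta> z) powr (\<gamma> + 1)) \<partial>\<mu>) \<le> ennreal (2 * ?X)" .
      have q: "ennreal ((1 - cmod a) powr \<gamma>) / weight_hat \<omega> a = ennreal ((1 - cmod a) powr \<gamma> / H (cmod a))"
        unfolding hat using Ha by (simp add: tail_eq_H divide_ennreal)
      have "ennreal ((1 - cmod a) powr \<gamma>) / weight_hat \<omega> a *
        (\<integral>\<^sup>+ z. ennreal
           ((pseudohyp (\<alpha> z) (\<beta> z) powr p / cmod (1 - cnj a * \<alpha> z) powr (\<gamma> + 1) +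
             pseudohyp (\<alpha> z) (\<beta> z) powr p / cmod (1 - cnj a * \<beta> z) powr (\<gamma> + 1)) * \<omega> z)
         \<partial>disc_area) \<le> ennreal ((1 - cmod a) powr \<gamma> / H (cmod a)) * ennreal (2 * ?X)"
        unfolding q test_integral_eq[OF p \<alpha> \<beta>] by (intro mult_left_mono I) auto
      also have "\<dots> = ennreal ((1 - cmod a) powr \<gamma> / H (cmod a) * (2 * ?X))"
        using Ha by (intro ennreal_mult'[symmetric]) auto
      also have "(1 - cmod a) powr \<gamma> / H (cmod a) * (2 * ?X) = 2 * c' * c * e powr p"
        using Ha h by simp
      finally show "ennreal ((1 - cmod a) powr \<gamma>) / weight_hat \<omega> a *
        (\<integral>\<^sup>+ z. ennreal
           ((pseudohyp (\<alpha> z) (\<beta> z) powr p / cmod (1 - cnj a * \<alpha> z) powr (\<gamma> + 1) +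
             pseudohyp (\<alpha> z) (\<beta> z) powr p / cmod (1 - cnj a * \<beta> z) powr (\<gamma> + 1)) * \<omega> z)
         \<partial>disc_area) \<le> ennreal (2 * c' * c * e powr p)" .
    qed
  qed
qed

lemma opnorm_le_test_sup:
  assumes p: "1 \<le> p" and \<gamma>: "0 < \<gamma>"
  shows "\<exists>C\<ge>0. \<forall>\<alpha> \<beta> e. self_map \<alpha> \<longrightarrow> self_map \<beta> \<longrightarrow> 0 \<le> e \<longrightarrow> test_sup p \<omega> \<gamma> \<alpha> \<beta> \<le> ennreal e \<longrightarrow>
    bergman_opnorm p \<omega> (\<lambda>f z. f (\<alpha> z) - f (\<beta> z)) \<le> ennreal ((C * e) powr (1 / p))"
proof -
  define c where "c = 32 * 72 powr p * (7 / 3) powr (\<gamma> + 1) * (Cc / (Cc - 1) * K * pi)"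
  have c: "0 \<le> c" using Cc K by (simp add: c_def)
  show ?thesis
  proof (intro exI[of _ c] conjI allI impI c)
    fix \<alpha> \<beta> :: "complex \<Rightarrow> complex" and e :: real
    assume \<alpha>: "self_map \<alpha>" and \<beta>: "self_map \<beta>" and e: "0 \<le> e" and le: "test_sup p \<omega> \<gamma> \<alpha> \<beta> \<le> ennreal e"
    have S: "(\<integral>\<^sup>+z. ennreal (pseudohyp (cut_off \<alpha> z) (cut_off \<beta> z) powr p / cmod (1 - cnj a * cut_off \<alpha> z) powr (\<gamma> + 1)
          + pseudohyp (cut_off \<alpha> z) (cut_off \<beta> z) powr p / cmod (1 - cnj a * cut_off \<beta> z) powr (\<gamma> + 1)) \<partial>\<mu>)
      \<le> ennreal (e * (H (cmod a) / (1 - cmod a) powr \<gamma>))" (is "?I \<le> _") if a: "a \<in> unit_disc" for a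
    proof -
      have h: "0 < 1 - cmod a" and Ha: "0 < H (cmod a)" using a by (auto intro!: H_pos)
      have q: "ennreal ((1 - cmod a) powr \<gamma>) / weight_hat \<omega> a = ennreal ((1 - cmod a) powr \<gamma> / H (cmod a))"
        unfolding hat using Ha by (simp add: tail_eq_H divide_ennreal)
      have "ennreal ((1 - cmod a) powr \<gamma> / H (cmod a)) * ?I \<le> test_sup p \<omega> \<gamma> \<alpha> \<beta>"
        unfolding test_sup_def by (rule SUP_upper2[OF a]) (simp add: q test_integral_eq[OF p \<alpha> \<beta>])
      also note le
      \<comment> \<open>The prefactor is a positive finite number, so multiplying by its reciprocal
        isolates the integral.\<close>
      finally have "ennreal (H (cmod a) / (1 - cmod a) powr \<gamma>) * (ennreal ((1 - cmod a) powr \<gamma> / H (cmod a)) * ?I)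
         \<le> ennreal (H (cmod a) / (1 - cmod a) powr \<gamma>) * ennreal e"
        by (rule mult_left_mono) simp
      moreover have "ennreal (H (cmod a) / (1 - cmod a) powr \<gamma>) * (ennreal ((1 - cmod a) powr \<gamma> / H (cmod a)) * ?I) = ?I"
        using Ha h by (simp add: mult.assoc[symmetric] flip: ennreal_mult')
      moreover have "ennreal (H (cmod a) / (1 - cmod a) powr \<gamma>) * ennreal e = ennreal (e * (H (cmod a) / (1 - cmod a) powr \<gamma>))"
        using e by (subst mult.commute) (rule ennreal_mult'[symmetric])
      ultimately show ?thesis by simp
    qed
    show "bergman_opnorm p \<omega> (\<lambda>f z. f (\<alpha> z) - f (\<beta> z)) \<le> ennreal ((c * e) powr (1 / p))"
      unfolding bergman_opnorm_def
    proof (rule SUP_least)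
      fix f assume f: "f \<in> {f \<in> bergman_space p \<omega>. bergman_norm p \<omega> f \<le> 1}"
      then have hf: "f holomorphic_on unit_disc" by (auto simp: bergman_space_def)
      note fm = cut_off_measurable[OF hf]
      have "(\<integral>\<^sup>+z. ennreal (cmod (cut_off f z) powr p) \<partial>\<mu>) = bergman_integral p \<omega> f"
        by (rule bergman_integral_eq[symmetric, OF fm]) simp
      also have "\<dots> \<le> 1" using f bergman_norm_le_iff[of 1 p \<omega> f] p by simp
      finally have n1: "(\<integral>\<^sup>+z. ennreal (cmod (cut_off f z) powr p) \<partial>\<mu>) \<le> 1" .
      have "bergman_integral p \<omega> (\<lambda>z. f (\<alpha> z) - f (\<beta> z))
         = (\<integral>\<^sup>+z. ennreal (cmod (cut_off f (cut_off \<alpha> z) - cut_off f (cut_off \<beta> z)) powr p) \<partial>\<mu>)"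
        by (rule bergman_integral_diff[OF p \<alpha> \<beta> fm]) simp
      also have "\<dots> \<le> ennreal (c * e) * (\<integral>\<^sup>+z. ennreal (cmod (cut_off f z) powr p) \<partial>\<mu>)"
        unfolding c_def
        by (rule operator_bound[OF self_map_cut_off(1)[OF p \<alpha> \<beta>] self_map_cut_off(3)[OF p \<alpha> \<beta>] self_map_cut_off(2)[OF p \<alpha> \<beta>] self_map_cut_off(4)[OF p \<alpha> \<beta>]
             p e \<gamma> S cut_off_holomorphic[OF hf] fm])
      also have "\<dots> \<le> ennreal (c * e) * 1" by (intro mult_left_mono n1) simp
      also have "\<dots> = ennreal (((c * e) powr (1 / p)) powr p)"
        using c e p by (simp add: powr_powr)
      finally show "bergman_norm p \<omega> (\<lambda>z. f (\<alpha> z) - f (\<beta> z)) \<le> ennreal ((c * e) powr (1 / p))"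
        using p by (subst bergman_norm_le_iff) auto
    qed
  qed
qed

end

section \<open>Passage to the limit and the equivalence for semigroups\<close>

lemma tendsto_0_ennrealI:
  fixes f :: "'a \<Rightarrow> ennreal"
  assumes "\<And>e::real. 0 < e \<Longrightarrow> eventually (\<lambda>x. f x \<le> ennreal e) F"
  shows "(f \<longlongrightarrow> 0) F"
proof (rule order_tendstoI)
  fix a :: ennreal assume "0 < a"
  then obtain x where x: "0 < x" "x < a" using dense by blast
  then obtain e where e: "x = ennreal e" "0 < e" by (cases x) auto
  show "eventually (\<lambda>x. f x < a) F"
    using assms[OF e(2)] x e by (auto elim!: eventually_mono)
qed simp

lemma tendsto_0_ennrealD:
  fixes f :: "'a \<Rightarrow> ennreal" and e :: real
  assumes "(f \<longlongrightarrow> 0) F" "0 < e"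
  shows "eventually (\<lambda>x. f x \<le> ennreal e) F"
  using order_tendstoD(2)[OF assms(1), of "ennreal e"] assms(2) by (auto elim!: eventually_mono)

lemma doubling_weight_exists:
  assumes \<omega>: "\<omega> \<in> D_hat \<inter> D_check"
  obtains W Cd K Cc where "doubling_weight W Cd K Cc \<omega>"
proof -
  have rad: "radial_weight \<omega>" and pos: "\<And>z. z \<in> unit_disc \<Longrightarrow> 0 < weight_hat \<omega> z"
    using \<omega> by (auto simp: D_hat_def)
  obtain W where W[measurable]: "W \<in> borel_measurable borel"
    and W2: "AE z in lborel. z \<in> unit_disc \<longrightarrow> ennreal (\<omega> z) = W (cmod z)"
    and W1: "AE s in lborel. s \<in> {0..<1} \<longrightarrow> ennreal (\<omega> (of_real s)) = W s"
    by (rule radial_weight_profile[OF rad])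
  have hat: "weight_hat \<omega> z = tail W (cmod z)" for z by (rule weight_hat_eq_tail[OF W1])
  obtain Cd where Cd: "1 \<le> Cd" "\<And>r. 0 \<le> r \<Longrightarrow> r < 1 \<Longrightarrow> weight_hat \<omega> (of_real r) \<le> ennreal Cd * weight_hat \<omega> (of_real ((1 + r) / 2))"
    using \<omega> unfolding D_hat_def by blast
  obtain K Cc where K: "1 < K" "1 < Cc" "\<And>r. 0 \<le> r \<Longrightarrow> r < 1 \<Longrightarrow> ennreal Cc * weight_hat \<omega> (of_real (1 - (1 - r) / K)) \<le> weight_hat \<omega> (of_real r)"
    using \<omega> unfolding D_check_def by blast
  have hat_r: "weight_hat \<omega> (of_real r) = tail W r" if "0 \<le> r" for r using that by (simp add: hat)
  have doubling: "tail W r \<le> ennreal Cd * tail W ((1 + r) / 2)" if "0 \<le> r" "r < 1" for r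
    using Cd(2)[OF that] hat_r[of r] hat_r[of "(1 + r) / 2"] that by simp
  have reverse: "ennreal Cc * tail W (1 - (1 - r) / K) \<le> tail W r" if "0 \<le> r" "r < 1" for r
  proof -
    have "0 \<le> 1 - (1 - r) / K" using that K by (simp add: field_simps)
    then show ?thesis using K(3)[OF that] hat_r[of r] hat_r[of "1 - (1 - r) / K"] that by metis
  qed
  \<comment> \<open>The polar factor 2 s degenerates at the origin, so integrability over the disc
    controls the tail only away from 0. From 1/2 the doubling condition at r = 0 extends finiteness
    to the whole interval.\<close>
  have half: "tail W (1 / 2) < top"
  proof -
    have "tail W (1 / 2) \<le> (\<integral>\<^sup>+s. ennreal (2 * s) * W s * indicator {0..<1} s \<partial>lborel)"
      unfolding tail_def
    proof (rule nn_integral_mono)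
      fix s :: real
      show "W s * indicator {1 / 2..<1} s \<le> ennreal (2 * s) * W s * indicator {0..<1} s"
      proof (cases "s \<in> {1 / 2..<1}")
        case True
        then have "1 * W s \<le> ennreal (2 * s) * W s" by (intro mult_right_mono) auto
        then show ?thesis using True by simp
      qed simp
    qed
    also have "\<dots> = (\<integral>\<^sup>+z. ennreal 1 \<partial>profile_measure W)"
      by (subst nn_integral_profile_polar) auto
    also have "\<dots> = (\<integral>\<^sup>+z. ennreal (1 * \<omega> z) \<partial>disc_area)"
      by (rule nn_integral_disc_area[OF rad W W2, symmetric]) auto
    also have "\<dots> \<le> (\<integral>\<^sup>+z. ennreal (norm (\<omega> z)) \<partial>disc_area)"
      by (intro nn_integral_mono ennreal_leI) simp
    also have "\<dots> < top" using rad by (auto simp: radial_weight_def integrable_iff_bounded)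
    finally show ?thesis .
  qed
  have "tail W 0 \<le> ennreal Cd * tail W (1 / 2)" using doubling[of 0] by simp
  also have "\<dots> < top" using half by (simp add: ennreal_mult_less_top)
  finally have fin: "tail W 0 < top" .
  show thesis
  proof (rule that[of W Cd K Cc], unfold_locales)
    show "0 < tail W r" if "0 \<le> r" "r < 1" for r
      using pos[of "of_real r"] that hat_r[of r] by simp
  qed (use W fin Cd K doubling reverse rad W2 hat in auto)
qed

text \<open>That \<gamma>0 depends on \<omega> alone is expressed by choosing it before p and
  \<phi>. The equivalence allows any threshold \<gamma>1, so its reverse implication starts from the
  weakest assumption; the last conjunct adds that \<gamma>0 itself is a valid threshold. The
  restriction s > t0 is carried by the filter.\<close>

theorem theorem4:
  fixes \<omega> :: "complex \<Rightarrow> real"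
  assumes "\<omega> \<in> D_hat \<inter> D_check"
  shows "\<exists>\<gamma>0>0. \<forall>(p::real) (\<phi> :: real \<Rightarrow> complex \<Rightarrow> complex).
    1 \<le> p \<longrightarrow> analytic_semigroup \<phi> \<longrightarrow>
      (eventually_norm_continuous p \<omega> \<phi> \<longleftrightarrow>
        (\<exists>\<gamma>1>0. \<exists>t0>0. \<forall>\<gamma>>\<gamma>1. \<forall>t>t0.
          ((\<lambda>s. semigroup_test_sup p \<omega> \<phi> \<gamma> t s) \<longlongrightarrow> 0) (at t within {t0<..}))) \<and>
      (eventually_norm_continuous p \<omega> \<phi> \<longrightarrow>
        (\<exists>t0>0. \<forall>\<gamma>>\<gamma>0. \<forall>t>t0.
          ((\<lambda>s. semigroup_test_sup p \<omega> \<phi> \<gamma> t s) \<longlongrightarrow> 0) (at t within {t0<..})))"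
proof -
  obtain W Cd K Cc where "doubling_weight W Cd K Cc \<omega>"
    using doubling_weight_exists[OF assms] by blast
  then interpret doubling_weight W Cd K Cc \<omega> .
  \<comment> \<open>The logarithm makes the geometric ratio Cd / 2^\<gamma> less than 1; the value 1
    keeps the exponent \<gamma> - 1 of the circle estimate non-negative.\<close>
  define \<gamma>0 where "\<gamma>0 = max 1 (log 2 Cd)"
  have \<gamma>0: "0 < \<gamma>0" by (simp add: \<gamma>0_def)
  have large: "Cd < 2 powr \<gamma>" "1 \<le> \<gamma>" if "\<gamma>0 < \<gamma>" for \<gamma>
  proof -
    have "log 2 Cd < \<gamma>" using that by (simp add: \<gamma>0_def)
    then show "Cd < 2 powr \<gamma>" using Cd by (simp add: log_less_iff)
    show "1 \<le> \<gamma>" using that by (simp add: \<gamma>0_def)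
  qed
  have semigroup_test_sup: "semigroup_test_sup p \<omega> \<phi> \<gamma> t s = test_sup p \<omega> \<gamma> (\<phi> t) (\<phi> s)" for p \<phi> \<gamma> t s
    by (simp add: semigroup_test_sup_def test_sup_def)
  have necessary: "\<exists>t0>0. \<forall>\<gamma>>\<gamma>0. \<forall>t>t0. ((\<lambda>s. semigroup_test_sup p \<omega> \<phi> \<gamma> t s) \<longlongrightarrow> 0) (at t within {t0<..})"
    if p: "1 \<le> p" and \<phi>: "analytic_semigroup \<phi>" and enc: "eventually_norm_continuous p \<omega> \<phi>" for p \<phi>
  proof -
    have self: "self_map (\<phi> t)" if "0 \<le> t" for t
      using \<phi> that by (auto simp: analytic_semigroup_def self_map_def)
    obtain t0 where t0: "0 < t0" and lim: "\<And>t. t0 < t \<Longrightarrow>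
        ((\<lambda>s. bergman_opnorm p \<omega> (\<lambda>f z. comp_op \<phi> s f z - comp_op \<phi> t f z)) \<longlongrightarrow> 0) (at t)"
      using enc by (auto simp: eventually_norm_continuous_def)
    have "((\<lambda>s. semigroup_test_sup p \<omega> \<phi> \<gamma> t s) \<longlongrightarrow> 0) (at t within {t0<..})" if \<gamma>: "\<gamma>0 < \<gamma>" and t: "t0 < t" for \<gamma> t
    proof (rule tendsto_0_ennrealI)
      fix e :: real assume e: "0 < e"
      obtain C where C: "0 \<le> C" "\<And>\<alpha> \<beta> e. self_map \<alpha> \<Longrightarrow> self_map \<beta> \<Longrightarrow> 0 \<le> e \<Longrightarrow>
          bergman_opnorm p \<omega> (\<lambda>f z. f (\<alpha> z) - f (\<beta> z)) \<le> ennreal e \<Longrightarrow> test_sup p \<omega> \<gamma> \<alpha> \<beta> \<le> ennreal (C * e powr p)"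
        using test_sup_le_opnorm[OF p large[OF \<gamma>]] by blast
      \<comment> \<open>Solves C d^p \<le> e; adding 1 covers C = 0.\<close>
      define d where "d = (e / (C + 1)) powr (1 / p)"
      have d: "0 < d" using e C by (simp add: d_def)
      have "C * d powr p \<le> e" using e C p by (simp add: d_def powr_powr field_simps)
      have "((\<lambda>s. bergman_opnorm p \<omega> (\<lambda>f z. comp_op \<phi> s f z - comp_op \<phi> t f z)) \<longlongrightarrow> 0) (at t within {t0<..})"
        using lim[OF t] by (rule tendsto_within_subset) simp
      from tendsto_0_ennrealD[OF this d]
      have "eventually (\<lambda>s. bergman_opnorm p \<omega> (\<lambda>f z. comp_op \<phi> s f z - comp_op \<phi> t f z) \<le> ennreal d \<and> t0 < s) (at t within {t0<..})"
        by (intro eventually_conj) (auto simp: eventually_at_filter)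
      then show "eventually (\<lambda>s. semigroup_test_sup p \<omega> \<phi> \<gamma> t s \<le> ennreal e) (at t within {t0<..})"
      proof (elim eventually_mono)
        fix s assume s: "bergman_opnorm p \<omega> (\<lambda>f z. comp_op \<phi> s f z - comp_op \<phi> t f z) \<le> ennreal d \<and> t0 < s"
        then have "bergman_opnorm p \<omega> (\<lambda>f z. f (\<phi> t z) - f (\<phi> s z)) \<le> ennreal d"
          using bergman_opnorm_diff_commute[of p \<omega> "\<lambda>f z. f (\<phi> t z)" "\<lambda>f z. f (\<phi> s z)"] by (simp add: comp_op_def)
        then have "test_sup p \<omega> \<gamma> (\<phi> t) (\<phi> s) \<le> ennreal (C * d powr p)"
          using s t t0 d by (intro C(2) self) auto
        also have "\<dots> \<le> ennreal e" by (rule ennreal_leI) fact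
        finally show "semigroup_test_sup p \<omega> \<phi> \<gamma> t s \<le> ennreal e" by (simp add: semigroup_test_sup)
      qed
    qed
    then show ?thesis using t0 by blast
  qed
  have sufficient: "eventually_norm_continuous p \<omega> \<phi>"
    if p: "1 \<le> p" and \<phi>: "analytic_semigroup \<phi>" and \<gamma>1: "0 < \<gamma>1" and t0: "0 < t0"
      and lim: "\<forall>\<gamma>>\<gamma>1. \<forall>t>t0. ((\<lambda>s. semigroup_test_sup p \<omega> \<phi> \<gamma> t s) \<longlongrightarrow> 0) (at t within {t0<..})" for p \<phi> \<gamma>1 t0
    unfolding eventually_norm_continuous_def
  proof (intro exI[of _ t0] conjI allI impI t0 tendsto_0_ennrealI)
    have self: "self_map (\<phi> t)" if "0 \<le> t" for t
      using \<phi> that by (auto simp: analytic_semigroup_def self_map_def)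
    fix t e :: real assume t: "t0 < t" and e: "0 < e"
    \<comment> \<open>One admissible exponent is enough for the upper bound of the operator
      norm.\<close>
    define \<gamma> where "\<gamma> = \<gamma>1 + 1"
    have \<gamma>: "\<gamma>1 < \<gamma>" "0 < \<gamma>" using \<gamma>1 by (auto simp: \<gamma>_def)
    obtain C where C: "0 \<le> C" "\<And>\<alpha> \<beta> e. self_map \<alpha> \<Longrightarrow> self_map \<beta> \<Longrightarrow> 0 \<le> e \<Longrightarrow> test_sup p \<omega> \<gamma> \<alpha> \<beta> \<le> ennreal e \<Longrightarrow>
        bergman_opnorm p \<omega> (\<lambda>f z. f (\<alpha> z) - f (\<beta> z)) \<le> ennreal ((C * e) powr (1 / p))"
      using opnorm_le_test_sup[OF p \<gamma>(2)] by blast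
    define d where "d = e powr p / (C + 1)"
    have d: "0 < d" using e C by (simp add: d_def)
    have "C * d \<le> e powr p" using e C by (simp add: d_def field_simps)
    then have "(C * d) powr (1 / p) \<le> (e powr p) powr (1 / p)" using C d p by (intro powr_mono2) auto
    then have Cd: "(C * d) powr (1 / p) \<le> e" using e p by (simp add: powr_powr)
    \<comment> \<open>The half-line is an open neighbourhood of t, so the one-sided restriction on s
      does not change the limit.\<close>
    have at: "at t within {t0<..} = at t" using t by (intro at_within_open) auto
    have "((\<lambda>s. semigroup_test_sup p \<omega> \<phi> \<gamma> t s) \<longlongrightarrow> 0) (at t)" using lim \<gamma> t at by metis
    from tendsto_0_ennrealD[OF this d]
    have "eventually (\<lambda>s. semigroup_test_sup p \<omega> \<phi> \<gamma> t s \<le> ennreal d) (at t)" .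
    moreover have "eventually (\<lambda>s. s \<in> {t0<..}) (at t)"
      using t by (intro eventually_at_in_open') auto
    ultimately show "eventually (\<lambda>s. bergman_opnorm p \<omega> (\<lambda>f z. comp_op \<phi> s f z - comp_op \<phi> t f z) \<le> ennreal e) (at t)"
    proof eventually_elim
      case (elim s)
      have "bergman_opnorm p \<omega> (\<lambda>f z. f (\<phi> t z) - f (\<phi> s z)) \<le> ennreal ((C * d) powr (1 / p))"
        using elim t t0 d by (intro C(2) self) (auto simp: semigroup_test_sup)
      also have "\<dots> \<le> ennreal e" by (rule ennreal_leI) fact
      finally show ?case
        using bergman_opnorm_diff_commute[of p \<omega> "\<lambda>f z. f (\<phi> t z)" "\<lambda>f z. f (\<phi> s z)"] by (simp add: comp_op_def)
    qed
  qed
  show ?thesis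
  proof (rule exI[of _ \<gamma>0], intro conjI allI impI iffI)
    show "0 < \<gamma>0" by fact
    fix p :: real and \<phi> :: "real \<Rightarrow> complex \<Rightarrow> complex"
    assume p: "1 \<le> p" and \<phi>: "analytic_semigroup \<phi>"
    {
      assume enc: "eventually_norm_continuous p \<omega> \<phi>"
      show "\<exists>t0>0. \<forall>\<gamma>>\<gamma>0. \<forall>t>t0. ((\<lambda>s. semigroup_test_sup p \<omega> \<phi> \<gamma> t s) \<longlongrightarrow> 0) (at t within {t0<..})"
        by (rule necessary[OF p \<phi> enc])
      with \<gamma>0 show "\<exists>\<gamma>1>0. \<exists>t0>0. \<forall>\<gamma>>\<gamma>1. \<forall>t>t0. ((\<lambda>s. semigroup_test_sup p \<omega> \<phi> \<gamma> t s) \<longlongrightarrow> 0) (at t within {t0<..})"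
        by (rule exI[of _ \<gamma>0, OF conjI])
    }
    assume "\<exists>\<gamma>1>0. \<exists>t0>0. \<forall>\<gamma>>\<gamma>1. \<forall>t>t0. ((\<lambda>s. semigroup_test_sup p \<omega> \<phi> \<gamma> t s) \<longlongrightarrow> 0) (at t within {t0<..})"
    then obtain \<gamma>1 t0 where "0 < \<gamma>1" "0 < t0"
      "\<forall>\<gamma>>\<gamma>1. \<forall>t>t0. ((\<lambda>s. semigroup_test_sup p \<omega> \<phi> \<gamma> t s) \<longlongrightarrow> 0) (at t within {t0<..})"
      by (elim exE conjE)
    then show "eventually_norm_continuous p \<omega> \<phi>" by (rule sufficient[OF p \<phi>])
  qed
qed

end
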